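(* Let $G$ be a non-discrete LCA group with dual $\Gamma$, $V$ an open neighbourhood of $0\in\Gamma$ with compact closure $\bar V$, and for $1\le p<\infty$ let $\mathcal A_p(\Gamma):=\{\psi\in\mathcal A(\Gamma):\psi\in L^p(\Gamma)\}$ with norm $\|\psi\|_{\mathcal A_p}:=\|\psi\|^{\bar V}+\|\psi\|_p$ ($L^p$ with respect to Haar measure on $\Gamma$). For $1\le p<q<\infty$: (i) $(\mathcal A_p(\Gamma),\|\cdot\|_{\mathcal A_p})$ is an isometrically translation invariant Segal algebra in $\mathcal A(\Gamma)$; (ii) $\mathcal A_p(\Gamma)\subsetneqq\mathcal A_q(\Gamma)$.
   Context: $G$ non-discrete LCA with dual $\Gamma$, $(x,\gamma)=\gamma(x)$. For $E\subseteq\Gamma$, $\mathrm{span}(E)$ is the span of the characters in $E$ as functions on $G$, each $p=\sum\hat p(\gamma)\gamma$ uniquely, $\|p\|_\infty=\sup_G|p|$. For $\phi\in C_b(\Gamma)$: $\|\phi\|^{\bar V,\gamma}=\sup\{|\sum_{\gamma'\in\bar V+\gamma}\hat p(\gamma')\phi(\gamma')|:p\in\mathrm{span}(\bar V+\gamma),\|p\|_\infty\le1\}$, $\|\phi\|^{\bar V}=\sup_\gamma\|\phi\|^{\bar V,\gamma}$, $C^{\bar V}_{BSE}(\Gamma)=\{\phi\in C_b(\Gamma):\|\phi\|^{\bar V}<\infty\}$. With $\mathcal K(\Gamma)$ the compact subsets of $\Gamma$ with dense nonempty interior directed by inclusion, $\mathcal A(\Gamma)=\{\psi\in C^{\bar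 V}_{BSE}(\Gamma):\lim_{\Omega\in\mathcal K(\Gamma)}\sup_{\gamma\notin\Omega}\|\psi\|^{\bar V,\gamma}=0\}$, a commutative Banach function algebra under $\|\cdot\|^{\bar V}$. A Segal algebra in $\mathcal A(\Gamma)$ is a dense ideal $\mathcal S$ that is a Banach space under a norm $\|\cdot\|_{\mathcal S}\ge\|\cdot\|^{\bar V}$, with $\|\phi\psi\|_{\mathcal S}\le\|\phi\|_{\mathcal S}\|\psi\|^{\bar V}$ ($\phi\in\mathcal S,\psi\in\mathcal A(\Gamma)$), and having approximate units (for each $\phi\in\mathcal S$, $\varepsilon>0$ some $u\in\mathcal S$ has $\|\phi-u\phi\|_{\mathcal S}<\varepsilon$); it is isometrically translation invariant if $\psi\in\mathcal S$ implies $\psi(\cdot-\gamma)\in\mathcal S$ with the same norm for all $\gamma\in\Gamma$. *)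

theory Defs
  imports "HOL-Analysis.Analysis"
begin

text \<open>
  G is the type 'g (a locally compact Hausdorff abelian topological group),
  its dual Gamma is the type 'c, identified with the continuous characters
  of G via the pairing chi x gamma = (x, gamma) = gamma(x).
\<close>

definition LCA_group :: "'g::{topological_ab_group_add,t2_space} itself \<Rightarrow> bool" where
  "LCA_group _ \<longleftrightarrow> (\<forall>x::'g. \<exists>K. compact K \<and> x \<in> interior K)"

text \<open>chi realises 'c as the Pontryagin dual of 'g: 'c is (via chi) exactly the group of
  continuous characters of 'g under pointwise multiplication, carrying the topology of
  uniform convergence on compacta (= compact-open topology).\<close>
definition dual_pairing ::
  "('g::topological_ab_group_add \<Rightarrow> 'c::{topological_space,ab_group_add} \<Rightarrow> complex) \<Rightarrow> bool" where
  "dual_pairing chi \<longleftrightarrow>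
     (\<forall>\<gamma>. continuous_on UNIV (\<lambda>x. chi x \<gamma>)) \<and>
     (\<forall>x \<gamma>. cmod (chi x \<gamma>) = 1) \<and>
     (\<forall>x y \<gamma>. chi (x + y) \<gamma> = chi x \<gamma> * chi y \<gamma>) \<and>
     (\<forall>x \<gamma> \<gamma>'. chi x (\<gamma> + \<gamma>') = chi x \<gamma> * chi x \<gamma>') \<and>
     (\<forall>\<gamma> \<gamma>'. (\<forall>x. chi x \<gamma> = chi x \<gamma>') \<longrightarrow> \<gamma> = \<gamma>') \<and>
     (\<forall>f. continuous_on UNIV f \<and> (\<forall>x. cmod (f x) = 1) \<and> (\<forall>x y. f (x + y) = f x * f y)
          \<longrightarrow> (\<exists>\<gamma>. \<forall>x. f x = chi x \<gamma>)) \<and>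
     (\<forall>S::'c set. open S \<longleftrightarrow>
        (\<forall>\<gamma>\<in>S. \<exists>K e. compact K \<and> e > 0 \<and>
            {\<gamma>'. \<forall>x\<in>K. cmod (chi x \<gamma>' - chi x \<gamma>) < e} \<subseteq> S))"

definition haar_measure :: "'c::{topological_space,ab_group_add} measure \<Rightarrow> bool" where
  "haar_measure \<mu> \<longleftrightarrow>
     sets \<mu> = sets borel \<and> space \<mu> = UNIV \<and>
     (\<forall>A\<in>sets borel. \<forall>\<gamma>. emeasure \<mu> ((\<lambda>x. \<gamma> + x) ` A) = emeasure \<mu> A) \<and>
     (\<forall>K. compact K \<longrightarrow> emeasure \<mu> K < \<infinity>) \<and>
     (\<forall>U. open U \<and> U \<noteq> {} \<longrightarrow> emeasure \<mu> U > 0) \<and>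
     (\<forall>A\<in>sets borel. emeasure \<mu> A = (INF U\<in>{U. open U \<and> A \<subseteq> U}. emeasure \<mu> U)) \<and>
     (\<forall>U. open U \<longrightarrow> emeasure \<mu> U = (SUP K\<in>{K. compact K \<and> K \<subseteq> U}. emeasure \<mu> K))"

text \<open>Trigonometric polynomials with frequencies in E, represented by their
  (unique) finitely supported coefficient functions.\<close>
definition span_coeffs :: "'c set \<Rightarrow> ('c \<Rightarrow> complex) set" where
  "span_coeffs E = {c. finite {\<gamma>. c \<gamma> \<noteq> 0} \<and> {\<gamma>. c \<gamma> \<noteq> 0} \<subseteq> E}"

definition tp_eval :: "('g \<Rightarrow> 'c \<Rightarrow> complex) \<Rightarrow> ('c \<Rightarrow> complex) \<Rightarrow> 'g \<Rightarrow> complex" where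
  "tp_eval chi c x = (\<Sum>\<gamma>\<in>{\<gamma>. c \<gamma> \<noteq> 0}. c \<gamma> * chi x \<gamma>)"

definition loc_norm ::
  "('g \<Rightarrow> 'c::ab_group_add \<Rightarrow> complex) \<Rightarrow> 'c set \<Rightarrow> ('c \<Rightarrow> complex) \<Rightarrow> 'c \<Rightarrow> ereal" where
  "loc_norm chi Vb \<phi> \<gamma> =
     (SUP c\<in>{c \<in> span_coeffs ((\<lambda>v. v + \<gamma>) ` Vb). \<forall>x. cmod (tp_eval chi c x) \<le> 1}.
        ereal (cmod (\<Sum>\<gamma>'\<in>{\<gamma>'. c \<gamma>' \<noteq> 0}. c \<gamma>' * \<phi> \<gamma>')))"

definition bse_norm ::
  "('g \<Rightarrow> 'c::ab_group_add \<Rightarrow> complex) \<Rightarrow> 'c set \<Rightarrow> ('c \<Rightarrow> complex) \<Rightarrow> ereal" where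
  "bse_norm chi Vb \<phi> = (SUP \<gamma>. loc_norm chi Vb \<phi> \<gamma>)"

definition Cb :: "('c::topological_space \<Rightarrow> complex) set" where
  "Cb = {\<phi>. continuous_on UNIV \<phi> \<and> bounded (range \<phi>)}"

definition C_BSE ::
  "('g \<Rightarrow> 'c::{topological_space,ab_group_add} \<Rightarrow> complex) \<Rightarrow> 'c set \<Rightarrow> ('c \<Rightarrow> complex) set" where
  "C_BSE chi Vb = {\<phi>\<in>Cb. bse_norm chi Vb \<phi> < \<infinity>}"

definition Kfam :: "'c::topological_space set set" where
  "Kfam = {\<Omega>. compact \<Omega> \<and> interior \<Omega> \<noteq> {} \<and> \<Omega> \<subseteq> closure (interior \<Omega>)}"

definition Aalg ::
  "('g \<Rightarrow> 'c::{topological_space,ab_group_add} \<Rightarrow> complex) \<Rightarrow> 'c set \<Rightarrow> ('c \<Rightarrow> complex) set" where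
  "Aalg chi Vb = {\<psi>\<in>C_BSE chi Vb. \<forall>e>0. \<exists>\<Omega>0\<in>Kfam. \<forall>\<Omega>\<in>Kfam. \<Omega>0 \<subseteq> \<Omega> \<longrightarrow>
       (SUP \<gamma>\<in>- \<Omega>. loc_norm chi Vb \<psi> \<gamma>) \<le> ereal e}"

definition Anorm ::
  "('g \<Rightarrow> 'c::ab_group_add \<Rightarrow> complex) \<Rightarrow> 'c set \<Rightarrow> ('c \<Rightarrow> complex) \<Rightarrow> real" where
  "Anorm chi Vb \<phi> = real_of_ereal (bse_norm chi Vb \<phi>)"

definition Lp_set :: "'c measure \<Rightarrow> real \<Rightarrow> ('c \<Rightarrow> complex) set" where
  "Lp_set \<mu> p = {\<psi>. \<psi> \<in> borel_measurable \<mu> \<and>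
       (\<integral>\<^sup>+ \<gamma>. ennreal (cmod (\<psi> \<gamma>) powr p) \<partial>\<mu>) < \<infinity>}"

definition Lp_norm :: "'c measure \<Rightarrow> real \<Rightarrow> ('c \<Rightarrow> complex) \<Rightarrow> real" where
  "Lp_norm \<mu> p \<psi> = enn2real (\<integral>\<^sup>+ \<gamma>. ennreal (cmod (\<psi> \<gamma>) powr p) \<partial>\<mu>) powr (1 / p)"

definition Ap_set ::
  "('g \<Rightarrow> 'c::{topological_space,ab_group_add} \<Rightarrow> complex) \<Rightarrow> 'c set \<Rightarrow> 'c measure \<Rightarrow> real
     \<Rightarrow> ('c \<Rightarrow> complex) set" where
  "Ap_set chi Vb \<mu> p = Aalg chi Vb \<inter> Lp_set \<mu> p"

definition Ap_norm ::
  "('g \<Rightarrow> 'c::{topological_space,ab_group_add} \<Rightarrow> complex) \<Rightarrow> 'c set \<Rightarrow> 'c measure \<Rightarrow> real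
     \<Rightarrow> ('c \<Rightarrow> complex) \<Rightarrow> real" where
  "Ap_norm chi Vb \<mu> p \<psi> = Anorm chi Vb \<psi> + Lp_norm \<mu> p \<psi>"

definition banach_fun_space :: "('c \<Rightarrow> complex) set \<Rightarrow> (('c \<Rightarrow> complex) \<Rightarrow> real) \<Rightarrow> bool" where
  "banach_fun_space S nS \<longleftrightarrow>
     (\<lambda>_. 0) \<in> S \<and>
     (\<forall>\<phi>\<in>S. \<forall>\<psi>\<in>S. (\<lambda>\<gamma>. \<phi> \<gamma> + \<psi> \<gamma>) \<in> S) \<and>
     (\<forall>\<phi>\<in>S. \<forall>a::complex. (\<lambda>\<gamma>. a * \<phi> \<gamma>) \<in> S) \<and>
     (\<forall>\<phi>\<in>S. nS \<phi> \<ge> 0 \<and> (nS \<phi> = 0 \<longleftrightarrow> \<phi> = (\<lambda>_. 0))) \<and>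
     (\<forall>\<phi>\<in>S. \<forall>a. nS (\<lambda>\<gamma>. a * \<phi> \<gamma>) = cmod a * nS \<phi>) \<and>
     (\<forall>\<phi>\<in>S. \<forall>\<psi>\<in>S. nS (\<lambda>\<gamma>. \<phi> \<gamma> + \<psi> \<gamma>) \<le> nS \<phi> + nS \<psi>) \<and>
     (\<forall>f::nat \<Rightarrow> 'c \<Rightarrow> complex. (\<forall>n. f n \<in> S) \<and>
        (\<forall>e>0. \<exists>N. \<forall>m\<ge>N. \<forall>n\<ge>N. nS (\<lambda>\<gamma>. f m \<gamma> - f n \<gamma>) < e) \<longrightarrow>
        (\<exists>g\<in>S. \<forall>e>0. \<exists>N. \<forall>n\<ge>N. nS (\<lambda>\<gamma>. f n \<gamma> - g \<gamma>) < e))"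

definition segal_algebra ::
  "('g \<Rightarrow> 'c::{topological_space,ab_group_add} \<Rightarrow> complex) \<Rightarrow> 'c set
     \<Rightarrow> ('c \<Rightarrow> complex) set \<Rightarrow> (('c \<Rightarrow> complex) \<Rightarrow> real) \<Rightarrow> bool" where
  "segal_algebra chi Vb S nS \<longleftrightarrow>
     S \<subseteq> Aalg chi Vb \<and>
     (\<forall>\<phi>\<in>S. \<forall>\<psi>\<in>Aalg chi Vb. (\<lambda>\<gamma>. \<phi> \<gamma> * \<psi> \<gamma>) \<in> S) \<and>
     (\<forall>\<psi>\<in>Aalg chi Vb. \<forall>e>0. \<exists>\<phi>\<in>S. Anorm chi Vb (\<lambda>\<gamma>. \<psi> \<gamma> - \<phi> \<gamma>) < e) \<and>
     banach_fun_space S nS \<and>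
     (\<forall>\<phi>\<in>S. Anorm chi Vb \<phi> \<le> nS \<phi>) \<and>
     (\<forall>\<phi>\<in>S. \<forall>\<psi>\<in>Aalg chi Vb. nS (\<lambda>\<gamma>. \<phi> \<gamma> * \<psi> \<gamma>) \<le> nS \<phi> * Anorm chi Vb \<psi>) \<and>
     (\<forall>\<phi>\<in>S. \<forall>e>0. \<exists>u\<in>S. nS (\<lambda>\<gamma>. \<phi> \<gamma> - u \<gamma> * \<phi> \<gamma>) < e)"

definition isom_transl_inv :: "('c::ab_group_add \<Rightarrow> complex) set \<Rightarrow> (('c \<Rightarrow> complex) \<Rightarrow> real) \<Rightarrow> bool" where
  "isom_transl_inv S nS \<longleftrightarrow>
     (\<forall>\<psi>\<in>S. \<forall>\<gamma>. (\<lambda>\<gamma>'. \<psi> (\<gamma>' - \<gamma>)) \<in> S \<and> nS (\<lambda>\<gamma>'. \<psi> (\<gamma>' - \<gamma>)) = nS \<psi>)"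

end

theory Submission
  imports Defs "HOL-Library.Poly_Mapping"
begin

text \<open>
  Everything about the algebra \<open>Aalg\<close> is obtained from two facts about the dual group.

  First, a positive definite function \<open>\<phi>\<close> on the dual satisfies
  \<open>|\<Sum> c \<gamma> * \<phi> \<gamma>| \<le> \<phi> 0 * sup |\<Sum> c \<gamma> * \<gamma>|\<close>: multiply the trigonometric polynomial by the nonnegative one
  with coefficients \<open>\<phi> (s - t)\<close>, where \<open>s\<close> and \<open>t\<close> range over a Folner set, and apply an invariant mean on G.
  Averaging translates of one compactly supported positive definite bump over a compact set then gives
  compactly supported functions equal to 1 on a prescribed compact set whose local norms are bounded
  independently of that set; these are the approximate units, and they yield density.

  Second, the dual is not compact. If it were, all characters would be trivial on a neighbourhood
  of 0 in G, so it suffices that characters separate the points of G. A Haar functional on G is the mean of the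
  sums over the translates of a maximal separated set; the characters then come from a maximal preordering
  (Zorn) of the commutative algebra generated by the translations and a convolution operator, the
  latter being responsible for their continuity. Summing rarely overlapping translates of the bump
  with coefficients \<open>n powr (- 1 / p)\<close> separates the exponents p and q.
\<close>

section \<open>Invariant means\<close>

text \<open>The hypotheses equip only the dual with a measure. On G all averaging is done by
  finitely additive functionals obtained from compactness: the invariant mean stands in for Haar
  measure on the Bohr compactification, and Haar integration becomes a functional on all bounded
  compactly supported functions, so that cut-offs and step functions can be inserted without any
  measurability question.

  The inequality for positive definite functions takes the place of Bochner's theorem: \<phi> would
  be the transform of a positive measure of mass \<phi> 0, and pairing \<phi> with the coefficients
  of a trigonometric polynomial would integrate that polynomial.

  The uniform constant for local units comes from the finite window: a polynomial with frequencies
  in one translate of closure V sees only those translates of the bump whose centres lie in a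
  translate of one fixed compact set. The same window, with the dual non-compact, leaves room for
  infinitely many bumps no two of which are seen together.\<close>

definition invariant_mean :: "(('a::ab_group_add \<Rightarrow> real) \<Rightarrow> real) \<Rightarrow> bool" where
  "invariant_mean m \<longleftrightarrow>
     (\<forall>f g. bounded (range f) \<longrightarrow> bounded (range g) \<longrightarrow> m (\<lambda>x. f x + g x) = m f + m g) \<and>
     (\<forall>f c. bounded (range f) \<longrightarrow> m (\<lambda>x. c * f x) = c * m f) \<and>
     (\<forall>f. bounded (range f) \<longrightarrow> (\<forall>x. 0 \<le> f x) \<longrightarrow> 0 \<le> m f) \<and>
     m (\<lambda>x. 1) = 1 \<and>
     (\<forall>f y. bounded (range f) \<longrightarrow> m (\<lambda>x. f (x + y)) = m f)"

lemma invariant_meanD: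
  assumes "invariant_mean m"
  shows "bounded (range f) \<Longrightarrow> bounded (range g) \<Longrightarrow> m (\<lambda>x. f x + g x) = m f + m g"
    and "bounded (range f) \<Longrightarrow> m (\<lambda>x. c * f x) = c * m f"
    and "bounded (range f) \<Longrightarrow> (\<And>x. 0 \<le> f x) \<Longrightarrow> 0 \<le> m f"
    and "m (\<lambda>x. 1) = 1"
    and "bounded (range f) \<Longrightarrow> m (\<lambda>x. f (x + y)) = m f"
  using assms unfolding invariant_mean_def by blast+

text \<open>A pair (y, n) in Y demands invariance under y up to 2 * M / (n + 1) on functions bounded
  by M, a closed condition that a finite average can meet. Prescribing 0 on unbounded functions
  confines every such functional to a product of compact intervals.\<close>

definition almost_mean :: "('a::ab_group_add \<times> nat) set \<Rightarrow> (('a \<Rightarrow> real) \<Rightarrow> real) \<Rightarrow> bool" where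
  "almost_mean Y m \<longleftrightarrow>
     (\<forall>f g. bounded (range f) \<longrightarrow> bounded (range g) \<longrightarrow> m (\<lambda>x. f x + g x) = m f + m g) \<and>
     (\<forall>f c. bounded (range f) \<longrightarrow> m (\<lambda>x. c * f x) = c * m f) \<and>
     (\<forall>f. bounded (range f) \<longrightarrow> (\<forall>x. 0 \<le> f x) \<longrightarrow> 0 \<le> m f) \<and>
     m (\<lambda>x. 1) = 1 \<and>
     (\<forall>f. \<not> bounded (range f) \<longrightarrow> m f = 0) \<and>
     (\<forall>f M y n. (y, n) \<in> Y \<longrightarrow> (\<forall>x. \<bar>f x\<bar> \<le> M) \<longrightarrow> \<bar>m (\<lambda>x. f (x + y)) - m f\<bar> * real (Suc n) \<le> 2 * M)"

lemma semidefinite_discriminant: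
  fixes A B C :: real
  assumes q: "\<And>r s. 0 \<le> r * r * A + 2 * r * s * B + s * s * C"
  shows "B\<^sup>2 \<le> A * C"
proof -
  have C0: "0 \<le> C" using q[of 0 1] by simp
  show ?thesis
  proof (cases "C = 0")
    case True
    have "B = 0"
    proof (rule ccontr)
      assume "B \<noteq> 0"
      \<comment> \<open>With C = 0 the form is affine in s, and this s makes it -1.\<close>
      have "0 \<le> A + 2 * (-(A + 1) / (2 * B)) * B" using q[of 1 "-(A + 1) / (2 * B)"] True by simp
      also have "\<dots> = -1" using \<open>B \<noteq> 0\<close> by (simp add: field_simps)
      finally show False by simp
    qed
    then show ?thesis using True by simp
  next
    case False
    then have "0 < C" using C0 by simp
    have "0 \<le> C * C * A + 2 * C * (-B) * B + (-B) * (-B) * C" by (rule q)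
    also have "\<dots> = C * (A * C - B\<^sup>2)" by (simp add: power2_eq_square algebra_simps)
    finally show ?thesis using \<open>0 < C\<close> by (simp add: zero_le_mult_iff)
  qed
qed

lemma bounded_range_iff: "bounded (range (f :: 'a \<Rightarrow> real)) \<longleftrightarrow> (\<exists>M. \<forall>x. \<bar>f x\<bar> \<le> M)"
  by (auto simp: bounded_iff)

lemma almost_mean_abs_le:
  assumes m: "almost_mean Y m" and M: "\<And>x. \<bar>f x\<bar> \<le> M"
  shows "\<bar>m f\<bar> \<le> M"
proof -
  note am = m[unfolded almost_mean_def]
  have madd: "m (\<lambda>x. f x + g x) = m f + m g" if "bounded (range f)" "bounded (range g)" for f g
    using am that by blast
  have msc: "m (\<lambda>x. c * f x) = c * m f" if "bounded (range f)" for f c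
    using am that by blast
  have mpos: "0 \<le> m f" if "bounded (range f)" "\<And>x. 0 \<le> f x" for f
    using am that by blast
  have m1: "m (\<lambda>x. 1) = 1" using am by blast
  have b1: "bounded (range (\<lambda>x. 1 :: real))" by (auto simp: bounded_range_iff)
  have bf: "bounded (range f)" using M bounded_range_iff by blast
  have bM: "bounded (range (\<lambda>x. M * 1 :: real))" by (auto simp: bounded_range_iff)
  have bm: "bounded (range (\<lambda>x. -1 * f x))" using M unfolding bounded_range_iff by auto
  have "0 \<le> m (\<lambda>x. M * 1 + f x)"
  proof (rule mpos)
    show "0 \<le> M * 1 + f x" for x using M[of x] by linarith
  qed (intro bounded_plus_comp bf bM)
  moreover have "0 \<le> m (\<lambda>x. M * 1 + (-1) * f x)"
  proof (rule mpos)
    show "0 \<le> M * 1 + (-1) * f x" for x using M[of x] by linarith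
  qed (intro bounded_plus_comp bm bM)
  moreover have "m (\<lambda>x. M * 1 + f x) = M + m f"
    using madd[OF bM bf] msc[OF b1, of M] m1 by simp
  moreover have "m (\<lambda>x. M * 1 + (-1) * f x) = M - m f"
    using madd[OF bM bm] msc[OF b1, of M] msc[OF bf, of "-1"] m1 by simp
  ultimately show ?thesis by (simp add: abs_le_iff)
qed

text \<open>Precompose m with the average of f over x, x + y, ..., x + n y. Averaging commutes with
  all translations, so the conditions in Y survive; for y itself the difference telescopes to two
  values of f divided by n + 1. The term \<open>(((+) y) ^^ k) 0\<close> is the multiple k
  y.\<close>

lemma almost_mean_insert:
  fixes Y :: "('a::ab_group_add \<times> nat) set"
  assumes m: "almost_mean Y m"
  shows "\<exists>m'. almost_mean (insert (y, n) Y) m'"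
proof -
  define A where "A = (\<lambda>f (x::'a). (\<Sum>k\<le>n. f (x + (((+) y) ^^ k) 0)) / real (Suc n) :: real)"
  have sh: "((+) y ^^ k) (x + z) = ((+) y ^^ k) x + z" for k and x z :: 'a
    by (induction k) (auto simp: algebra_simps)
  have Ab: "\<bar>A f x\<bar> \<le> M" if "\<forall>x. \<bar>f x\<bar> \<le> M" for f M x
  proof -
    have "\<bar>\<Sum>k\<le>n. f (x + (((+) y) ^^ k) 0)\<bar> \<le> (\<Sum>k\<le>n. M)"
      by (rule order_trans[OF sum_abs]) (intro sum_mono, use that in auto)
    then show ?thesis unfolding A_def by (simp add: field_simps abs_divide)
  qed
  have Abd: "bounded (range (A f))" if "bounded (range f)" for f
    using that Ab unfolding bounded_range_iff by metis
  have Aadd: "A (\<lambda>x. f x + g x) = (\<lambda>x. A f x + A g x)" for f g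
    by (auto simp: A_def sum.distrib add_divide_distrib)
  have Asc: "A (\<lambda>x. c * f x) = (\<lambda>x. c * A f x)" for f c
    by (auto simp: A_def sum_distrib_left)
  have A1: "A (\<lambda>x. 1) = (\<lambda>x. 1)"
    by (auto simp: A_def)
  have Ash: "A (\<lambda>x. f (x + z)) = (\<lambda>x. A f (x + z))" for f z
    by (auto simp: A_def algebra_simps intro!: sum.cong)
  have Apos: "0 \<le> A f x" if "\<forall>x. 0 \<le> f x" for f x
    unfolding A_def using that by (intro divide_nonneg_nonneg sum_nonneg) auto
  have tel: "\<bar>A f (x + y) - A f x\<bar> * real (Suc n) \<le> 2 * M" if "\<forall>x. \<bar>f x\<bar> \<le> M" for f M x
  proof -
    have e: "x + y + (((+) y) ^^ k) 0 = x + (((+) y) ^^ Suc k) 0" for k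
      by (simp add: algebra_simps)
    have "(A f (x + y) - A f x) * real (Suc n)
        = (\<Sum>k\<le>n. f (x + (((+) y) ^^ Suc k) 0) - f (x + (((+) y) ^^ k) 0))"
      unfolding A_def e by (simp add: diff_divide_distrib[symmetric] sum_subtractf)
    also have "\<dots> = f (x + (((+) y) ^^ Suc n) 0) - f x"
      by (induction n) (simp_all del: funpow.simps)
    finally have "\<bar>A f (x + y) - A f x\<bar> * real (Suc n) = \<bar>f (x + (((+) y) ^^ Suc n) 0) - f x\<bar>"
      by (metis abs_mult abs_of_nat)
    also have "\<dots> \<le> M + M"
      using that[rule_format, of x] that[rule_format, of "x + (((+) y) ^^ Suc n) 0"] by linarith
    finally show ?thesis by simp
  qed
  note am = m[unfolded almost_mean_def]
  have madd: "m (\<lambda>x. f x + g x) = m f + m g" if "bounded (range f)" "bounded (range g)" for f g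
    using am that by blast
  have msc: "m (\<lambda>x. c * f x) = c * m f" if "bounded (range f)" for f c
    using am that by blast
  have mpos: "0 \<le> m f" if "bounded (range f)" "\<And>x. 0 \<le> f x" for f
    using am that by blast
  have m1: "m (\<lambda>x. 1) = 1" using am by blast
  have minv: "\<bar>m (\<lambda>x. f (x + z)) - m f\<bar> * real (Suc k) \<le> 2 * M"
    if "(z, k) \<in> Y" "\<forall>x. \<bar>f x\<bar> \<le> M" for z k f M
    using am that by blast
  have mb: "\<bar>m f\<bar> \<le> M" if "\<And>x. \<bar>f x\<bar> \<le> M" for f M
    using almost_mean_abs_le[OF m that] .
  define m' where "m' = (\<lambda>f. if bounded (range f) then m (A f) else 0)"
  have trb: "bounded (range (\<lambda>x. f (x + z)))" if "bounded (range f)" for f :: "'a \<Rightarrow> real" and z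
    using that unfolding bounded_range_iff by auto
  have "almost_mean (insert (y, n) Y) m'"
    unfolding almost_mean_def
  proof (intro conjI allI impI, goal_cases)
    case (1 f g)
    then show ?case by (simp add: m'_def Aadd madd Abd bounded_plus_comp)
  next
    case (2 f c)
    moreover have "bounded (range (\<lambda>x. c * f x))"
      using bounded_scaling[OF 2, of c] by (simp add: image_image)
    ultimately show ?case by (simp add: m'_def Asc msc Abd)
  next
    case (3 f)
    then show ?case by (simp add: m'_def mpos Abd Apos)
  next
    case 4
    then show ?case using bounded_range_iff[of "\<lambda>_. 1"] by (auto simp: m'_def A1 m1)
  next
    case (5 f)
    then show ?case by (simp add: m'_def)
  next
    case (6 f M z k)
    have bf: "bounded (range f)" using 6(2) bounded_range_iff by blast
    have mz: "m' (\<lambda>x. f (x + z)) - m' f = m (\<lambda>x. A f (x + z)) - m (A f)"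
      using bf trb[OF bf] by (simp add: m'_def Ash)
    show ?case
    proof (cases "(z, k) \<in> Y")
      case True
      show ?thesis unfolding mz using minv[OF True, of "A f" M] Ab[OF 6(2)] by blast
    next
      case False
      then have zk: "z = y" "k = n" using 6(1) by auto
      have b1: "bounded (range (\<lambda>x. A f (x + y)))" "bounded (range (\<lambda>x. -1 * A f x))" "bounded (range (A f))"
        using Abd[OF bf] trb[OF Abd[OF bf]] by auto
      have "m (\<lambda>x. A f (x + y)) - m (A f) = m (\<lambda>x. A f (x + y) + (-1) * A f x)"
        using madd[OF b1(1,2)] msc[OF b1(3), of "-1"] by simp
      moreover have "\<bar>m (\<lambda>x. A f (x + y) + (-1) * A f x)\<bar> \<le> 2 * M / real (Suc n)"
        using tel[OF 6(2)] by (intro mb) (simp add: field_simps)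
      ultimately have "\<bar>m (\<lambda>x. A f (x + y)) - m (A f)\<bar> * real (Suc n) \<le> 2 * M"
        by (simp add: field_simps)
      then show ?thesis using mz zk by simp
    qed
  qed
  then show ?thesis by blast
qed

lemma almost_mean_finite:
  fixes Y :: "('a::ab_group_add \<times> nat) set"
  assumes "finite Y"
  shows "\<exists>m. almost_mean Y m"
  using assms
proof (induction Y)
  case empty
  have sc: "bounded (range (\<lambda>x. c * f x))" if "bounded (range f)" for f :: "'a \<Rightarrow> real" and c
    using bounded_scaling[OF that, of c] by (simp add: image_image)
  have "almost_mean {} (\<lambda>f::'a \<Rightarrow> real. if bounded (range f) then f 0 else 0)"
    unfolding almost_mean_def
    by (simp add: bounded_plus_comp sc)
  then show ?case by blast
next
  case (insert yn Y)
  then show ?case using almost_mean_insert by (metis prod.exhaust)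
qed

lemma closed_almost_mean: "closed {m. almost_mean Y m}"
  unfolding almost_mean_def
  by (intro closed_Collect_conj closed_Collect_all closed_Collect_imp open_Collect_const closed_Collect_eq
      closed_Collect_le continuous_intros continuous_on_product_coordinates)

lemma almost_mean_mono: "almost_mean Y m \<Longrightarrow> X \<subseteq> Y \<Longrightarrow> almost_mean X m"
  unfolding almost_mean_def by (elim conjE, intro conjI) (assumption | meson subsetD)+

text \<open>Tychonoff: functionals bounded by the sup norm form a product of compact intervals in
  which each condition (y, n) is closed, and any finitely many conditions hold together. Invariance
  up to 2 M / (n + 1) for every n is invariance.\<close>

theorem invariant_mean_exists: "\<exists>m :: ('a::ab_group_add \<Rightarrow> real) \<Rightarrow> real. invariant_mean m"
proof -
  define b where "b = (\<lambda>f :: 'a \<Rightarrow> real. if bounded (range f) then (SUP x. \<bar>f x\<bar>) else 0)"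
  define S where "S = Pi\<^sub>E UNIV (\<lambda>f. {- b f..b f})"
  have cS: "compact S"
    unfolding S_def compactin_euclidean_iff[symmetric] euclidean_product_topology[symmetric]
    by (subst compactin_PiE) auto
  have inS: "m \<in> S" if m: "almost_mean Y m" for m :: "('a \<Rightarrow> real) \<Rightarrow> real" and Y
  proof -
    have "\<bar>m f\<bar> \<le> b f" for f
    proof (cases "bounded (range f)")
      case True
      then have "bdd_above (range (\<lambda>x. \<bar>f x\<bar>))"
        unfolding bounded_range_iff by (auto simp: bdd_above_def)
      then have "\<bar>f x\<bar> \<le> b f" for x
        using True by (auto simp: b_def intro: cSUP_upper)
      then show ?thesis by (rule almost_mean_abs_le[OF m])
    next
      case False
      then have "m f = 0" using m unfolding almost_mean_def by blast
      then show ?thesis using False by (simp add: b_def)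
    qed
    then show ?thesis unfolding S_def by (auto simp: abs_le_iff minus_le_iff)
  qed
  have "S \<inter> (\<Inter>i\<in>UNIV. {m. almost_mean {i} m}) \<noteq> {}"
  proof (rule compact_imp_fip_image[OF cS closed_almost_mean])
    fix Y :: "('a \<times> nat) set"
    assume "finite Y"
    then obtain m where m: "almost_mean Y m" using almost_mean_finite by blast
    then have "almost_mean {i} m" if "i \<in> Y" for i
      using that by (blast intro: almost_mean_mono[OF m])
    then show "S \<inter> (\<Inter>i\<in>Y. {m. almost_mean {i} m}) \<noteq> {}" using inS[OF m] by blast
  qed
  then obtain m :: "('a \<Rightarrow> real) \<Rightarrow> real" where m: "\<And>i. almost_mean {i} m" by blast
  have "invariant_mean m"
    unfolding invariant_mean_def
  proof (intro conjI)
    show "\<forall>f y. bounded (range f) \<longrightarrow> m (\<lambda>x. f (x + y)) = m f"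
    proof (intro allI impI)
      fix f :: "'a \<Rightarrow> real" and y
      assume "bounded (range f)"
      then obtain M where M: "\<forall>x. \<bar>f x\<bar> \<le> M" unfolding bounded_range_iff by blast
      define d where "d = \<bar>m (\<lambda>x. f (x + y)) - m f\<bar>"
      have le: "d * real (Suc n) \<le> 2 * M" for n
        unfolding d_def using m[of "(y, n)"] M unfolding almost_mean_def by blast
      have "d = 0"
      proof (rule ccontr)
        assume "d \<noteq> 0"
        then have "d > 0" unfolding d_def by simp
        then obtain n where "2 * M < real n * d" using reals_Archimedean3 by blast
        also have "\<dots> \<le> d * real (Suc n)" using \<open>d > 0\<close> by (simp add: algebra_simps)
        finally show False using le[of n] by simp
      qed
      then show "m (\<lambda>x. f (x + y)) = m f" unfolding d_def by simp
    qed
  qed (use m[of "(0, 0)"] in \<open>unfold almost_mean_def, blast+\<close>)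
  then show ?thesis by blast
qed

section \<open>Haar functionals on locally compact abelian groups\<close>

definition cpt_support :: "('a::topological_space \<Rightarrow> real) \<Rightarrow> bool" where
  "cpt_support f \<longleftrightarrow> (\<exists>K. compact K \<and> (\<forall>x. x \<notin> K \<longrightarrow> f x = 0))"

text \<open>Neither continuity nor measurability is part of this class, so indicators of compact
  sets and step approximations of kernels are admissible arguments of the functionals below.\<close>

definition bcs :: "('a::topological_space \<Rightarrow> real) \<Rightarrow> bool" where
  "bcs f \<longleftrightarrow> bounded (range f) \<and> cpt_support f"

lemma bcsI: "compact K \<Longrightarrow> (\<And>x. x \<notin> K \<Longrightarrow> f x = 0) \<Longrightarrow> (\<And>x. \<bar>f x\<bar> \<le> M) \<Longrightarrow> bcs f"
  unfolding bcs_def cpt_support_def bounded_range_iff by blast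

lemma bcsE:
  assumes "bcs f"
  obtains K M where "compact K" "\<And>x. x \<notin> K \<Longrightarrow> f x = 0" "\<And>x. \<bar>f x\<bar> \<le> M" "0 \<le> M"
proof -
  from assms obtain K M where "compact K" "\<And>x. x \<notin> K \<Longrightarrow> f x = 0" "\<And>x. \<bar>f x\<bar> \<le> M"
    unfolding bcs_def cpt_support_def bounded_range_iff by blast
  moreover from this(3)[of undefined] have "0 \<le> M" by linarith
  ultimately show ?thesis using that by blast
qed

lemma bcs_add: "bcs f \<Longrightarrow> bcs g \<Longrightarrow> bcs (\<lambda>x. f x + g x)"
proof (elim bcsE)
  fix K M L N
  assume h: "compact K" "\<And>x. x \<notin> K \<Longrightarrow> f x = 0" "\<And>x. \<bar>f x\<bar> \<le> M"
    "compact L" "\<And>x. x \<notin> L \<Longrightarrow> g x = 0" "\<And>x. \<bar>g x\<bar> \<le> N"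
  show "bcs (\<lambda>x. f x + g x)"
  proof (rule bcsI[of "K \<union> L"])
    show "\<bar>f x + g x\<bar> \<le> M + N" for x using h(3)[of x] h(6)[of x] by linarith
  qed (use h in auto)
qed

lemma bcs_mult: "bcs f \<Longrightarrow> (\<And>x. \<bar>g x\<bar> \<le> N) \<Longrightarrow> bcs (\<lambda>x. f x * g x)"
proof (elim bcsE)
  fix K M
  assume h: "compact K" "\<And>x. x \<notin> K \<Longrightarrow> f x = 0" "\<And>x. \<bar>f x\<bar> \<le> M" "0 \<le> M" "\<And>x. \<bar>g x\<bar> \<le> N"
  show "bcs (\<lambda>x. f x * g x)"
  proof (rule bcsI[of K])
    show "\<bar>f x * g x\<bar> \<le> M * N" for x
      using mult_mono[OF h(3)[of x] h(5)[of x]] h(4) by (simp add: abs_mult)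
  qed (use h in auto)
qed

lemma bcs_scale: "bcs f \<Longrightarrow> bcs (\<lambda>x. c * f x)"
  using bcs_mult[of f "\<lambda>_. c" "\<bar>c\<bar>"] by (simp add: mult.commute)

lemma bcs_abs: "bcs f \<Longrightarrow> bcs (\<lambda>x. \<bar>f x\<bar>)"
  by (elim bcsE, rule bcsI) auto

lemma bcs_diff: "bcs f \<Longrightarrow> bcs g \<Longrightarrow> bcs (\<lambda>x. f x - g x)"
  using bcs_add[of f "\<lambda>x. -1 * g x"] bcs_scale[of g "-1"] by simp

lemma bcs_zero: "bcs (\<lambda>x. 0)"
  by (rule bcsI[of "{}" _ 0]) auto

lemma bcs_sum: "(\<And>i. i \<in> A \<Longrightarrow> bcs (f i)) \<Longrightarrow> bcs (\<lambda>x. \<Sum>i\<in>A. f i x)"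
proof (induction A rule: infinite_finite_induct)
  case (insert i A)
  then show ?case by (simp add: bcs_add)
qed (auto simp: bcs_zero)

lemma bcs_translate:
  fixes f :: "'a::topological_ab_group_add \<Rightarrow> real"
  assumes "bcs f" shows "bcs (\<lambda>x. f (x + y))"
  using assms
proof (elim bcsE)
  fix K M
  assume h: "compact K" "\<And>x. x \<notin> K \<Longrightarrow> f x = 0" "\<And>x. \<bar>f x\<bar> \<le> M"
  show ?thesis
  proof (rule bcsI[of "(\<lambda>x. x - y) ` K"])
    show "compact ((\<lambda>x. x - y) ` K)"
      by (intro compact_continuous_image continuous_intros h)
    show "f (x + y) = 0" if "x \<notin> (\<lambda>x. x - y) ` K" for x
    proof (rule h(2), rule notI)
      assume "x + y \<in> K"
      then have "(x + y) - y \<in> (\<lambda>x. x - y) ` K" by blast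
      then show False using that by simp
    qed
  qed (use h in auto)
qed

lemma bcs_continuous:
  assumes "continuous_on UNIV f" "cpt_support f" shows "bcs f"
proof -
  from assms(2) obtain K where K: "compact K" "\<And>x. x \<notin> K \<Longrightarrow> f x = 0"
    unfolding cpt_support_def by blast
  have "compact (f ` K)"
    using K assms(1) by (intro compact_continuous_image) (auto intro: continuous_on_subset)
  then obtain M where "\<And>x. x \<in> K \<Longrightarrow> \<bar>f x\<bar> \<le> M"
    using compact_imp_bounded[of "f ` K"] unfolding bounded_iff by auto
  then have "\<bar>f x\<bar> \<le> max M 0" for x
    using K(2)[of x] by (cases "x \<in> K") fastforce+
  then show ?thesis using K by (intro bcsI) auto
qed

text \<open>Haar integration as a finitely additive functional. Limits under it must come from
  uniform estimates. Strict positivity on continuous functions is what later makes the inner product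
  \<open>ip\<close> definite.\<close>

locale haar_functional =
  fixes I :: "('g::topological_ab_group_add \<Rightarrow> real) \<Rightarrow> real"
  assumes add: "bcs f \<Longrightarrow> bcs g \<Longrightarrow> I (\<lambda>x. f x + g x) = I f + I g"
    and scale: "bcs f \<Longrightarrow> I (\<lambda>x. c * f x) = c * I f"
    and nonneg: "bcs f \<Longrightarrow> (\<And>x. 0 \<le> f x) \<Longrightarrow> 0 \<le> I f"
    and translate: "bcs f \<Longrightarrow> I (\<lambda>x. f (x + y)) = I f"
    and pos: "continuous_on UNIV f \<Longrightarrow> cpt_support f \<Longrightarrow> (\<And>x. 0 \<le> f x) \<Longrightarrow> 0 < f y \<Longrightarrow> 0 < I f"
begin

lemma zero: "I (\<lambda>x. 0) = 0"
  using scale[OF bcs_zero, of 0] by simp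

lemma diff: "bcs f \<Longrightarrow> bcs g \<Longrightarrow> I (\<lambda>x. f x - g x) = I f - I g"
  using add[of f "\<lambda>x. -1 * g x"] bcs_scale[of g "-1"] scale[of g "-1"] by simp

lemma sum: "(\<And>i. i \<in> A \<Longrightarrow> bcs (f i)) \<Longrightarrow> I (\<lambda>x. \<Sum>i\<in>A. f i x) = (\<Sum>i\<in>A. I (f i))"
proof (induction A rule: infinite_finite_induct)
  case (insert i A)
  then show ?case by (simp add: add bcs_sum)
qed (auto simp: zero)

lemma mono: "bcs f \<Longrightarrow> bcs g \<Longrightarrow> (\<And>x. f x \<le> g x) \<Longrightarrow> I f \<le> I g"
  using nonneg[OF bcs_diff[of g f]] diff[of g f] by simp

lemma abs_le:
  assumes f: "bcs f" and g: "bcs g" and le: "\<And>x. \<bar>f x\<bar> \<le> c * g x"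
  shows "\<bar>I f\<bar> \<le> c * I g"
proof -
  have 1: "f x \<le> c * g x" "-1 * f x \<le> c * g x" for x using le[of x] by linarith+
  have "I f \<le> c * I g" using mono[OF f bcs_scale[OF g] 1(1)] scale[OF g] by simp
  moreover have "- I f \<le> c * I g"
    using mono[OF bcs_scale[OF f] bcs_scale[OF g] 1(2)] scale[OF g] scale[OF f, of "-1"] by simp
  ultimately show ?thesis by linarith
qed

lemma cauchy_schwarz:
  assumes f: "bcs f" and g: "bcs g" and p: "\<And>x. 0 \<le> p x" and pb: "bcs p"
  shows "(I (\<lambda>x. p x * (f x * g x)))\<^sup>2 \<le> I (\<lambda>x. p x * (f x)\<^sup>2) * I (\<lambda>x. p x * (g x)\<^sup>2)"
proof -
  obtain M where M: "\<And>x. \<bar>f x\<bar> \<le> M" "0 \<le> M" by (rule bcsE[OF f]) blast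
  obtain N where N: "\<And>x. \<bar>g x\<bar> \<le> N" "0 \<le> N" by (rule bcsE[OF g]) blast
  have prod_le: "\<bar>r * s\<bar> \<le> R * S" if "\<bar>r\<bar> \<le> R" "\<bar>s\<bar> \<le> S" for r s R S :: real
    using mult_mono[OF that] that by (simp add: abs_mult)
  have b: "bcs (\<lambda>x. p x * (f x * g x))" "bcs (\<lambda>x. p x * (f x)\<^sup>2)" "bcs (\<lambda>x. p x * (g x)\<^sup>2)"
    unfolding power2_eq_square
    by (rule bcs_mult[OF pb] prod_le M N)+
  define A B C where "A = I (\<lambda>x. p x * (f x)\<^sup>2)" and "B = I (\<lambda>x. p x * (f x * g x))"
    and "C = I (\<lambda>x. p x * (g x)\<^sup>2)"
  have "0 \<le> r * r * A + 2 * r * s * B + s * s * C" for r s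
  proof -
    have "0 \<le> I (\<lambda>x. r\<^sup>2 * (p x * (f x)\<^sup>2) + (2 * r * s) * (p x * (f x * g x)) + s\<^sup>2 * (p x * (g x)\<^sup>2))"
    proof (rule nonneg)
      fix x
      have "r\<^sup>2 * (p x * (f x)\<^sup>2) + (2 * r * s) * (p x * (f x * g x)) + s\<^sup>2 * (p x * (g x)\<^sup>2)
          = p x * (r * f x + s * g x)\<^sup>2" by (simp add: power2_eq_square algebra_simps)
      then show "0 \<le> r\<^sup>2 * (p x * (f x)\<^sup>2) + (2 * r * s) * (p x * (f x * g x)) + s\<^sup>2 * (p x * (g x)\<^sup>2)"
        using p[of x] by simp
    qed (intro bcs_add bcs_scale b)
    also have "\<dots> = r\<^sup>2 * A + 2 * r * s * B + s\<^sup>2 * C"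
      by (simp add: add scale bcs_add bcs_scale b A_def B_def C_def)
    finally show ?thesis by (simp add: power2_eq_square)
  qed
  then have "B\<^sup>2 \<le> A * C" by (rule semidefinite_discriminant)
  then show ?thesis unfolding A_def B_def C_def .
qed

end

text \<open>Summing f over a maximal separated set Z behaves like a Riemann sum of fixed mesh:
  separation bounds the number of summands on a compact set, and maximality makes every translate of
  Z meet D. An invariant mean over the position of Z removes the dependence on the
  translate.\<close>

theorem haar_functional_exists:
  assumes lca: "LCA_group TYPE('g::{topological_ab_group_add,t2_space})"
  shows "\<exists>I :: ('g \<Rightarrow> real) \<Rightarrow> real. haar_functional I"
proof -
  obtain K0 :: "'g set" where K0: "compact K0" "0 \<in> interior K0"
    using lca unfolding LCA_group_def by blast
  define U where "U = interior K0"
  have U: "open U" "0 \<in> U" "U \<subseteq> K0" using K0 interior_subset by (auto simp: U_def)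
  define D where "D = {u - v |u v. u \<in> U \<and> v \<in> U}"
  define K1 where "K1 = {u - v |u v. u \<in> K0 \<and> v \<in> K0}"
  have K1: "compact K1"
  proof -
    have "compact ((\<lambda>(u, v). u - v) ` (K0 \<times> K0))"
      by (intro compact_continuous_image compact_Times K0) (auto simp: case_prod_beta intro!: continuous_intros)
    moreover have "(\<lambda>(u, v). u - v) ` (K0 \<times> K0) = K1" by (auto simp: K1_def)
    ultimately show ?thesis by simp
  qed
  have DK1: "D \<subseteq> K1" using U by (auto simp: D_def K1_def)
  have Dsym: "- d \<in> D" if "d \<in> D" for d
    using that by (auto simp: D_def) (metis minus_diff_eq)
  have D0: "0 \<in> D" using U by (force simp: D_def)
  define \<Z> where "\<Z> = {Z. \<forall>z\<in>Z. \<forall>z'\<in>Z. z \<noteq> z' \<longrightarrow> z - z' \<notin> D}"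
  have "\<exists>Z\<in>\<Z>. \<forall>X\<in>\<Z>. Z \<subseteq> X \<longrightarrow> X = Z"
  proof (rule subset_Zorn')
    fix C assume C: "subset.chain \<Z> C"
    show "\<Union>C \<in> \<Z>"
      unfolding \<Z>_def
    proof (intro CollectI ballI impI)
      fix z z' assume "z \<in> \<Union>C" "z' \<in> \<Union>C" "z \<noteq> z'"
      then obtain A B where "A \<in> C" "B \<in> C" "z \<in> A" "z' \<in> B" by blast
      moreover from this have "A \<subseteq> B \<or> B \<subseteq> A" using C by (auto simp: subset.chain_def)
      ultimately obtain E where "E \<in> C" "z \<in> E" "z' \<in> E" by blast
      moreover from this have "E \<in> \<Z>" using C by (auto simp: subset.chain_def)
      ultimately show "z - z' \<notin> D" using \<open>z \<noteq> z'\<close> by (auto simp: \<Z>_def)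
    qed
  qed
  then obtain Z where Z: "Z \<in> \<Z>" "\<And>X. X \<in> \<Z> \<Longrightarrow> Z \<subseteq> X \<Longrightarrow> X = Z" by blast
  have sep: "z = z'" if "z \<in> Z" "z' \<in> Z" "z - z' \<in> D" for z z'
    using that Z(1) unfolding \<Z>_def by blast
  have cover: "\<exists>z\<in>Z. z + x \<in> D" for x
  proof (rule ccontr)
    assume n: "\<not> (\<exists>z\<in>Z. z + x \<in> D)"
    have n2: "- x - z \<notin> D" if "z \<in> Z" for z
      using n Dsym[of "- x - z"] that by (auto simp: add.commute)
    have "insert (- x) Z \<in> \<Z>"
      unfolding \<Z>_def using n n2 sep by fastforce
    then have "- x \<in> Z" using Z(2)[of "insert (- x) Z"] by blast
    then show False using n D0 by force
  qed
  \<comment> \<open>Cover K by finitely many sets k - U. Two points z + x and z' + x in the same one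
    differ by an element of D = U - U, so z = z'; hence their number is at most the number of these
    sets, whatever x is.\<close>
  have count: "\<exists>N. \<forall>x. finite {z \<in> Z. z + x \<in> K} \<and> card {z \<in> Z. z + x \<in> K} \<le> N" if K: "compact K" for K
  proof -
    have op: "open {y. k - y \<in> U}" for k
    proof -
      have "open ((\<lambda>y. k - y) -` U)" by (intro open_vimage U continuous_intros)
      then show ?thesis by (simp add: vimage_def)
    qed
    have "K \<subseteq> \<Union>((\<lambda>k. {y. k - y \<in> U}) ` K)" using U by auto
    then obtain F where F: "F \<subseteq> K" "finite F" "K \<subseteq> (\<Union>k\<in>F. {y. k - y \<in> U})"
      using compactE_image[OF K, of K "\<lambda>k. {y. k - y \<in> U}"] op by metis
    have "finite {z \<in> Z. z + x \<in> K} \<and> card {z \<in> Z. z + x \<in> K} \<le> card F" for x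
    proof -
      define a where "a z = (SOME k. k \<in> F \<and> k - (z + x) \<in> U)" for z
      have a: "a z \<in> F \<and> a z - (z + x) \<in> U" if "z + x \<in> K" for z
        unfolding a_def by (rule someI_ex) (use F(3) that in auto)
      have "inj_on a {z \<in> Z. z + x \<in> K}"
      proof (rule inj_onI)
        fix z z' assume h: "z \<in> {z \<in> Z. z + x \<in> K}" "z' \<in> {z \<in> Z. z + x \<in> K}" "a z = a z'"
        have "(a z - (z' + x)) - (a z - (z + x)) \<in> D"
          unfolding D_def using a[of z] a[of z'] h by (smt (verit) mem_Collect_eq)
        then have "z - z' \<in> D" by (simp add: algebra_simps)
        then show "z = z'" using sep h by blast
      qed
      moreover have "a ` {z \<in> Z. z + x \<in> K} \<subseteq> F" using a by auto
      ultimately show ?thesis using F(2) by (meson card_inj_on_le inj_on_finite)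
    qed
    then show ?thesis by blast
  qed
  define L where "L f x = (\<Sum>z | z \<in> Z \<and> f (z + x) \<noteq> 0. f (z + x))" for f :: "'g \<Rightarrow> real" and x
  have Leq: "L f x = (\<Sum>z | z \<in> Z \<and> z + x \<in> K. f (z + x))"
    if "compact K" "\<And>x. x \<notin> K \<Longrightarrow> f x = 0" for f K x
    unfolding L_def using count[OF that(1)] that(2)
    by (intro sum.mono_neutral_left) auto
  have Lb: "bounded (range (L f))" if "bcs f" for f
  proof -
    from that obtain K M where K: "compact K" "\<And>x. x \<notin> K \<Longrightarrow> f x = 0" and M: "\<And>x. \<bar>f x\<bar> \<le> M" "0 \<le> M"
      by (rule bcsE) blast
    obtain N where N: "\<And>x. card {z \<in> Z. z + x \<in> K} \<le> N" using count[OF K(1)] by blast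
    have "\<bar>L f x\<bar> \<le> real N * M" for x
    proof -
      have "\<bar>L f x\<bar> \<le> (\<Sum>z | z \<in> Z \<and> z + x \<in> K. \<bar>f (z + x)\<bar>)"
        using Leq[OF K(1), of f x] K(2) sum_abs[of "\<lambda>z. f (z + x)" "{z. z \<in> Z \<and> z + x \<in> K}"] by simp
      also have "\<dots> \<le> (\<Sum>z | z \<in> Z \<and> z + x \<in> K. M)"
        by (rule sum_mono) (rule M)
      also have "\<dots> \<le> real N * M" using N[of x] M(2) by (simp add: mult_right_mono)
      finally show ?thesis .
    qed
    then show ?thesis unfolding bounded_range_iff by blast
  qed
  have Ladd: "L (\<lambda>x. f x + g x) = (\<lambda>x. L f x + L g x)" if fg: "bcs f" "bcs g" for f g
  proof -
    from fg(1) obtain K where K: "compact K" "\<And>x. x \<notin> K \<Longrightarrow> f x = 0" by (rule bcsE) blast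
    from fg(2) obtain K' where K': "compact K'" "\<And>x. x \<notin> K' \<Longrightarrow> g x = 0" by (rule bcsE) blast
    have c: "compact (K \<union> K')" using K K' by auto
    have "L (\<lambda>x. f x + g x) x = L f x + L g x" for x
      using Leq[OF c, of "\<lambda>x. f x + g x"] Leq[OF c, of f] Leq[OF c, of g] K K' by (simp add: sum.distrib)
    then show ?thesis by blast
  qed
  have Lscale: "L (\<lambda>x. c * f x) = (\<lambda>x. c * L f x)" if f: "bcs f" for f c
  proof -
    from f obtain K where K: "compact K" "\<And>x. x \<notin> K \<Longrightarrow> f x = 0" by (rule bcsE) blast
    have "L (\<lambda>x. c * f x) x = c * L f x" for x
      using Leq[OF K(1), of "\<lambda>x. c * f x"] Leq[OF K] K by (simp add: sum_distrib_left)
    then show ?thesis by blast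
  qed
  have Lnn: "0 \<le> L f x" if "\<And>x. 0 \<le> f x" for f x
    unfolding L_def by (intro sum_nonneg that)
  have Ltr: "L (\<lambda>x. f (x + y)) = (\<lambda>x. L f (x + y))" for f y
    by (auto simp: L_def add.assoc)
  obtain m :: "('g \<Rightarrow> real) \<Rightarrow> real" where m: "invariant_mean m" using invariant_mean_exists by blast
  note madd = invariant_meanD(1)[OF m] and msc = invariant_meanD(2)[OF m] and mpos = invariant_meanD(3)[OF m]
    and m1 = invariant_meanD(4)[OF m] and minv = invariant_meanD(5)[OF m]
  have b1: "bounded (range (\<lambda>x. 1 :: real))" by auto
  define I where "I f = m (L f)" for f
  have Iadd: "I (\<lambda>x. f x + g x) = I f + I g" if "bcs f" "bcs g" for f g
    unfolding I_def by (simp add: Ladd that madd Lb)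
  have Itr: "I (\<lambda>x. f (x + y)) = I f" if "bcs f" for f y
    unfolding I_def by (simp add: Ltr that minv Lb)
  have Isum: "I (\<lambda>x. \<Sum>i\<in>A. f i x) = (\<Sum>i\<in>A. I (f i))" if "finite A" "\<And>i. i \<in> A \<Longrightarrow> bcs (f i)" for A :: "'g set" and f
    using that
  proof (induction A)
    case empty
    have "L (\<lambda>x. 0) = (\<lambda>x. 0 * 1)" by (auto simp: L_def)
    then show ?case using msc[OF b1, of 0] by (simp add: I_def)
  next
    case (insert i A)
    then show ?case by (simp add: Iadd bcs_sum)
  qed
  have "haar_functional I"
  proof
    fix f :: "'g \<Rightarrow> real" and y
    assume f: "continuous_on UNIV f" "cpt_support f" "\<And>x. 0 \<le> f x" "0 < f y"
    have bf: "bcs f" using f bcs_continuous by blast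
    define \<delta> where "\<delta> = f y / 2"
    have \<delta>: "0 < \<delta>" using f by (simp add: \<delta>_def)
    \<comment> \<open>Finitely many translates of f add up to a function g that is at least \<delta>
      on K1. Every translate of Z meets K1, so L g is at least \<delta> everywhere, while I g is a
      multiple of I f.\<close>
    define Ok where "Ok k = {x. \<delta> < f (x - k + y)}" for k
    have cf: "continuous_on UNIV (\<lambda>x. f (x - k + y))" for k
      by (rule continuous_on_compose2[OF f(1)]) (auto intro!: continuous_intros)
    have op: "open (Ok k)" for k
      unfolding Ok_def by (intro open_Collect_less continuous_on_const cf)
    have "k \<in> Ok k" for k using f(4) by (simp add: Ok_def \<delta>_def)
    then have "K1 \<subseteq> \<Union>(Ok ` K1)" by auto
    then obtain F where F: "F \<subseteq> K1" "finite F" "K1 \<subseteq> (\<Union>k\<in>F. Ok k)"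
      using compactE_image[OF K1, of K1 Ok] op by metis
    define g where "g x = (\<Sum>k\<in>F. f (x + (y - k)))" for x
    have bg: "bcs g" unfolding g_def by (intro bcs_sum bcs_translate bf)
    have gnn: "0 \<le> g x" for x unfolding g_def by (intro sum_nonneg f)
    have g\<delta>: "\<delta> \<le> g x" if xK: "x \<in> K1" for x
    proof -
      obtain k where k: "k \<in> F" "x \<in> Ok k" using F(3) xK by auto
      have "\<delta> \<le> f (x + (y - k))" using k(2) by (simp add: Ok_def algebra_simps)
      also have "\<dots> \<le> g x" unfolding g_def using k F(2) f(3) by (intro member_le_sum) auto
      finally show ?thesis .
    qed
    have Lg: "\<delta> \<le> L g x" for x
    proof -
      from bg obtain K where K: "compact K" "\<And>x. x \<notin> K \<Longrightarrow> g x = 0" by (rule bcsE) blast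
      obtain z where z: "z \<in> Z" "z + x \<in> K1" using cover[of x] DK1 by blast
      then have "z + x \<in> K" using g\<delta>[OF z(2)] \<delta> K(2) by force
      then have "g (z + x) \<le> (\<Sum>z | z \<in> Z \<and> z + x \<in> K. g (z + x))"
        using count[OF K(1)] gnn z by (intro member_le_sum) auto
      then show ?thesis using Leq[OF K] g\<delta>[OF z(2)] by simp
    qed
    have "0 \<le> m (\<lambda>x. L g x + (-\<delta>) * 1)"
    proof (rule mpos)
      show "bounded (range (\<lambda>x. L g x + (-\<delta>) * 1))"
        by (intro bounded_plus_comp Lb bg) auto
    qed (use Lg in auto)
    also have "\<dots> = I g - \<delta>"
      using madd[OF Lb[OF bg], of "\<lambda>x. (-\<delta>) * 1"] msc[OF b1, of "-\<delta>"] m1 by (simp add: I_def)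
    finally have "\<delta> \<le> I g" by simp
    also have "I g = real (card F) * I f"
      unfolding g_def using F(2) by (subst Isum) (auto simp: bcs_translate bf Itr)
    finally have "0 < real (card F) * I f" using \<delta> by linarith
    then show "0 < I f" by (simp add: zero_less_mult_iff)
  next
    show "I (\<lambda>x. c * f x) = c * I f" if "bcs f" for c and f
      unfolding I_def by (simp add: Lscale that msc Lb)
  qed (use Iadd Itr in \<open>auto simp: I_def Lb intro!: mpos Lnn\<close>)
  then show ?thesis by blast
qed

locale sym_haar_functional = haar_functional +
  assumes reflect: "bcs f \<Longrightarrow> I (\<lambda>x. f (- x)) = I f"

lemma bcs_reflect:
  fixes f :: "'a::topological_ab_group_add \<Rightarrow> real"
  assumes "bcs f" shows "bcs (\<lambda>x. f (- x))"
  using assms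
proof (elim bcsE)
  fix K M
  assume h: "compact K" "\<And>x. x \<notin> K \<Longrightarrow> f x = 0" "\<And>x. \<bar>f x\<bar> \<le> M"
  show ?thesis
  proof (rule bcsI[of "uminus ` K"])
    show "compact (uminus ` K)"
      by (intro compact_continuous_image continuous_intros h)
    show "f (- x) = 0" if "x \<notin> uminus ` K" for x
      using that h(2)[of "- x"] by force
  qed (use h in auto)
qed

text \<open>Adding the reflected functional supplies the reflection invariance that is usually read
  off from the uniqueness of Haar measure.\<close>

theorem sym_haar_functional_exists:
  assumes "LCA_group TYPE('g::{topological_ab_group_add,t2_space})"
  shows "\<exists>I :: ('g \<Rightarrow> real) \<Rightarrow> real. sym_haar_functional I"
proof -
  obtain I :: "('g \<Rightarrow> real) \<Rightarrow> real" where "haar_functional I"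
    using haar_functional_exists[OF assms] by blast
  then interpret haar_functional I .
  have "sym_haar_functional (\<lambda>f. I f + I (\<lambda>x. f (- x)))"
  proof
    fix f :: "'g \<Rightarrow> real" and y
    assume f: "bcs f"
    have "I (\<lambda>x. f (- x + y)) = I (\<lambda>x. f (- x))"
      using translate[OF bcs_reflect[OF f], of "- y"] by (simp add: add.commute)
    then show "I (\<lambda>x. f (x + y)) + I (\<lambda>x. f (- x + y)) = I f + I (\<lambda>x. f (- x))"
      by (simp add: translate f)
  next
    fix f :: "'g \<Rightarrow> real" and y
    assume f: "continuous_on UNIV f" "cpt_support f" "\<And>x. 0 \<le> f x" "0 < f y"
    then show "0 < I f + I (\<lambda>x. f (- x))"
      using pos[OF f] nonneg[OF bcs_reflect[OF bcs_continuous[OF f(1,2)]]] by (simp add: add_pos_nonneg)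
  qed (simp_all add: add scale nonneg bcs_reflect algebra_simps)
  then show ?thesis by blast
qed

section \<open>Convolution\<close>

lemma zero_nhd_add:
  fixes O1 :: "'a::topological_ab_group_add set"
  assumes "open O1" "0 \<in> O1"
  obtains W where "open W" "0 \<in> W" "\<And>a b. a \<in> W \<Longrightarrow> b \<in> W \<Longrightarrow> a + b \<in> O1" "\<And>a. a \<in> W \<Longrightarrow> - a \<in> W"
proof -
  have "open ((\<lambda>(a, b). a + b) -` O1)"
    by (intro open_vimage assms) (auto simp: case_prod_beta intro!: continuous_intros)
  moreover have "(0, 0) \<in> (\<lambda>(a, b). a + b) -` O1" using assms(2) by simp
  ultimately obtain A B where AB0: "open A" "open B" "(0, 0) \<in> A \<times> B" "A \<times> B \<subseteq> (\<lambda>(a, b). a + b) -` O1"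
    by (rule open_prod_elim)
  then have AB: "open A" "open B" "0 \<in> A" "0 \<in> B" "A \<times> B \<subseteq> (\<lambda>(a, b). a + b) -` O1"
    by simp_all
  define W where "W = (A \<inter> B) \<inter> uminus -` (A \<inter> B)"
  have "open W" unfolding W_def by (intro open_Int open_vimage AB continuous_intros)
  moreover have "0 \<in> W" using AB by (simp add: W_def)
  moreover have "a + b \<in> O1" if "a \<in> W" "b \<in> W" for a b
  proof -
    have "(a, b) \<in> A \<times> B" using that by (simp add: W_def)
    then have "(a, b) \<in> (\<lambda>(a, b). a + b) -` O1" using AB(5) by (rule rev_subsetD)
    then show ?thesis by simp
  qed
  moreover have "- a \<in> W" if "a \<in> W" for a
    using that by (simp add: W_def)
  ultimately show ?thesis using that by blast
qed

lemma open_translate_nhd: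
  fixes O1 :: "'a::topological_ab_group_add set"
  assumes "open O1" shows "open {x. x - a \<in> O1}" "open {x. a - x \<in> O1}"
proof -
  have "open ((\<lambda>x. x - a) -` O1)" by (intro open_vimage assms continuous_intros)
  then show "open {x. x - a \<in> O1}" by (simp add: vimage_def)
  have "open ((\<lambda>x. a - x) -` O1)" by (intro open_vimage assms continuous_intros)
  then show "open {x. a - x \<in> O1}" by (simp add: vimage_def)
qed

lemma compact_translate_cover:
  fixes K :: "'a::topological_ab_group_add set"
  assumes "compact K" "\<And>y. open (W y)" "\<And>y. 0 \<in> W y"
  obtains F where "F \<subseteq> K" "finite F" "\<And>x. x \<in> K \<Longrightarrow> \<exists>y\<in>F. x - y \<in> W y"
proof -
  have o: "open {x. x - y \<in> W y}" for y by (rule open_translate_nhd(1)[OF assms(2)])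
  have c: "K \<subseteq> (\<Union>y\<in>K. {x. x - y \<in> W y})" using assms(3) by auto
  obtain F where F: "F \<subseteq> K" "finite F" "K \<subseteq> (\<Union>y\<in>F. {x. x - y \<in> W y})"
    by (rule compactE_image[OF assms(1) o c])
  have "\<exists>y\<in>F. x - y \<in> W y" if "x \<in> K" for x
    using subsetD[OF F(3) that] by simp
  with F(1,2) show ?thesis by (rule that)
qed

text \<open>A Lebesgue number argument. Around each y a neighbourhood is chosen such that w varies
  little over sums of two of its elements: s = y + (s - y) and s + o' = y + (s - y + o') are then
  both compared with y.\<close>

lemma cpt_support_uniformly_continuous:
  fixes w :: "'a::topological_ab_group_add \<Rightarrow> real"
  assumes w: "continuous_on UNIV w" "cpt_support w" and e: "0 < e"
  obtains O1 where "open O1" "0 \<in> O1" "\<And>s s'. s - s' \<in> O1 \<Longrightarrow> \<bar>w s - w s'\<bar> < e"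
proof -
  obtain K where K: "compact K" "\<And>x. x \<notin> K \<Longrightarrow> w x = 0" using w unfolding cpt_support_def by blast
  have "\<exists>W. open W \<and> 0 \<in> W \<and> (\<forall>a\<in>W. \<forall>b\<in>W. \<bar>w (y + (a + b)) - w y\<bar> < e / 2)" for y
  proof -
    define O2 where "O2 = (\<lambda>o'. w (y + o')) -` {w y - e / 2 <..< w y + e / 2}"
    have "open O2"
      unfolding O2_def by (intro open_vimage continuous_on_compose2[OF w(1)] continuous_intros) auto
    moreover have "0 \<in> O2" using e by (simp add: O2_def)
    ultimately obtain W where W: "open W" "0 \<in> W" "\<And>a b. a \<in> W \<Longrightarrow> b \<in> W \<Longrightarrow> a + b \<in> O2"
      by (rule zero_nhd_add) blast
    have "\<bar>w (y + (a + b)) - w y\<bar> < e / 2" if "a \<in> W" "b \<in> W" for a b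
    proof -
      have "w y - e / 2 < w (y + (a + b))" "w (y + (a + b)) < w y + e / 2"
        using W(3)[OF that] by (simp_all add: O2_def)
      then show ?thesis by linarith
    qed
    with W(1,2) show ?thesis by blast
  qed
  then have "\<exists>W. \<forall>y. open (W y) \<and> 0 \<in> W y \<and> (\<forall>a\<in>W y. \<forall>b\<in>W y. \<bar>w (y + (a + b)) - w y\<bar> < e / 2)"
    by (intro choice allI)
  then obtain W where W: "\<And>y. open (W y)" "\<And>y. 0 \<in> W y"
    "\<And>y a b. a \<in> W y \<Longrightarrow> b \<in> W y \<Longrightarrow> \<bar>w (y + (a + b)) - w y\<bar> < e / 2" by blast
  obtain F where F: "F \<subseteq> K" "finite F" "\<And>x. x \<in> K \<Longrightarrow> \<exists>y\<in>F. x - y \<in> W y"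
    by (rule compact_translate_cover[of K W]) (use K W in auto)
  define V where "V = (\<Inter>y\<in>F. W y)"
  have V: "open V" "0 \<in> V" unfolding V_def using W(1,2) F(2) by blast+
  \<comment> \<open>Either of s and s' may be the one that lies in K, so the neighbourhood is made
    symmetric.\<close>
  define O1 where "O1 = V \<inter> uminus -` V"
  have O1: "open O1" "0 \<in> O1"
    unfolding O1_def by (intro open_Int open_vimage V continuous_intros) (simp add: V)
  have *: "\<bar>w (s + o') - w s\<bar> < e" if sK: "s \<in> K" and oV: "o' \<in> V" for s o'
  proof -
    obtain y where y: "y \<in> F" "s - y \<in> W y" using F(3) sK by auto
    then have "o' \<in> W y" using oV by (auto simp: V_def)
    then have "\<bar>w (y + (s - y + o')) - w y\<bar> < e / 2" by (rule W(3)[OF y(2)])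
    moreover have "\<bar>w (y + (s - y + 0)) - w y\<bar> < e / 2" by (rule W(3)[OF y(2) W(2)])
    moreover have "y + (s - y + o') = s + o'" "y + (s - y + 0) = s" by simp_all
    ultimately have "\<bar>w (s + o') - w y\<bar> < e / 2" "\<bar>w s - w y\<bar> < e / 2" by simp_all
    then show ?thesis by linarith
  qed
  show ?thesis
  proof (rule that[OF O1])
    fix s s' assume o: "s - s' \<in> O1"
    then have o2: "s - s' \<in> V" "s' - s \<in> V" by (auto simp: O1_def)
    consider "s \<in> K" | "s' \<in> K" | "s \<notin> K" "s' \<notin> K" by blast
    then show "\<bar>w s - w s'\<bar> < e"
    proof cases
      case 1 then show ?thesis using *[OF 1 o2(2)] by (simp add: abs_minus_commute)
    next
      case 2 then show ?thesis using *[OF 2 o2(1)] by simp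
    next
      case 3 then show ?thesis using K e by simp
    qed
  qed
qed

lemma continuous_on_UNIV_nhdI:
  fixes f :: "'a::topological_space \<Rightarrow> 'b::metric_space"
  assumes "\<And>x e. 0 < e \<Longrightarrow> \<exists>U. open U \<and> x \<in> U \<and> (\<forall>y\<in>U. dist (f y) (f x) < e)"
  shows "continuous_on UNIV f"
  unfolding continuous_on_def
  by (intro ballI tendstoI) (auto simp: eventually_at_topological dest!: assms)

context haar_functional
begin

text \<open>For a finitely additive functional the interchange is not automatic. Rounding s in K to
  one of finitely many points \<sigma> s turns w (t + \<sigma> s) into a finite sum of products, for
  which the interchange is linearity; uniform continuity of w bounds the error on both sides by a
  multiple of e.\<close>

lemma fubini:
  assumes k: "bcs k" and g: "bcs g" and w: "continuous_on UNIV w" "cpt_support w"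
  shows "I (\<lambda>t. g t * I (\<lambda>s. k s * w (t + s))) = I (\<lambda>s. k s * I (\<lambda>t. g t * w (t + s)))"
proof -
  obtain B where B: "\<And>x. \<bar>w x\<bar> \<le> B" by (rule bcsE[OF bcs_continuous[OF w]]) blast
  have bk: "bcs (\<lambda>s. k s * w (f s))" for f by (rule bcs_mult[OF k]) (rule B)
  have bg: "bcs (\<lambda>t. g t * w (f t))" for f by (rule bcs_mult[OF g]) (rule B)
  have ak: "bcs (\<lambda>s. \<bar>k s\<bar>)" and ag: "bcs (\<lambda>s. \<bar>g s\<bar>)" using k g bcs_abs by auto
  have innerk: "\<bar>I (\<lambda>s. k s * w (f s))\<bar> \<le> B * I (\<lambda>s. \<bar>k s\<bar>)" for f
    by (intro abs_le bk ak) (simp add: abs_mult mult.commute[of B] mult_left_mono B)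
  have innerg: "\<bar>I (\<lambda>s. g s * w (f s))\<bar> \<le> B * I (\<lambda>s. \<bar>g s\<bar>)" for f
    by (intro abs_le bg ag) (simp add: abs_mult mult.commute[of B] mult_left_mono B)
  have bgI: "bcs (\<lambda>t. g t * I (\<lambda>s. k s * w (f t s)))" for f
    by (rule bcs_mult[OF g]) (rule innerk)
  have bkI: "bcs (\<lambda>s. k s * I (\<lambda>t. g t * w (f s t)))" for f
    by (rule bcs_mult[OF k]) (rule innerg)
  define X where "X = I (\<lambda>t. g t * I (\<lambda>s. k s * w (t + s)))"
  define Y where "Y = I (\<lambda>s. k s * I (\<lambda>t. g t * w (t + s)))"
  define D where "D = I (\<lambda>s. \<bar>k s\<bar>) * I (\<lambda>s. \<bar>g s\<bar>)"
  have "\<bar>X - Y\<bar> \<le> 2 * (e * D)" if e: "0 < e" for e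
  proof -
    obtain O1 where O1: "open O1" "0 \<in> O1" "\<And>s s'. s - s' \<in> O1 \<Longrightarrow> \<bar>w s - w s'\<bar> < e"
      using cpt_support_uniformly_continuous[OF w e] by blast
    obtain K where K: "compact K" "\<And>x. x \<notin> K \<Longrightarrow> k x = 0" by (rule bcsE[OF k]) blast
    obtain F where F: "F \<subseteq> K" "finite F" "\<And>x. x \<in> K \<Longrightarrow> \<exists>y\<in>F. x - y \<in> O1"
      using compact_translate_cover[OF K(1), of "\<lambda>_. O1"] O1 by blast
    define \<sigma> where "\<sigma> s = (SOME a. a \<in> F \<and> s - a \<in> O1)" for s
    have \<sigma>: "\<sigma> s \<in> F \<and> s - \<sigma> s \<in> O1" if "s \<in> K" for s
      unfolding \<sigma>_def by (rule someI_ex) (use F(3) that in auto)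
    have bnd: "\<bar>w (t + s) - w (t + \<sigma> s)\<bar> \<le> e" if "s \<in> K" for s t
      using O1(3)[of "t + s" "t + \<sigma> s"] \<sigma>[OF that] by (simp add: less_imp_le)
    define ka where "ka a s = k s * (if \<sigma> s = a then 1 else 0)" for a s
    have bka: "bcs (ka a)" for a unfolding ka_def by (rule bcs_mult[OF k, of _ 1]) auto
    have split: "(\<Sum>a\<in>F. ka a s * f a) = k s * f (\<sigma> s)" for s and f :: "'g \<Rightarrow> real"
    proof (cases "s \<in> K")
      case True
      then have "\<sigma> s \<in> F" using \<sigma> by blast
      moreover have "(\<Sum>a\<in>F. ka a s * f a) = (\<Sum>a\<in>F. if a = \<sigma> s then k s * f a else 0)"
        by (intro sum.cong) (auto simp: ka_def)
      ultimately show ?thesis using F(2) by simp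
    next
      case False then show ?thesis using K by (simp add: ka_def)
    qed
    have mid: "I (\<lambda>s. k s * f (\<sigma> s)) = (\<Sum>a\<in>F. I (ka a) * f a)" for f :: "'g \<Rightarrow> real"
    proof -
      have "I (\<lambda>s. \<Sum>a\<in>F. f a * ka a s) = (\<Sum>a\<in>F. f a * I (ka a))"
        by (subst sum) (auto intro: bcs_scale bka simp: scale[OF bka])
      then show ?thesis using split[of _ f] by (simp add: mult.commute)
    qed
    define X' where "X' = I (\<lambda>t. g t * I (\<lambda>s. k s * w (t + \<sigma> s)))"
    define Y' where "Y' = I (\<lambda>s. k s * I (\<lambda>t. g t * w (t + \<sigma> s)))"
    have "X' = Y'"
    proof -
      have "Y' = (\<Sum>a\<in>F. I (ka a) * I (\<lambda>t. g t * w (t + a)))"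
        unfolding Y'_def by (rule mid)
      also have "\<dots> = I (\<lambda>t. \<Sum>a\<in>F. I (ka a) * (g t * w (t + a)))"
        by (subst sum) (auto intro: bcs_scale bg simp: scale[OF bg])
      also have "\<dots> = X'"
        unfolding X'_def mid[of "\<lambda>a. w (_ + a)"] by (simp add: sum_distrib_left algebra_simps)
      finally show ?thesis by simp
    qed
    have inX: "\<bar>I (\<lambda>s. k s * w (t + s)) - I (\<lambda>s. k s * w (t + \<sigma> s))\<bar> \<le> e * I (\<lambda>s. \<bar>k s\<bar>)" for t
    proof -
      have "\<bar>I (\<lambda>s. k s * w (t + s) - k s * w (t + \<sigma> s))\<bar> \<le> e * I (\<lambda>s. \<bar>k s\<bar>)"
      proof (intro abs_le bcs_diff bk ak)
        show "\<bar>k s * w (t + s) - k s * w (t + \<sigma> s)\<bar> \<le> e * \<bar>k s\<bar>" for s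
        proof (cases "s \<in> K")
          case True
          show ?thesis using mult_left_mono[OF bnd[OF True, of t], of "\<bar>k s\<bar>"]
            by (simp add: right_diff_distrib[symmetric] abs_mult mult.commute)
        qed (use K in auto)
      qed
      then show ?thesis by (simp add: diff bk)
    qed
    have "\<bar>X - X'\<bar> \<le> (e * I (\<lambda>s. \<bar>k s\<bar>)) * I (\<lambda>s. \<bar>g s\<bar>)"
      unfolding X_def X'_def diff[OF bgI bgI, symmetric]
    proof (intro abs_le bcs_diff bgI ag)
      show "\<bar>g t * I (\<lambda>s. k s * w (t + s)) - g t * I (\<lambda>s. k s * w (t + \<sigma> s))\<bar> \<le> e * I (\<lambda>s. \<bar>k s\<bar>) * \<bar>g t\<bar>" for t
        using mult_left_mono[OF inX[of t], of "\<bar>g t\<bar>"]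
        by (simp add: right_diff_distrib[symmetric] abs_mult mult.commute)
    qed
    moreover have "\<bar>Y - Y'\<bar> \<le> (e * I (\<lambda>s. \<bar>g s\<bar>)) * I (\<lambda>s. \<bar>k s\<bar>)"
      unfolding Y_def Y'_def diff[OF bkI bkI, symmetric]
    proof (intro abs_le bcs_diff bkI ak)
      show "\<bar>k s * I (\<lambda>t. g t * w (t + s)) - k s * I (\<lambda>t. g t * w (t + \<sigma> s))\<bar> \<le> e * I (\<lambda>s. \<bar>g s\<bar>) * \<bar>k s\<bar>" for s
      proof (cases "s \<in> K")
        case True
        have "\<bar>I (\<lambda>t. g t * w (t + s) - g t * w (t + \<sigma> s))\<bar> \<le> e * I (\<lambda>s. \<bar>g s\<bar>)"
        proof (intro abs_le bcs_diff bg ag)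
          show "\<bar>g t * w (t + s) - g t * w (t + \<sigma> s)\<bar> \<le> e * \<bar>g t\<bar>" for t
            using mult_left_mono[OF bnd[OF True, of t], of "\<bar>g t\<bar>"]
            by (simp add: right_diff_distrib[symmetric] abs_mult mult.commute)
        qed
        then have "\<bar>I (\<lambda>t. g t * w (t + s)) - I (\<lambda>t. g t * w (t + \<sigma> s))\<bar> \<le> e * I (\<lambda>s. \<bar>g s\<bar>)"
          by (simp add: diff bg)
        from mult_left_mono[OF this, of "\<bar>k s\<bar>"] show ?thesis
          by (simp add: right_diff_distrib[symmetric] abs_mult mult.commute)
      qed (use K in auto)
    qed
    ultimately show ?thesis using \<open>X' = Y'\<close> by (simp add: D_def mult_ac abs_le_iff)
  qed
  then have "\<bar>X - Y\<bar> \<le> 0 + d" if "0 < d" for d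
  proof -
    have D0: "0 \<le> D" unfolding D_def by (intro mult_nonneg_nonneg nonneg ak ag) auto
    have "\<bar>X - Y\<bar> \<le> 2 * (d / (2 * (D + 1)) * D)"
      using D0 that by (intro \<open>\<And>e. 0 < e \<Longrightarrow> \<bar>X - Y\<bar> \<le> 2 * (e * D)\<close>) (auto simp: field_simps)
    also have "\<dots> \<le> d" using D0 that by (simp add: field_simps)
    finally show ?thesis by simp
  qed
  then have "\<bar>X - Y\<bar> \<le> 0" using field_le_epsilon by blast
  then show ?thesis unfolding X_def Y_def by simp
qed

text \<open>A correlation. For even k and a reflection invariant functional it agrees with the usual
  convolution, and this form commutes with translations of u without any sign.\<close>

definition conv :: "('g \<Rightarrow> real) \<Rightarrow> ('g \<Rightarrow> real) \<Rightarrow> 'g \<Rightarrow> real" where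
  "conv k u t = I (\<lambda>s. k s * u (t + s))"

lemma bcs_kernel:
  assumes "bcs k" "bcs u" shows "bcs (\<lambda>s. k s * u (t + s))"
proof -
  obtain B where B: "\<And>x. \<bar>u x\<bar> \<le> B" by (rule bcsE[OF assms(2)]) blast
  show ?thesis by (rule bcs_mult[OF assms(1)]) (rule B)
qed

lemma conv_continuous:
  assumes k: "bcs k" and u: "continuous_on UNIV u" "cpt_support u"
  shows "continuous_on UNIV (conv k u)"
proof (rule continuous_on_UNIV_nhdI)
  fix x :: 'g and e :: real assume e: "0 < e"
  have bu: "bcs u" using bcs_continuous[OF u] .
  define N where "N = I (\<lambda>s. \<bar>k s\<bar>)"
  have N: "0 \<le> N" unfolding N_def by (intro nonneg bcs_abs k) auto
  have e': "0 < e / (N + 1)" using e N by simp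
  obtain O1 where O1: "open O1" "0 \<in> O1" "\<And>s s'. s - s' \<in> O1 \<Longrightarrow> \<bar>u s - u s'\<bar> < e / (N + 1)"
    using cpt_support_uniformly_continuous[OF u e'] by blast
  have "dist (conv k u y) (conv k u x) < e" if "y - x \<in> O1" for y
  proof -
    have "\<bar>I (\<lambda>s. k s * u (y + s) - k s * u (x + s))\<bar> \<le> (e / (N + 1)) * N"
      unfolding N_def
    proof (intro abs_le bcs_diff bcs_kernel bcs_abs k bu)
      show "\<bar>k s * u (y + s) - k s * u (x + s)\<bar> \<le> e / (I (\<lambda>s. \<bar>k s\<bar>) + 1) * \<bar>k s\<bar>" for s
        using mult_left_mono[OF less_imp_le[OF O1(3)[of "y + s" "x + s"]], of "\<bar>k s\<bar>"] that
        unfolding N_def by (simp add: right_diff_distrib[symmetric] abs_mult mult.commute)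
    qed
    also have "\<dots> < e" using e N by (simp add: field_simps)
    finally show ?thesis by (simp add: conv_def diff bcs_kernel k bu dist_real_def)
  qed
  then show "\<exists>U. open U \<and> x \<in> U \<and> (\<forall>y\<in>U. dist (conv k u y) (conv k u x) < e)"
    using O1 open_translate_nhd(1)[OF O1(1), of x] by (intro exI[of _ "{y. y - x \<in> O1}"]) auto
qed

lemma conv_support:
  assumes k: "compact K" "\<And>x. x \<notin> K \<Longrightarrow> k x = 0" and u: "compact L" "\<And>x. x \<notin> L \<Longrightarrow> u x = 0"
    and n: "conv k u t \<noteq> 0"
  shows "\<exists>a\<in>L. \<exists>b\<in>K. t = a - b"
proof (rule ccontr)
  assume c: "\<not> ?thesis"
  have "k s * u (t + s) = 0" for s
  proof (cases "s \<in> K \<and> t + s \<in> L")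
    case True
    then have "t = (t + s) - s" by simp
    then show ?thesis using c True by blast
  qed (use k u in auto)
  then have "(\<lambda>s. k s * u (t + s)) = (\<lambda>s. 0)" by blast
  then show False using n zero by (simp add: conv_def)
qed

lemma conv_cpt_support:
  assumes k: "bcs k" and u: "bcs u" shows "cpt_support (conv k u)"
proof -
  obtain K where K: "compact K" "\<And>x. x \<notin> K \<Longrightarrow> k x = 0" by (rule bcsE[OF k]) blast
  obtain L where L: "compact L" "\<And>x. x \<notin> L \<Longrightarrow> u x = 0" by (rule bcsE[OF u]) blast
  have "compact ((\<lambda>(u, v). u - v) ` (L \<times> K))"
    by (intro compact_continuous_image compact_Times K L) (auto simp: case_prod_beta intro!: continuous_intros)
  moreover have "conv k u t = 0" if "t \<notin> (\<lambda>(u, v). u - v) ` (L \<times> K)" for t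
    using conv_support[OF K L, where t = t] that by force
  ultimately show ?thesis unfolding cpt_support_def by blast
qed

text \<open>Young's inequality for the L^1 norm of k and the L^2 norm of u: Cauchy-Schwarz with
  weight |k| at each t, then Fubini and translation invariance.\<close>

lemma conv_norm_le:
  assumes k: "bcs k" and u: "continuous_on UNIV u" "cpt_support u"
  shows "I (\<lambda>t. (conv k u t)\<^sup>2) \<le> (I (\<lambda>s. \<bar>k s\<bar>))\<^sup>2 * I (\<lambda>t. (u t)\<^sup>2)"
proof -
  have bu: "bcs u" using bcs_continuous[OF u] .
  obtain B where B: "\<And>x. \<bar>u x\<bar> \<le> B" by (rule bcsE[OF bu]) blast
  have w: "continuous_on UNIV (\<lambda>t. (u t)\<^sup>2)" "cpt_support (\<lambda>t. (u t)\<^sup>2)"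
    using u by (auto intro!: continuous_intros simp: cpt_support_def)
  have bw: "bcs (\<lambda>t. (u t)\<^sup>2)" using bcs_continuous[OF w] .
  define N where "N = I (\<lambda>s. \<bar>k s\<bar>)"
  have N: "0 \<le> N" unfolding N_def by (intro nonneg bcs_abs k) auto
  have bc: "bcs (conv k u)"
    by (intro bcs_continuous conv_continuous conv_cpt_support k u bu)
  have bc2: "bcs (\<lambda>t. (conv k u t)\<^sup>2)"
    by (intro bcs_continuous) (use conv_continuous[OF k u] conv_cpt_support[OF k bu] in
      \<open>auto intro!: continuous_intros simp: cpt_support_def\<close>)
  obtain K where K: "compact K" "\<And>x. x \<notin> K \<Longrightarrow> conv k u x = 0" by (rule bcsE[OF bc]) blast
  \<comment> \<open>Fubini needs an outer weight of compact support; g is the indicator of a compact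
    set outside of which the convolution vanishes, so it can be inserted for free.\<close>
  define g where "g t = (if t \<in> K then 1 else 0 :: real)" for t
  have g: "bcs g" by (rule bcsI[of K _ 1]) (use K in \<open>auto simp: g_def\<close>)
  have bk1: "bcs (\<lambda>s. \<bar>k s\<bar> * (u (t + s))\<^sup>2)" for t
    using bcs_kernel[OF bcs_abs[OF k] bw] .
  have pt: "(conv k u t)\<^sup>2 \<le> N * (g t * I (\<lambda>s. \<bar>k s\<bar> * (u (t + s))\<^sup>2))" for t
  proof (cases "t \<in> K")
    case True
    obtain Kk where Kk: "compact Kk" "\<And>x. x \<notin> Kk \<Longrightarrow> k x = 0" by (rule bcsE[OF k]) blast
    \<comment> \<open>Writing k u as |k| times (sgn k) u brings the integrand into the form of the
      weighted Cauchy-Schwarz inequality.\<close>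
    define sg where "sg s = sgn (k s)" for s
    have bsg: "bcs sg" by (rule bcsI[OF Kk(1), of _ 1]) (auto simp: sg_def Kk sgn_real_def)
    have but: "bcs (\<lambda>s. u (t + s))" using bcs_translate[OF bu, of t] by (simp add: add.commute)
    have "(I (\<lambda>s. \<bar>k s\<bar> * (sg s * u (t + s))))\<^sup>2
        \<le> I (\<lambda>s. \<bar>k s\<bar> * (sg s)\<^sup>2) * I (\<lambda>s. \<bar>k s\<bar> * (u (t + s))\<^sup>2)"
      by (intro cauchy_schwarz bsg but bcs_abs k) auto
    moreover have "\<bar>k s\<bar> * (sg s * x) = k s * x" for s x
      by (simp add: sg_def mult.assoc[symmetric] abs_mult_sgn)
    moreover have "\<bar>k s\<bar> * (sg s)\<^sup>2 = \<bar>k s\<bar>" for s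
      by (auto simp: sg_def sgn_real_def)
    ultimately show ?thesis using True by (simp add: conv_def N_def g_def)
  next
    case False
    then show ?thesis using K by (simp add: g_def)
  qed
  have bgi: "bcs (\<lambda>t. g t * I (\<lambda>s. \<bar>k s\<bar> * (u (t + s))\<^sup>2))"
  proof (rule bcs_mult[OF g])
    show "\<bar>I (\<lambda>s. \<bar>k s\<bar> * (u (t + s))\<^sup>2)\<bar> \<le> B\<^sup>2 * I (\<lambda>s. \<bar>k s\<bar>)" for t
    proof (intro abs_le bk1 bcs_abs k)
      show "\<bar>\<bar>k s\<bar> * (u (t + s))\<^sup>2\<bar> \<le> B\<^sup>2 * \<bar>k s\<bar>" for s
        using mult_left_mono[OF power_mono[OF B[of "t + s"], of 2], of "\<bar>k s\<bar>"]
        by (simp add: abs_mult mult.commute)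
    qed
  qed
  have "I (\<lambda>t. (conv k u t)\<^sup>2) \<le> N * I (\<lambda>t. g t * I (\<lambda>s. \<bar>k s\<bar> * (u (t + s))\<^sup>2))"
    using mono[OF bc2 bcs_scale[OF bgi] pt] scale[OF bgi] by simp
  also have "I (\<lambda>t. g t * I (\<lambda>s. \<bar>k s\<bar> * (u (t + s))\<^sup>2)) = I (\<lambda>s. \<bar>k s\<bar> * I (\<lambda>t. g t * (u (t + s))\<^sup>2))"
    by (rule fubini[OF bcs_abs[OF k] g w])
  also have "N * \<dots> \<le> N * (I (\<lambda>t. (u t)\<^sup>2) * N)"
  proof (intro mult_left_mono N)
    have bgw: "bcs (\<lambda>t. g t * (u (t + s))\<^sup>2)" for s
      using bcs_kernel[OF g bw, of s] by (simp add: add.commute)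
    have le: "\<bar>I (\<lambda>t. g t * (u (t + s))\<^sup>2)\<bar> \<le> I (\<lambda>t. (u t)\<^sup>2)" for s
    proof -
      have "\<bar>I (\<lambda>t. g t * (u (t + s))\<^sup>2)\<bar> \<le> 1 * I (\<lambda>t. (u (t + s))\<^sup>2)"
        by (intro abs_le bgw bcs_translate[OF bw, of s]) (auto simp: g_def)
      then show ?thesis using translate[OF bw] by simp
    qed
    have "I (\<lambda>s. \<bar>k s\<bar> * I (\<lambda>t. g t * (u (t + s))\<^sup>2)) \<le> I (\<lambda>s. I (\<lambda>t. (u t)\<^sup>2) * \<bar>k s\<bar>)"
    proof (intro mono bcs_scale bcs_abs k bcs_mult[OF bcs_abs[OF k] le])
      show "\<bar>k s\<bar> * I (\<lambda>t. g t * (u (t + s))\<^sup>2) \<le> I (\<lambda>t. (u t)\<^sup>2) * \<bar>k s\<bar>" for s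
        using mult_left_mono[OF order_trans[OF abs_ge_self le[of s]], of "\<bar>k s\<bar>"] by (simp add: mult.commute)
    qed
    then show "I (\<lambda>s. \<bar>k s\<bar> * I (\<lambda>t. g t * (u (t + s))\<^sup>2)) \<le> I (\<lambda>t. (u t)\<^sup>2) * N"
      by (simp add: scale bcs_abs k N_def)
  qed
  finally show ?thesis by (simp add: N_def power2_eq_square mult_ac)
qed

lemma conv_shift: "conv k u (t + y) = conv k (\<lambda>t. u (t + y)) t"
  by (simp add: conv_def add_ac)

text \<open>Moves the translation from u onto the kernel, so that the effect of a small translation
  after smoothing is governed by the L^1 modulus of continuity of k and not by u.\<close>

lemma conv_diff_shift:
  assumes k: "bcs k" and u: "bcs u"
  shows "conv k u t - conv k u (t + x) = conv (\<lambda>s. k s - k (s - x)) u t"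
proof -
  have bk': "bcs (\<lambda>s. k (s - x))" using bcs_translate[OF k, of "- x"] by simp
  have "I (\<lambda>s. k (s - x) * u (t + s)) = I (\<lambda>s. k s * u (t + x + s))"
    using translate[OF bcs_kernel[OF bk' u, of t], of x] by (simp add: add_ac)
  then have "conv k u t - conv k u (t + x) = I (\<lambda>s. k s * u (t + s)) - I (\<lambda>s. k (s - x) * u (t + s))"
    by (simp add: conv_def)
  also have "\<dots> = I (\<lambda>s. k s * u (t + s) - k (s - x) * u (t + s))"
    by (intro diff[symmetric] bcs_kernel k bk' u)
  finally show ?thesis by (simp add: conv_def algebra_simps)
qed

end

text \<open>Fubini turns both sides into integrals over s of k s against the correlation of u and v,
  at s on one side and at - s on the other; evenness of k and reflection invariance match
  them.\<close>

lemma (in sym_haar_functional) conv_symmetric: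
  assumes k: "bcs k" and even: "\<And>s. k (- s) = k s"
    and u: "continuous_on UNIV u" "cpt_support u" and v: "continuous_on UNIV v" "cpt_support v"
  shows "I (\<lambda>t. conv k u t * v t) = I (\<lambda>t. u t * conv k v t)"
proof -
  have bu: "bcs u" and bv: "bcs v" using bcs_continuous u v by auto
  obtain B where B: "\<And>x. \<bar>v x\<bar> \<le> B" by (rule bcsE[OF bv]) blast
  have buv: "bcs (\<lambda>t. u t * v (t + s))" for s by (rule bcs_mult[OF bu]) (rule B)
  have e: "I (\<lambda>t. v t * u (t + s)) = I (\<lambda>t. u t * v (t + - s))" for s
    using translate[OF buv[of "- s"], of s] by (simp add: mult.commute)
  have b: "bcs (\<lambda>s. k s * I (\<lambda>t. u t * v (t + s)))"
  proof (rule bcs_mult[OF k])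
    show "\<bar>I (\<lambda>t. u t * v (t + s))\<bar> \<le> B * I (\<lambda>t. \<bar>u t\<bar>)" for s
      by (intro abs_le buv bcs_abs bu) (simp add: abs_mult mult.commute[of B] mult_left_mono B)
  qed
  have "I (\<lambda>t. conv k u t * v t) = I (\<lambda>t. v t * I (\<lambda>s. k s * u (t + s)))"
    by (simp add: conv_def mult.commute)
  also have "\<dots> = I (\<lambda>s. k s * I (\<lambda>t. v t * u (t + s)))" by (rule fubini[OF k bv u])
  also have "\<dots> = I (\<lambda>s. k (- s) * I (\<lambda>t. u t * v (t + - s)))" by (simp only: e even)
  also have "\<dots> = I (\<lambda>s. k s * I (\<lambda>t. u t * v (t + s)))" by (rule reflect[OF b])
  also have "\<dots> = I (\<lambda>t. u t * I (\<lambda>s. k s * v (t + s)))" by (rule fubini[OF k bu v, symmetric])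
  finally show ?thesis by (simp add: conv_def)
qed

section \<open>Characters of ordered commutative algebras\<close>

text \<open>H will be the real algebra of self-adjoint elements, kept as a subset of the ambient
  complex algebra instead of a type of its own; \<rho> embeds the real scalars.\<close>

locale real_subring =
  fixes H :: "'r::comm_ring_1 set" and \<rho> :: "real \<Rightarrow> 'r"
  assumes H_add: "a \<in> H \<Longrightarrow> b \<in> H \<Longrightarrow> a + b \<in> H"
    and H_mult: "a \<in> H \<Longrightarrow> b \<in> H \<Longrightarrow> a * b \<in> H"
    and H_const: "\<rho> r \<in> H"
    and const_add: "\<rho> (r + s) = \<rho> r + \<rho> s"
    and const_mult: "\<rho> (r * s) = \<rho> r * \<rho> s"
    and const_1: "\<rho> 1 = 1"
begin

lemma const_0: "\<rho> 0 = 0"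
  using const_add[of 0 0] by simp

lemma const_minus: "\<rho> (- r) = - \<rho> r"
  using const_add[of r "- r"] const_0 by (simp add: eq_neg_iff_add_eq_0 add.commute)

lemma const_diff: "\<rho> (r - s) = \<rho> r - \<rho> s"
  using const_add[of r "- s"] const_minus by simp

lemma H_0: "0 \<in> H" and H_1: "1 \<in> H"
  using H_const[of 0] H_const[of 1] by (simp_all add: const_0 const_1)

lemma H_minus: "a \<in> H \<Longrightarrow> - a \<in> H"
  using H_mult[OF H_const[of "-1"], of a] by (simp add: const_minus const_1)

lemma H_diff: "a \<in> H \<Longrightarrow> b \<in> H \<Longrightarrow> a - b \<in> H"
  using H_add[OF _ H_minus, of a b] by simp

lemma H_power: "a \<in> H \<Longrightarrow> a ^ n \<in> H"
  by (induction n) (auto intro: H_mult H_1)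

end

text \<open>P is the set of nonnegative elements of a total preordering. Nonzero a with both a and -
  a in P are allowed, as are infinitesimals; the character below sends them to 0.\<close>

locale archimedean_order = real_subring H \<rho> for H :: "'r::comm_ring_1 set" and \<rho> +
  fixes P :: "'r set"
  assumes P_H: "P \<subseteq> H"
    and P_add: "a \<in> P \<Longrightarrow> b \<in> P \<Longrightarrow> a + b \<in> P"
    and P_mult: "a \<in> P \<Longrightarrow> b \<in> P \<Longrightarrow> a * b \<in> P"
    and P_square: "a \<in> H \<Longrightarrow> a * a \<in> P"
    and P_proper: "- 1 \<notin> P"
    and P_total: "a \<in> H \<Longrightarrow> a \<in> P \<or> - a \<in> P"
    and P_arch: "a \<in> H \<Longrightarrow> \<exists>M. \<rho> M - a \<in> P"
begin

lemma const_in_P_iff: "\<rho> r \<in> P \<longleftrightarrow> 0 \<le> r"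
proof
  assume "0 \<le> r"
  then have "\<rho> r = \<rho> (sqrt r) * \<rho> (sqrt r)" by (simp add: const_mult[symmetric])
  then show "\<rho> r \<in> P" using P_square[OF H_const] by simp
next
  assume r: "\<rho> r \<in> P"
  show "0 \<le> r"
  proof (rule ccontr)
    assume n: "\<not> 0 \<le> r"
    have "\<rho> (sqrt (- 1 / r)) * \<rho> (sqrt (- 1 / r)) * \<rho> r \<in> P"
      by (intro P_mult[OF P_square[OF H_const] r])
    also have "\<rho> (sqrt (- 1 / r)) * \<rho> (sqrt (- 1 / r)) * \<rho> r = \<rho> ((sqrt (- 1 / r) * sqrt (- 1 / r)) * r)"
      by (simp only: const_mult)
    also have "(sqrt (- 1 / r) * sqrt (- 1 / r)) * r = - 1"
    proof -
      have "0 \<le> - 1 / r" using n by (simp add: divide_nonneg_neg)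
      then have "sqrt (- 1 / r) * sqrt (- 1 / r) = - 1 / r" by (rule real_sqrt_mult_self[THEN trans, OF abs_of_nonneg])
      then show ?thesis using n by simp
    qed
    finally show False using P_proper by (simp add: const_minus const_1)
  qed
qed

text \<open>The real number that realises the Dedekind cut of a among the constants, its standard
  part.\<close>

definition order_char :: "'r \<Rightarrow> real" where
  "order_char a = Sup {r. a - \<rho> r \<in> P}"

lemma order_char_upper: "a - \<rho> r \<in> P \<Longrightarrow> \<rho> M - a \<in> P \<Longrightarrow> r \<le> M"
  using P_add[of "a - \<rho> r" "\<rho> M - a"] const_in_P_iff[of "M - r"] by (simp add: const_diff)

lemma order_char_eqI:
  assumes a: "a \<in> H" and l: "\<And>e. 0 < e \<Longrightarrow> a - \<rho> (x - e) \<in> P" and u: "\<And>e. 0 < e \<Longrightarrow> \<rho> (x + e) - a \<in> P"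
  shows "order_char a = x"
proof -
  have ne: "{r. a - \<rho> r \<in> P} \<noteq> {}" using l[of 1] by auto
  have ub: "r \<le> x + e" if "a - \<rho> r \<in> P" "0 < e" for r e using order_char_upper[OF that(1) u[OF that(2)]] .
  have bdd: "bdd_above {r. a - \<rho> r \<in> P}" using ub[of _ 1] by (intro bdd_aboveI) auto
  have "x - e \<le> order_char a" if "0 < e" for e
    unfolding order_char_def by (intro cSup_upper bdd) (use l[OF that] in simp)
  then have 1: "x \<le> order_char a" by (metis diff_le_eq field_le_epsilon)
  have "order_char a \<le> x + e" if "0 < e" for e
    unfolding order_char_def by (intro cSup_least ne) (use ub that in simp)
  then have "order_char a \<le> x" by (rule field_le_epsilon)
  with 1 show ?thesis by simp
qed

lemma order_char_bounds:
  assumes a: "a \<in> H" and e: "0 < e"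
  shows "a - \<rho> (order_char a - e) \<in> P" "\<rho> (order_char a + e) - a \<in> P"
proof -
  obtain M where M: "\<rho> M - a \<in> P" using P_arch[OF a] by blast
  obtain N where N: "\<rho> N - (- a) \<in> P" using P_arch[OF H_minus[OF a]] by blast
  have ne: "- N \<in> {r. a - \<rho> r \<in> P}" using N by (simp add: const_minus add.commute)
  have bdd: "bdd_above {r. a - \<rho> r \<in> P}" using order_char_upper[OF _ M] by (intro bdd_aboveI) auto
  obtain r where r: "a - \<rho> r \<in> P" "order_char a - e < r"
    using less_cSupD[of "{r. a - \<rho> r \<in> P}" "order_char a - e"] ne e unfolding order_char_def by auto
  have "(a - \<rho> r) + \<rho> (r - (order_char a - e)) \<in> P"
    using r by (intro P_add) (simp_all add: const_in_P_iff)
  moreover have "(a - \<rho> r) + \<rho> (r - (order_char a - e)) = a - \<rho> (order_char a - e)"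
    by (simp add: const_diff)
  ultimately show "a - \<rho> (order_char a - e) \<in> P" by simp
  have "a - \<rho> (order_char a + e) \<notin> P"
  proof
    assume "a - \<rho> (order_char a + e) \<in> P"
    then have "order_char a + e \<le> order_char a"
      unfolding order_char_def by (intro cSup_upper bdd) simp
    then show False using e by simp
  qed
  then show "\<rho> (order_char a + e) - a \<in> P"
    using P_total[OF H_diff[OF a H_const[of "order_char a + e"]]] by simp
qed

lemma order_char_const: "order_char (\<rho> r) = r"
  by (rule order_char_eqI) (auto simp: H_const const_in_P_iff const_diff[symmetric])

lemma order_char_add:
  assumes "a \<in> H" "b \<in> H" shows "order_char (a + b) = order_char a + order_char b"
proof (rule order_char_eqI)
  fix e :: real assume "0 < e"
  then have e: "0 < e / 2" by simp
  have 1: "a + b - \<rho> (order_char a + order_char b - e)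
      = (a - \<rho> (order_char a - e / 2)) + (b - \<rho> (order_char b - e / 2))"
    using const_add[of "e / 2" "e / 2"] by (simp add: const_diff const_add algebra_simps)
  show "a + b - \<rho> (order_char a + order_char b - e) \<in> P"
    unfolding 1 by (intro P_add order_char_bounds assms e)
  have 2: "\<rho> (order_char a + order_char b + e) - (a + b)
      = (\<rho> (order_char a + e / 2) - a) + (\<rho> (order_char b + e / 2) - b)"
    using const_add[of "e / 2" "e / 2"] by (simp add: const_add algebra_simps)
  show "\<rho> (order_char a + order_char b + e) - (a + b) \<in> P"
    unfolding 2 by (intro P_add order_char_bounds assms e)
qed (intro H_add assms)

lemma order_char_scale:
  assumes "a \<in> H" shows "order_char (\<rho> r * a) = r * order_char a"
proof -
  have pos: "order_char (\<rho> r * a) = r * order_char a" if "0 < r" for r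
  proof (rule order_char_eqI)
    fix e :: real assume "0 < e"
    then have e: "0 < e / r" using that by simp
    have r: "\<rho> r \<in> P" using that by (simp add: const_in_P_iff)
    have re: "\<rho> r * (a - \<rho> (x - e / r)) = \<rho> r * a - \<rho> (r * x - e)"
        "\<rho> r * (\<rho> (x + e / r) - a) = \<rho> (r * x + e) - \<rho> r * a" for x
    proof -
      have "r * (x + e / r) = r * x + e" "r * (x - e / r) = r * x - e"
        using that by (simp_all add: algebra_simps)
      then show "\<rho> r * (a - \<rho> (x - e / r)) = \<rho> r * a - \<rho> (r * x - e)"
          "\<rho> r * (\<rho> (x + e / r) - a) = \<rho> (r * x + e) - \<rho> r * a"
        using const_mult[of r] by (metis right_diff_distrib)+
    qed
    have "\<rho> r * (a - \<rho> (order_char a - e / r)) \<in> P" "\<rho> r * (\<rho> (order_char a + e / r) - a) \<in> P"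
      by (intro P_mult r order_char_bounds assms e)+
    then show "\<rho> r * a - \<rho> (r * order_char a - e) \<in> P" "\<rho> (r * order_char a + e) - \<rho> r * a \<in> P"
      unfolding re .
  qed (intro H_mult H_const assms)
  consider "0 < r" | "r = 0" | "r < 0" by linarith
  then show ?thesis
  proof cases
    case 1 then show ?thesis by (rule pos)
  next
    case 2 then show ?thesis using order_char_const[of 0] by (simp add: const_0)
  next
    case 3
    then have n: "order_char (\<rho> (- r) * a) = - r * order_char a" by (intro pos) simp
    have "order_char (\<rho> r * a + \<rho> (- r) * a) = order_char (\<rho> r * a) + order_char (\<rho> (- r) * a)"
      by (intro order_char_add H_mult H_const assms)
    moreover have "\<rho> r * a + \<rho> (- r) * a = \<rho> 0" by (simp add: const_minus const_0)
    ultimately show ?thesis using n order_char_const[of 0] by simp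
  qed
qed

text \<open>With x the value of a and d = a - x, the product of the nonnegative elements a - (x -
  sqrt e) and (x + sqrt e) - a is e - d * d. So d * d has value 0, and expanding a = x + d gives the
  claim; general products follow by polarisation.\<close>

lemma order_char_square:
  assumes a: "a \<in> H" shows "order_char (a * a) = order_char a * order_char a"
proof -
  define x where "x = order_char a"
  define d where "d = a - \<rho> x"
  have d: "d \<in> H" unfolding d_def by (intro H_diff a H_const)
  have "order_char (d * d) = 0"
  proof (rule order_char_eqI)
    fix e :: real assume e: "0 < e"
    then have s: "0 < sqrt e" by simp
    have "(d * d) + \<rho> e \<in> P" using e by (intro P_add P_square d) (simp add: const_in_P_iff)
    then show "d * d - \<rho> (0 - e) \<in> P" by (simp add: const_minus)
    have "(a - \<rho> (x - sqrt e)) * (\<rho> (x + sqrt e) - a) \<in> P"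
      unfolding x_def by (intro P_mult order_char_bounds a s)
    also have "(a - \<rho> (x - sqrt e)) * (\<rho> (x + sqrt e) - a) = \<rho> (sqrt e) * \<rho> (sqrt e) - d * d"
      by (simp add: d_def const_add const_diff algebra_simps)
    also have "\<rho> (sqrt e) * \<rho> (sqrt e) = \<rho> (0 + e)"
      using e by (simp add: const_mult[symmetric])
    finally show "\<rho> (0 + e) - d * d \<in> P" .
  qed (intro H_mult d)
  moreover have "a * a = d * d + (\<rho> (2 * x) * d + \<rho> (x * x))"
  proof -
    have "\<rho> (2 * x) = \<rho> x + \<rho> x" using const_add[of x x] by simp
    then show ?thesis by (simp add: d_def const_mult algebra_simps)
  qed
  moreover have "order_char d = 0"
    using order_char_add[OF d H_const[of x]] order_char_const[of x] by (simp add: d_def x_def)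
  ultimately have "order_char (a * a) = x * x"
    by (simp add: order_char_add order_char_scale order_char_const H_add H_mult H_const d)
  then show ?thesis by (simp add: x_def)
qed

lemma order_char_mult:
  assumes "a \<in> H" "b \<in> H" shows "order_char (a * b) = order_char a * order_char b"
proof -
  have "(a + b) * (a + b) = a * a + (\<rho> 2 * (a * b) + b * b)"
    using const_add[of 1 1] by (simp add: const_1 algebra_simps)
  then have "order_char ((a + b) * (a + b)) = order_char (a * a) + (2 * order_char (a * b) + order_char (b * b))"
    by (simp add: order_char_add order_char_scale H_add H_mult H_const assms)
  moreover have "order_char ((a + b) * (a + b))
      = (order_char a + order_char b) * (order_char a + order_char b)"
    by (simp add: order_char_square order_char_add H_add assms)
  ultimately show ?thesis
    by (simp add: order_char_square assms) (simp add: algebra_simps)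
qed

lemma order_char_nonneg:
  assumes "a \<in> P" shows "0 \<le> order_char a"
proof -
  have "0 \<le> order_char a + e" if "0 < e" for e
    using order_char_upper[of a 0 "order_char a + e"] order_char_bounds(2)[of a e] assms P_H that
    by (auto simp: const_0)
  then show ?thesis by (rule field_le_epsilon)
qed

end

text \<open>Data of a GNS construction without completion: F (b * c) is a semi-inner product on H,
  and \<open>F_bdd\<close> says that multiplication by a is a bounded operator for it.\<close>

locale positive_functional = real_subring H \<rho> for H :: "'r::comm_ring_1 set" and \<rho> +
  fixes F :: "'r \<Rightarrow> real"
  assumes F_add: "F (a + b) = F a + F b"
    and F_scale: "F (\<rho> r * a) = r * F a"
    and F_square: "b \<in> H \<Longrightarrow> 0 \<le> F (b * b)"
    and F_bdd: "a \<in> H \<Longrightarrow> \<exists>M. \<forall>b\<in>H. F ((a * a) * (b * b)) \<le> M * F (b * b)"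
begin

lemma F_minus: "F (- a) = - F a"
  using F_scale[of "-1" a] by (simp add: const_minus const_1)

lemma F_diff: "F (a - b) = F a - F b"
  using F_add[of a "- b"] F_minus by simp

lemma F_sum: "F (sum f A) = (\<Sum>i\<in>A. F (f i))"
  using F_scale[of 0 0] by (induction A rule: infinite_finite_induct) (auto simp: F_add const_0)

text \<open>The elements acting as positive operators for the semi-inner product of F. An operator
  norm estimate puts an element into this cone without exhibiting it as a sum of squares, which is
  how the continuity of characters is obtained.\<close>

definition Pos :: "'r set" where
  "Pos = {a \<in> H. \<forall>b\<in>H. 0 \<le> F (a * (b * b))}"

lemma Pos_H: "Pos \<subseteq> H" by (auto simp: Pos_def)

lemma PosD: "a \<in> Pos \<Longrightarrow> b \<in> H \<Longrightarrow> 0 \<le> F (a * (b * b))"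
  by (auto simp: Pos_def)

lemma Pos_add: "a \<in> Pos \<Longrightarrow> b \<in> Pos \<Longrightarrow> a + b \<in> Pos"
  by (auto simp: Pos_def F_add distrib_right intro: H_add add_nonneg_nonneg)

lemma Pos_mult_square: "a \<in> Pos \<Longrightarrow> c \<in> H \<Longrightarrow> a * (c * c) \<in> Pos"
  unfolding Pos_def
proof (intro CollectI conjI ballI, goal_cases)
  case 1 then show ?case by (auto intro: H_mult)
next
  case (2 b)
  then have "0 \<le> F (a * ((c * b) * (c * b)))" by (auto intro: H_mult)
  then show ?case by (simp add: mult_ac)
qed

lemma Pos_square: "a \<in> H \<Longrightarrow> a * a \<in> Pos"
  unfolding Pos_def
proof (intro CollectI conjI ballI, goal_cases)
  case 1 then show ?case by (auto intro: H_mult)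
next
  case (2 b)
  then have "0 \<le> F ((a * b) * (a * b))" by (auto intro: H_mult F_square)
  then show ?case by (simp add: mult_ac)
qed

lemma Pos_0: "0 \<in> Pos" and Pos_1: "1 \<in> Pos"
  using Pos_square[OF H_0] Pos_square[OF H_1] by simp_all

lemma Pos_scale: "0 \<le> r \<Longrightarrow> a \<in> Pos \<Longrightarrow> \<rho> r * a \<in> Pos"
  using Pos_mult_square[of a "\<rho> (sqrt r)"] H_const by (simp add: const_mult[symmetric] mult.commute)

lemma Pos_bound:
  assumes a: "a \<in> H" shows "\<exists>M>0. \<rho> M - a \<in> Pos"
proof -
  obtain M where M: "\<And>b. b \<in> H \<Longrightarrow> F ((a * a) * (b * b)) \<le> M * F (b * b)" using F_bdd[OF a] by blast
  define N where "N = 1 + \<bar>M\<bar>"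
  have "\<rho> N - a \<in> Pos"
    unfolding Pos_def
  proof (intro CollectI conjI ballI)
    show "\<rho> N - a \<in> H" by (intro H_diff H_const a)
    fix b assume b: "b \<in> H"
    have 0: "0 \<le> F (b * b)" using F_square[OF b] .
    \<comment> \<open>Expanding this square bounds 2 F (a b b) by F (b b) + F (a a b b), hence by (1
      + M) F (b b), and N = 1 + |M| dominates half of that factor.\<close>
    have "0 \<le> F (((1 - a) * b) * ((1 - a) * b))"
      by (intro F_square H_mult H_diff H_1 a b)
    also have "((1 - a) * b) * ((1 - a) * b) = b * b - (a * (b * b) + a * (b * b)) + (a * a) * (b * b)"
      by (simp add: algebra_simps)
    also have "F \<dots> = F (b * b) - 2 * F (a * (b * b)) + F ((a * a) * (b * b))"
      by (simp only: F_add F_diff)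
    finally have "2 * F (a * (b * b)) \<le> F (b * b) + M * F (b * b)" using M[OF b] by linarith
    also have "\<dots> \<le> 2 * (N * F (b * b))"
    proof -
      have "M * F (b * b) \<le> \<bar>M\<bar> * F (b * b)" using 0 by (auto intro: mult_right_mono)
      moreover have "0 \<le> \<bar>M\<bar> * F (b * b)" using 0 by simp
      moreover have "f + x \<le> 2 * (f + y)" if "x \<le> y" "0 \<le> y" "0 \<le> f" for x y f :: real
        using that by simp
      ultimately show ?thesis using 0 unfolding N_def distrib_right mult_1 by blast
    qed
    finally show "0 \<le> F ((\<rho> N - a) * (b * b))"
      by (simp add: left_diff_distrib F_diff F_scale)
  qed
  then show ?thesis by (intro exI[of _ N]) (auto simp: N_def)
qed

lemma F_cauchy_schwarz:
  assumes a: "a \<in> H" and b: "b \<in> H"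
  shows "(F (a * b))\<^sup>2 \<le> F (a * a) * F (b * b)"
proof -
  have "0 \<le> r * r * F (a * a) + 2 * r * s * F (a * b) + s * s * F (b * b)" for r s
  proof -
    have "0 \<le> F ((\<rho> r * a + \<rho> s * b) * (\<rho> r * a + \<rho> s * b))"
      by (intro F_square H_add H_mult H_const a b)
    also have "(\<rho> r * a + \<rho> s * b) * (\<rho> r * a + \<rho> s * b)
        = \<rho> (r * r) * (a * a) + (\<rho> (r * s) * (a * b) + \<rho> (r * s) * (a * b)) + \<rho> (s * s) * (b * b)"
      by (simp add: const_mult algebra_simps)
    finally have "0 \<le> F (\<rho> (r * r) * (a * a) + (\<rho> (r * s) * (a * b) + \<rho> (r * s) * (a * b)) + \<rho> (s * s) * (b * b))" .
    then show ?thesis by (simp only: F_add F_scale)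
  qed
  then show ?thesis by (rule semidefinite_discriminant)
qed

text \<open>The argument for products of commuting positive operators: with \<open>x 0 = a\<close> and
  \<open>x (Suc n) = x n - x n * x n\<close>, the element a is the sum of the first n squares plus \<open>x n\<close>, and \<open>x n\<close>
  tends to 0 strongly.\<close>

lemma Pos_mult_aux:
  assumes a: "a \<in> Pos" "1 - a \<in> Pos" and b: "b \<in> Pos"
  shows "a * b \<in> Pos"
proof -
  have aH: "a \<in> H" and bH: "b \<in> H" using a b Pos_H by auto
  define x where "x n = ((\<lambda>x. x - x * x) ^^ n) a" for n
  have x0: "x 0 = a" and xS: "x (Suc n) = x n - x n * x n" for n by (simp_all add: x_def)
  have xP: "x n \<in> Pos \<and> 1 - x n \<in> Pos" for n
  proof (induction n)
    case 0 show ?case using a x0 by simp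
  next
    case (Suc n)
    then have h: "x n \<in> Pos" "1 - x n \<in> Pos" "x n \<in> H" "1 - x n \<in> H" using Pos_H by auto
    \<comment> \<open>The bounds 0 \<le> x n \<le> 1 are preserved using only products of a positive
      element with a square, for which positivity is already known.\<close>
    have "x (Suc n) = x n * ((1 - x n) * (1 - x n)) + (1 - x n) * (x n * x n)"
      by (simp add: xS algebra_simps)
    moreover have "1 - x (Suc n) = (1 - x n) + x n * x n" by (simp add: xS)
    ultimately show ?case by (metis Pos_add Pos_mult_square Pos_square h)
  qed
  then have xH: "x n \<in> H" for n using Pos_H by auto
  have dec: "a = (\<Sum>k<n. x k * x k) + x n" for n
    by (induction n) (auto simp: x0 xS)
  show ?thesis
    unfolding Pos_def
  proof (intro CollectI conjI ballI)
    show "a * b \<in> H" by (intro H_mult aH bH)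
    fix c assume c: "c \<in> H"
    define u where "u k = F ((x k * c) * (x k * c))" for k
    have u0: "0 \<le> u k" for k unfolding u_def by (intro F_square H_mult xH c)
    have "(\<Sum>k<n. u k) \<le> F (a * (c * c))" for n
    proof -
      have "F (a * (c * c)) = F ((\<Sum>k<n. x k * x k * (c * c)) + x n * (c * c))"
        by (subst dec[of n]) (simp only: distrib_right sum_distrib_right)
      also have "\<dots> = (\<Sum>k<n. u k) + F (x n * (c * c))"
        by (simp add: F_add F_sum u_def mult_ac)
      finally show ?thesis using PosD[OF conjunct1[OF xP] c, of n] by simp
    qed
    then have "summable u" by (intro summableI_nonneg_bounded[of _ "F (a * (c * c))"] u0)
    then have ulim: "u \<longlonglongrightarrow> 0" by (rule summable_LIMSEQ_zero)
    \<comment> \<open>After multiplication by b each square contributes a nonnegative term, and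
      Cauchy-Schwarz bounds the remainder containing x n through u n. The u k are summable because
      their sums stay below F (a * (c * c)).\<close>
    have low: "- sqrt (u n * F ((b * c) * (b * c))) \<le> F (a * b * (c * c))" for n
    proof -
      have "a * b * (c * c) = ((\<Sum>k<n. x k * x k) + x n) * b * (c * c)" by (subst dec[of n]) simp
      also have "\<dots> = (\<Sum>k<n. x k * x k * b * (c * c)) + x n * b * (c * c)"
        by (simp only: distrib_right sum_distrib_right)
      finally have "F (a * b * (c * c)) = (\<Sum>k<n. F (x k * x k * b * (c * c))) + F (x n * b * (c * c))"
        by (simp add: F_add F_sum)
      moreover have "0 \<le> F (x k * x k * b * (c * c))" for k
        using PosD[OF b, of "x k * c"] xH c H_mult by (simp add: mult_ac)
      then have "0 \<le> (\<Sum>k<n. F (x k * x k * b * (c * c)))" by (intro sum_nonneg)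
      moreover have "(F ((x n * c) * (b * c)))\<^sup>2 \<le> u n * F ((b * c) * (b * c))"
        unfolding u_def by (intro F_cauchy_schwarz H_mult xH bH c)
      then have "\<bar>F ((x n * c) * (b * c))\<bar> \<le> sqrt (u n * F ((b * c) * (b * c)))"
        by (metis real_sqrt_abs real_sqrt_le_iff)
      then have "- sqrt (u n * F ((b * c) * (b * c))) \<le> F (x n * b * (c * c))" by (simp add: mult_ac abs_le_iff)
      ultimately show ?thesis by linarith
    qed
    have "(\<lambda>n. - sqrt (u n * F ((b * c) * (b * c)))) \<longlonglongrightarrow> - sqrt (0 * F ((b * c) * (b * c)))"
      by (intro tendsto_intros ulim)
    then have "- sqrt (0 * F ((b * c) * (b * c))) \<le> F (a * b * (c * c))"
      by (rule LIMSEQ_le_const2) (use low in auto)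
    then show "0 \<le> F (a * b * (c * c))" by simp
  qed
qed

lemma Pos_mult:
  assumes a: "a \<in> Pos" and b: "b \<in> Pos" shows "a * b \<in> Pos"
proof -
  obtain M where M: "M > 0" "\<rho> M - a \<in> Pos" using Pos_bound a Pos_H by blast
  have 1: "\<rho> (1 / M) * a \<in> Pos" using M a by (intro Pos_scale) auto
  have "\<rho> (1 / M) * (\<rho> M - a) \<in> Pos" using M by (intro Pos_scale) auto
  moreover have "\<rho> (1 / M) * (\<rho> M - a) = 1 - \<rho> (1 / M) * a"
    using M(1) by (simp add: right_diff_distrib const_mult[symmetric] const_1)
  ultimately have "\<rho> (1 / M) * a * b \<in> Pos" using Pos_mult_aux[OF 1 _ b] by simp
  then have "\<rho> M * (\<rho> (1 / M) * a * b) \<in> Pos" using M by (intro Pos_scale) auto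
  moreover have "\<rho> M * (\<rho> (1 / M) * a * b) = a * b"
    using M(1) by (simp add: mult.assoc[symmetric] const_mult[symmetric] const_1)
  ultimately show ?thesis by simp
qed

text \<open>A Positivstellensatz. The cone generated by Pos and E * E - \<rho> e is proper because F
  (E * E) exceeds e * F 1. A maximal proper cone above it is total, and it is archimedean by
  \<open>Pos_bound\<close>, so its \<open>order_char\<close> is the required character.\<close>

theorem character_exists:
  assumes E: "E \<in> H" and e: "0 < e" "0 < F 1" "e * F 1 < F (E * E)"
  shows "\<exists>\<phi> :: 'r \<Rightarrow> real. (\<forall>a\<in>H. \<forall>b\<in>H. \<phi> (a + b) = \<phi> a + \<phi> b) \<and> (\<forall>a\<in>H. \<forall>b\<in>H. \<phi> (a * b) = \<phi> a * \<phi> b)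
    \<and> (\<forall>r. \<phi> (\<rho> r) = r) \<and> (\<forall>a\<in>Pos. 0 \<le> \<phi> a) \<and> e \<le> \<phi> (E * E)"
proof -
  define Q where "Q = {a + (E * E - \<rho> e) * b |a b. a \<in> Pos \<and> b \<in> Pos}"
  have EH: "E * E - \<rho> e \<in> H" by (intro H_diff H_mult H_const E)
  have QH: "Q \<subseteq> H" using Pos_H EH by (auto simp: Q_def intro!: H_add H_mult)
  have PosQ: "Pos \<subseteq> Q" using Pos_0 by (force simp: Q_def)
  have EQ: "E * E - \<rho> e \<in> Q" using Pos_0 Pos_1 unfolding Q_def by force
  have Qadd: "x + y \<in> Q" if xy: "x \<in> Q" "y \<in> Q" for x y
  proof -
    obtain a b a' b' where xy: "x = a + (E * E - \<rho> e) * b" "y = a' + (E * E - \<rho> e) * b'"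
      and h: "a \<in> Pos" "b \<in> Pos" "a' \<in> Pos" "b' \<in> Pos" using xy by (auto simp: Q_def)
    have "x + y = (a + a') + (E * E - \<rho> e) * (b + b')" unfolding xy by (simp add: algebra_simps)
    then show ?thesis unfolding Q_def using h Pos_add by blast
  qed
  have Qmult: "x * y \<in> Q" if xy: "x \<in> Q" "y \<in> Q" for x y
  proof -
    obtain a b a' b' where xy: "x = a + (E * E - \<rho> e) * b" "y = a' + (E * E - \<rho> e) * b'"
      and h: "a \<in> Pos" "b \<in> Pos" "a' \<in> Pos" "b' \<in> Pos" using xy by (auto simp: Q_def)
    have "x * y = (a * a' + b * b' * ((E * E - \<rho> e) * (E * E - \<rho> e)))
        + (E * E - \<rho> e) * (a * b' + a' * b)" unfolding xy by (simp add: algebra_simps)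
    moreover have "a * a' + b * b' * ((E * E - \<rho> e) * (E * E - \<rho> e)) \<in> Pos"
      by (intro Pos_add Pos_mult Pos_square EH h)
    moreover have "a * b' + a' * b \<in> Pos" by (intro Pos_add Pos_mult h)
    ultimately show ?thesis unfolding Q_def by blast
  qed
  \<comment> \<open>Test the hypothetical identity on E ^ n * E ^ n. The moments s n grow at least
    like q ^ n with q > e, since their ratios increase by Cauchy-Schwarz, whereas r (n + 1) \<le> e
    * r n - s n forces s n \<le> e * r n and r n \<le> e ^ n * r 0.\<close>
  have Qproper: "- 1 \<notin> Q"
  proof
    assume "- 1 \<in> Q"
    then obtain a b where ab: "- 1 = a + (E * E - \<rho> e) * b" "a \<in> Pos" "b \<in> Pos" by (auto simp: Q_def)
    define s where "s n = F (E ^ n * E ^ n)" for n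
    define r where "r n = F (b * (E ^ n * E ^ n))" for n
    define q where "q = F (E * E) / F 1"
    have q: "e < q" using e by (simp add: q_def field_simps)
    have s0: "s 0 = F 1" by (simp add: s_def)
    have sq: "0 < s n \<and> q * s n \<le> s (Suc n)" for n
    proof (induction n)
      case 0
      then show ?case using e by (simp add: s_def q_def)
    next
      case (Suc n)
      then have 1: "0 < s n" "q * s n \<le> s (Suc n)" by auto
      have q0: "0 < q" using q e by linarith
      have 2: "0 < s (Suc n)" using 1 q0 by (meson less_le_trans mult_pos_pos)
      have "(F (E ^ n * E ^ Suc (Suc n)))\<^sup>2 \<le> s n * s (Suc (Suc n))"
        unfolding s_def by (intro F_cauchy_schwarz H_power E)
      also have "E ^ n * E ^ Suc (Suc n) = E ^ Suc n * E ^ Suc n" by (simp add: mult_ac)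
      finally have "s (Suc n) * s (Suc n) \<le> s n * s (Suc (Suc n))" by (simp add: s_def power2_eq_square)
      moreover have "q * s n * s (Suc n) \<le> s (Suc n) * s (Suc n)"
        using 1 2 by (intro mult_right_mono) auto
      ultimately have "s n * (q * s (Suc n)) \<le> s n * s (Suc (Suc n))" by (simp add: mult_ac)
      then show ?case using 1 2 by simp
    qed
    have sn: "q ^ n * s 0 \<le> s n" for n
    proof (induction n)
      case (Suc n)
      have "q ^ Suc n * s 0 = q * (q ^ n * s 0)" by simp
      also have "\<dots> \<le> q * s n" using Suc q e by (intro mult_left_mono) auto
      also have "\<dots> \<le> s (Suc n)" using sq by blast
      finally show ?case .
    qed simp
    have rec: "r (Suc n) \<le> e * r n - s n" for n
    proof -
      have "F (- 1 * (E ^ n * E ^ n)) = F ((a + (E * E - \<rho> e) * b) * (E ^ n * E ^ n))"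
        using ab(1) by simp
      also have "(a + (E * E - \<rho> e) * b) * (E ^ n * E ^ n)
          = a * (E ^ n * E ^ n) + (b * (E ^ Suc n * E ^ Suc n) - \<rho> e * (b * (E ^ n * E ^ n)))"
        by (simp add: algebra_simps)
      also have "F \<dots> = F (a * (E ^ n * E ^ n)) + (r (Suc n) - e * r n)"
        by (simp only: F_add F_diff F_scale r_def)
      finally have "- s n = F (a * (E ^ n * E ^ n)) + (r (Suc n) - e * r n)"
        by (simp add: F_minus s_def)
      then show ?thesis using PosD[OF ab(2) H_power[OF E], of n] by linarith
    qed
    have r0: "0 \<le> r n" for n unfolding r_def by (rule PosD[OF ab(3) H_power[OF E]])
    have rn: "r n \<le> e ^ n * r 0" for n
    proof (induction n)
      case (Suc n)
      have "r (Suc n) \<le> e * r n" using rec[of n] sq[of n] by linarith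
      also have "\<dots> \<le> e * (e ^ n * r 0)" using Suc e by (intro mult_left_mono) auto
      finally show ?case by simp
    qed simp
    have "q ^ n * s 0 \<le> e * (e ^ n * r 0)" for n
    proof -
      have "s n \<le> e * r n" using rec[of n] r0[of "Suc n"] by linarith
      also have "\<dots> \<le> e * (e ^ n * r 0)" using rn e by (intro mult_left_mono) auto
      finally show ?thesis using sn[of n] by linarith
    qed
    then have bd: "(q / e) ^ n \<le> e * r 0 / s 0" for n
      using e s0 by (simp add: power_divide field_simps)
    have "1 < q / e" using q e by simp
    then obtain n where "e * r 0 / s 0 < (q / e) ^ n" using real_arch_pow by blast
    then show False using bd[of n] by simp
  qed
  define \<A> where "\<A> = {P. Q \<subseteq> P \<and> P \<subseteq> H \<and> (\<forall>x\<in>P. \<forall>y\<in>P. x + y \<in> P \<and> x * y \<in> P) \<and> - 1 \<notin> P}"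
  have "\<exists>P\<in>\<A>. \<forall>X\<in>\<A>. P \<subseteq> X \<longrightarrow> X = P"
  proof (rule subset_Zorn_nonempty)
    have "Q \<in> \<A>" using QH Qadd Qmult Qproper by (auto simp: \<A>_def)
    then show "\<A> \<noteq> {}" by blast
    fix C assume C: "C \<noteq> {}" "subset.chain \<A> C"
    have CA: "X \<in> \<A>" if "X \<in> C" for X using C that by (auto simp: subset.chain_def)
    have "x + y \<in> \<Union>C \<and> x * y \<in> \<Union>C" if xy: "x \<in> \<Union>C" "y \<in> \<Union>C" for x y
    proof -
      obtain A B where "A \<in> C" "B \<in> C" "x \<in> A" "y \<in> B" using xy by blast
      moreover from this have "A \<subseteq> B \<or> B \<subseteq> A" using C by (auto simp: subset.chain_def)
      ultimately obtain D where D: "D \<in> C" "x \<in> D" "y \<in> D" by blast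
      then have "x + y \<in> D \<and> x * y \<in> D" using CA[OF D(1)] by (auto simp: \<A>_def)
      then show ?thesis by (intro conjI UnionI[OF D(1)]) simp_all
    qed
    moreover have "Q \<subseteq> \<Union>C" using C(1) CA by (force simp: \<A>_def)
    moreover have "\<Union>C \<subseteq> H" "- 1 \<notin> \<Union>C" using CA by (auto simp: \<A>_def)
    ultimately show "\<Union>C \<in> \<A>" by (auto simp: \<A>_def)
  qed
  then obtain P where PA: "P \<in> \<A>" and Pmax: "\<And>X. X \<in> \<A> \<Longrightarrow> P \<subseteq> X \<Longrightarrow> X = P" by blast
  have P: "Q \<subseteq> P" "P \<subseteq> H" "- 1 \<notin> P" "\<And>x y. x \<in> P \<Longrightarrow> y \<in> P \<Longrightarrow> x + y \<in> P"
    "\<And>x y. x \<in> P \<Longrightarrow> y \<in> P \<Longrightarrow> x * y \<in> P" using PA by (auto simp: \<A>_def)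
  have PosP: "Pos \<subseteq> P" using PosQ P by auto
  \<comment> \<open>By maximality the cone generated by P and a contains -1; since a * a lies in P,
    all its elements have the form p + a * q.\<close>
  have ext: "\<exists>p\<in>P. \<exists>q\<in>P. - 1 = p + a * q" if a: "a \<in> H" "a \<notin> P" for a
  proof (rule ccontr)
    assume n: "\<not> ?thesis"
    define X where "X = {p + a * q |p q. p \<in> P \<and> q \<in> P}"
    have PX: "P \<subseteq> X" using Pos_0 PosP by (force simp: X_def)
    have aX: "a \<in> X" using Pos_0 Pos_1 PosP unfolding X_def by force
    have "x + y \<in> X \<and> x * y \<in> X" if xy: "x \<in> X" "y \<in> X" for x y
    proof -
      obtain p q p' q' where xy: "x = p + a * q" "y = p' + a * q'"
        and h: "p \<in> P" "q \<in> P" "p' \<in> P" "q' \<in> P" using xy by (auto simp: X_def)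
      have "x + y = (p + p') + a * (q + q')" "x * y = (p * p' + (a * a) * (q * q')) + a * (p * q' + p' * q)"
        unfolding xy by (simp_all add: algebra_simps)
      moreover have "a * a \<in> P" using Pos_square a PosP by auto
      moreover have "p + p' \<in> P" "q + q' \<in> P" "p * q' + p' * q \<in> P"
        by (intro P(4,5) h)+
      moreover from \<open>a * a \<in> P\<close> have "p * p' + (a * a) * (q * q') \<in> P" by (blast intro: P(4,5) h)
      ultimately show ?thesis unfolding X_def by (metis (mono_tags, lifting) mem_Collect_eq)
    qed
    moreover have "X \<subseteq> H" using P(2) a(1) by (auto simp: X_def intro!: H_add H_mult)
    moreover have "- 1 \<notin> X" using n unfolding X_def by auto
    ultimately have "X \<in> \<A>" using PX P(1) by (auto simp: \<A>_def)
    then have "X = P" using PX by (rule Pmax)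
    then show False using aX a by simp
  qed
  \<comment> \<open>Multiplying the two representations of -1 gives - (a * a) * (q * q') = (1 + p) *
    (1 + p'); solving for -1 would exhibit it as an element of P.\<close>
  have total: "a \<in> P \<or> - a \<in> P" if a: "a \<in> H" for a
  proof (rule ccontr)
    assume n: "\<not> ?thesis"
    obtain p q where pq: "p \<in> P" "q \<in> P" "- 1 = p + a * q" using ext[of a] a n by blast
    obtain p' q' where pq': "p' \<in> P" "q' \<in> P" "- 1 = p' + (- a) * q'" using ext[of "- a"] H_minus[OF a] n by blast
    have e1: "- (a * q) = 1 + p" using pq(3) by (metis add.commute add_diff_cancel_right' diff_minus_eq_add minus_add_cancel minus_diff_eq)
    have e2: "a * q' = 1 + p'" using pq'(3) by (metis add.commute add_diff_cancel_right' diff_minus_eq_add minus_add_cancel minus_diff_eq mult_minus_left)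
    have "- ((a * a) * (q * q')) = (1 + p) * (1 + p')"
      by (simp add: e1[symmetric] e2[symmetric] mult_ac)
    then have "(a * a) * (q * q') = - ((1 + p) * (1 + p'))" by (metis minus_minus)
    then have "- 1 = p + p' + p * p' + (a * a) * (q * q')" by (simp add: algebra_simps)
    moreover have "p + p' + p * p' + (a * a) * (q * q') \<in> P"
      by (intro P(4,5) pq(1,2) pq'(1,2) subsetD[OF PosP Pos_square[OF a]])
    ultimately show False using P(3) by simp
  qed
  interpret archimedean_order H \<rho> P
  proof
    show "\<exists>M. \<rho> M - a \<in> P" if "a \<in> H" for a using Pos_bound[OF that] PosP by blast
  qed (use P total Pos_square PosP in auto)
  have "0 \<le> order_char (E * E - \<rho> e)" using EQ P(1) by (intro order_char_nonneg) auto
  moreover have "order_char (E * E - \<rho> e + \<rho> e) = order_char (E * E - \<rho> e) + order_char (\<rho> e)"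
    by (intro order_char_add EH H_const)
  ultimately have "e \<le> order_char (E * E)" by (simp add: order_char_const)
  then show ?thesis
    using order_char_add order_char_mult order_char_const order_char_nonneg PosP
    by (intro exI[of _ order_char]) auto
qed

end

section \<open>The operator algebra\<close>

lemma poly_mapping_add_induct:
  fixes a :: "'k \<Rightarrow>\<^sub>0 'c::comm_monoid_add"
  assumes "\<And>k c. P (Poly_Mapping.single k c)" "\<And>a b. P a \<Longrightarrow> P b \<Longrightarrow> P (a + b)"
  shows "P a"
proof (induction a rule: update_induct)
  case const
  show ?case using assms(1)[of undefined 0] by simp
next
  case (update f a b)
  have "Poly_Mapping.update a b f = f + Poly_Mapping.single a b"
  proof (rule poly_mapping_eqI)
    fix k
    have "Poly_Mapping.lookup f a = 0" using update(1) by (simp add: in_keys_iff)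
    then show "Poly_Mapping.lookup (Poly_Mapping.update a b f) k = Poly_Mapping.lookup (f + Poly_Mapping.single a b) k"
      by (auto simp: lookup_update lookup_add lookup_single when_def)
  qed
  then show ?case using assms update by simp
qed

text \<open>E receives the coefficient together with the key, because the extension is needed for
  maps that are merely additive in the coefficient: \<open>star\<close> is conjugate linear and
  \<open>Fn\<close> real linear.\<close>

definition lin_ext :: "('k \<Rightarrow> 'c::comm_monoid_add \<Rightarrow> 'b::comm_monoid_add) \<Rightarrow> ('k \<Rightarrow>\<^sub>0 'c) \<Rightarrow> 'b" where
  "lin_ext E a = (\<Sum>k\<in>Poly_Mapping.keys a. E k (Poly_Mapping.lookup a k))"

lemma lin_ext_add:
  assumes "\<And>k. E k 0 = 0" "\<And>k c d. E k (c + d) = E k c + E k d"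
  shows "lin_ext E (a + b) = lin_ext E a + lin_ext E b"
  unfolding lin_ext_def by (rule setsum_keys_plus_distrib) (use assms in auto)

lemma lin_ext_single:
  assumes "\<And>k. E k 0 = 0" shows "lin_ext E (Poly_Mapping.single k c) = E k c"
  using assms by (simp add: lin_ext_def)

type_synonym 'g opalg = "('g \<times> nat) \<Rightarrow>\<^sub>0 complex"

text \<open>The ring of polynomials in one variable over the group algebra of \<open>'g\<close>: the monomial
  \<open>(x, n)\<close> stands for the translation by \<open>x\<close> composed with the \<open>n\<close>-th power of a smoothing operator.\<close>

definition star :: "'g::ab_group_add opalg \<Rightarrow> 'g opalg" where
  "star = lin_ext (\<lambda>(x, n) c. Poly_Mapping.single (- x, n) (cnj c))"

lemma star_add: "star (a + b) = star a + star b"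
  unfolding star_def by (rule lin_ext_add) (auto simp: single_add)

lemma star_single: "star (Poly_Mapping.single (x, n) c) = Poly_Mapping.single (- x, n) (cnj c)"
  unfolding star_def by (subst lin_ext_single) auto

lemma star_mult: "star (a * b) = star a * star b"
proof (induction a rule: poly_mapping_add_induct)
  case (1 k c)
  show ?case
  proof (induction b rule: poly_mapping_add_induct)
    case (1 l d)
    then show ?case by (cases k; cases l) (simp add: mult_single star_single)
  next
    case (2 b b')
    then show ?case by (simp add: distrib_left star_add)
  qed
next
  case (2 a a')
  then show ?case by (simp add: distrib_right star_add)
qed

section \<open>Generators of the operator algebra and their trigonometric parts\<close>

definition trans_el :: "'g::ab_group_add \<Rightarrow> 'g opalg" where
  "trans_el x = Poly_Mapping.single (x, 0) 1"

definition smooth_el :: "'g::ab_group_add opalg" where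
  "smooth_el = Poly_Mapping.single (0, 1) 1"

definition const_el :: "complex \<Rightarrow> 'g::ab_group_add opalg" where
  "const_el c = Poly_Mapping.single (0, 0) c"

lemma star_trans: "star (trans_el x) = trans_el (- x)"
  and star_smooth: "star smooth_el = smooth_el"
  and star_const: "star (const_el c) = const_el (cnj c)"
  by (simp_all add: trans_el_def smooth_el_def const_el_def star_single)

lemma trans_el_add: "trans_el (x + y) = trans_el x * trans_el y"
  by (simp add: trans_el_def mult_single)

lemma const_el_add: "const_el (c + d) = const_el c + const_el d"
  and const_el_mult: "const_el (c * d) = const_el c * const_el d"
  by (simp_all add: const_el_def mult_single single_add)

lemma const_el_1: "const_el 1 = 1" and const_el_0: "const_el 0 = 0" and trans_el_0: "trans_el 0 = 1"
  by (simp_all add: const_el_def trans_el_def zero_prod_def[symmetric])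

lemma const_el_minus: "const_el (- c) = - const_el c"
  by (simp add: const_el_def single_uminus)

lemma star_minus: "star (- a) = - star a"
proof -
  have "star (const_el (- 1) * a) = const_el (- 1) * star a" by (simp add: star_mult star_const)
  then show ?thesis by (simp add: const_el_minus const_el_1)
qed

lemma star_1: "star 1 = 1"
  using star_const[of 1] by (simp add: const_el_1)

text \<open>Characters are produced on self-adjoint elements only, so the translation is split into
  self-adjoint real and imaginary parts: it equals \<open>cos_el x\<close> plus i times
  \<open>sin_el x\<close>.\<close>

definition cos_el :: "'g::ab_group_add \<Rightarrow> 'g opalg" where
  "cos_el x = const_el (1 / 2) * (trans_el x + trans_el (- x))"

definition sin_el :: "'g::ab_group_add \<Rightarrow> 'g opalg" where
  "sin_el x = const_el (- \<i> / 2) * (trans_el x - trans_el (- x))"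

lemma star_diff: "star (a - b) = star a - star b"
  using star_add[of a "- b"] star_minus[of b] by simp

lemma star_cos: "star (cos_el x) = cos_el x" and star_sin: "star (sin_el x) = sin_el x"
proof -
  show "star (cos_el x) = cos_el x"
    by (simp add: cos_el_def star_mult star_add star_const star_trans add.commute)
  have "star (sin_el x) = const_el (\<i> / 2) * (trans_el (- x) - trans_el x)"
    by (simp add: sin_el_def star_mult star_diff star_const star_trans)
  also have "\<dots> = const_el (- \<i> / 2) * (trans_el x - trans_el (- x))"
    by (simp add: const_el_minus[of "\<i> / 2", simplified] algebra_simps)
  finally show "star (sin_el x) = sin_el x" by (simp add: sin_el_def)
qed

lemma cos_el_add: "cos_el (x + y) = cos_el x * cos_el y - sin_el x * sin_el y" (is ?C)
  and sin_el_add: "sin_el (x + y) = sin_el x * cos_el y + cos_el x * sin_el y" (is ?S)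
  and cos_sin_el: "cos_el x * cos_el x + sin_el x * sin_el x = 1" (is ?Q)
proof -
  define A B :: "'a opalg" where "A = const_el (1 / 2)" and "B = const_el (- \<i> / 2)"
  have AA: "A + A = 1" by (simp add: A_def const_el_add[symmetric] const_el_1)
  have BB: "B * B = - (A * A)"
    by (simp add: A_def B_def const_el_mult[symmetric] const_el_minus[symmetric])
  have A2: "A * A + A * A = A"
    by (simp add: A_def const_el_mult[symmetric] const_el_add[symmetric])
  have AB2: "A * B + A * B = B"
    by (simp add: A_def B_def const_el_mult[symmetric] const_el_add[symmetric])
  define X X' Y Y' where "X = trans_el x" and "X' = trans_el (- x)" and "Y = trans_el y" and "Y' = trans_el (- y)"
  have c: "cos_el x = A * (X + X')" "cos_el y = A * (Y + Y')" "sin_el x = B * (X - X')" "sin_el y = B * (Y - Y')"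
    by (simp_all add: cos_el_def sin_el_def A_def B_def X_def X'_def Y_def Y'_def)
  have xy: "trans_el (x + y) = X * Y" "trans_el (- (x + y)) = X' * Y'"
    by (simp_all add: X_def X'_def Y_def Y'_def trans_el_add[symmetric] add.commute)
  have cxy: "cos_el (x + y) = A * (X * Y + X' * Y')" "sin_el (x + y) = B * (X * Y - X' * Y')"
    by (simp_all only: cos_el_def sin_el_def xy A_def B_def)
  have "cos_el x * cos_el y - sin_el x * sin_el y
      = (A * A) * ((X + X') * (Y + Y')) - (B * B) * ((X - X') * (Y - Y'))"
    unfolding c by (simp add: mult_ac)
  also have "\<dots> = (A * A + A * A) * (X * Y + X' * Y')" unfolding BB by (simp add: algebra_simps)
  finally show ?C unfolding cxy A2 by simp
  have "sin_el x * cos_el y + cos_el x * sin_el y = (A * B + A * B) * (X * Y - X' * Y')"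
    unfolding c by (simp add: algebra_simps)
  then show ?S unfolding cxy AB2 by simp
  have XX: "X * X' = 1" by (simp add: X_def X'_def trans_el_add[symmetric] trans_el_0)
  have "cos_el x * cos_el x + sin_el x * sin_el x
      = (A * A) * ((X + X') * (X + X')) + (B * B) * ((X - X') * (X - X'))"
    unfolding c by (simp add: mult_ac)
  also have "\<dots> = (A * A + A * A) * (X * X' + X * X')" unfolding BB by (simp add: algebra_simps)
  also have "\<dots> = A + A" unfolding A2 XX by (simp add: distrib_left)
  finally show ?Q unfolding AA .
qed

text \<open>Evenness of k makes its convolution operator symmetric for \<open>ip\<close>, which is
  what justifies that \<open>star\<close> fixes \<open>smooth_el\<close>.\<close>

locale smoothing_operator = sym_haar_functional I
  for I :: "('g::topological_ab_group_add \<Rightarrow> real) \<Rightarrow> real" +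
  fixes k :: "'g \<Rightarrow> real"
  assumes k_cont: "continuous_on UNIV k" and k_supp: "cpt_support k" and k_even: "k (- s) = k s"
begin

lemma k_bcs: "bcs k" by (rule bcs_continuous[OF k_cont k_supp])

definition Cc :: "('g \<Rightarrow> real) set" where
  "Cc = {u. continuous_on UNIV u \<and> cpt_support u}"

lemma CcD: "u \<in> Cc \<Longrightarrow> continuous_on UNIV u" "u \<in> Cc \<Longrightarrow> cpt_support u" "u \<in> Cc \<Longrightarrow> bcs u"
  by (auto simp: Cc_def intro: bcs_continuous)

lemma Cc_cong_bcs: "continuous_on UNIV u \<Longrightarrow> bcs u \<Longrightarrow> u \<in> Cc"
  by (simp add: Cc_def bcs_def)

lemma Cc_add: "u \<in> Cc \<Longrightarrow> v \<in> Cc \<Longrightarrow> (\<lambda>t. u t + v t) \<in> Cc"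
  by (rule Cc_cong_bcs) (auto intro!: bcs_add continuous_intros simp: CcD)

lemma Cc_scale: "u \<in> Cc \<Longrightarrow> (\<lambda>t. c * u t) \<in> Cc"
  by (rule Cc_cong_bcs) (auto intro!: bcs_scale continuous_intros simp: CcD)

lemma Cc_shift: "u \<in> Cc \<Longrightarrow> (\<lambda>t. u (t + x)) \<in> Cc"
  by (rule Cc_cong_bcs) (auto intro!: bcs_translate continuous_on_compose2[OF CcD(1)] continuous_intros simp: CcD)

lemma Cc_conv: "u \<in> Cc \<Longrightarrow> conv k u \<in> Cc"
  using conv_continuous[OF k_bcs CcD(1,2)] conv_cpt_support[OF k_bcs CcD(3)] by (simp add: Cc_def)

lemma bcs_Cc_mult: "u \<in> Cc \<Longrightarrow> v \<in> Cc \<Longrightarrow> bcs (\<lambda>t. u t * v t)"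
proof -
  assume u: "u \<in> Cc" and v: "v \<in> Cc"
  obtain B where B: "\<And>x. \<bar>v x\<bar> \<le> B" by (rule bcsE[OF CcD(3)[OF v]]) blast
  show ?thesis by (rule bcs_mult[OF CcD(3)[OF u]]) (rule B)
qed

lemma conv_add: "u \<in> Cc \<Longrightarrow> v \<in> Cc \<Longrightarrow> conv k (\<lambda>t. u t + v t) t = conv k u t + conv k v t"
  using add[OF bcs_kernel[OF k_bcs CcD(3)] bcs_kernel[OF k_bcs CcD(3)], of u v t t]
  by (simp add: conv_def algebra_simps)

lemma conv_scale: "u \<in> Cc \<Longrightarrow> conv k (\<lambda>t. c * u t) t = c * conv k u t"
  using scale[OF bcs_kernel[OF k_bcs CcD(3)], of u c t] by (simp add: conv_def mult_ac)

definition ip :: "('g \<Rightarrow> real) \<Rightarrow> ('g \<Rightarrow> real) \<Rightarrow> real" where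
  "ip u v = I (\<lambda>t. u t * v t)"

lemma ip_add_left: "u \<in> Cc \<Longrightarrow> u' \<in> Cc \<Longrightarrow> v \<in> Cc \<Longrightarrow> ip (\<lambda>t. u t + u' t) v = ip u v + ip u' v"
  unfolding ip_def by (simp add: add[OF bcs_Cc_mult bcs_Cc_mult, symmetric] distrib_right)

lemma ip_commute: "ip u v = ip v u"
  by (simp add: ip_def mult.commute)

lemma ip_add_right: "u \<in> Cc \<Longrightarrow> u' \<in> Cc \<Longrightarrow> v \<in> Cc \<Longrightarrow> ip v (\<lambda>t. u t + u' t) = ip v u + ip v u'"
  using ip_add_left[of u u' v] by (simp add: ip_commute)

lemma ip_scale: "u \<in> Cc \<Longrightarrow> v \<in> Cc \<Longrightarrow> ip (\<lambda>t. c * u t) (\<lambda>t. d * v t) = c * d * ip u v"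
  using scale[OF bcs_Cc_mult[of u v], of "c * d"] by (simp add: ip_def mult_ac)

lemma ip_nonneg: "u \<in> Cc \<Longrightarrow> 0 \<le> ip u u"
  unfolding ip_def by (intro nonneg bcs_Cc_mult) auto

lemma ip_pos: "u \<in> Cc \<Longrightarrow> u y \<noteq> 0 \<Longrightarrow> 0 < ip u u"
proof -
  assume u: "u \<in> Cc" "u y \<noteq> 0"
  have "0 < I (\<lambda>t. u t * u t)"
  proof (rule pos)
    show "continuous_on UNIV (\<lambda>t. u t * u t)" by (intro continuous_intros CcD(1) u)
    show "cpt_support (\<lambda>t. u t * u t)" using CcD(2)[OF u(1)] by (auto simp: cpt_support_def)
    show "0 < u y * u y" using u(2) by (simp add: zero_less_mult_iff not_less_iff_gr_or_eq) linarith
  qed auto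
  then show ?thesis by (simp add: ip_def)
qed

lemma ip_shift: "u \<in> Cc \<Longrightarrow> v \<in> Cc \<Longrightarrow> ip (\<lambda>t. u (t + x)) (\<lambda>t. v (t + y)) = ip (\<lambda>t. u (t + (x - y))) v"
  using translate[OF bcs_Cc_mult[OF Cc_shift, of u v "x - y"], of y] by (simp add: ip_def algebra_simps)

lemma ip_conv: "u \<in> Cc \<Longrightarrow> v \<in> Cc \<Longrightarrow> ip (conv k u) v = ip u (conv k v)"
  unfolding ip_def by (rule conv_symmetric) (auto simp: k_bcs k_even CcD)

text \<open>The kernel itself serves as cyclic vector: the monomial (x, n) sends k to the translate
  by x of \<open>kpow n\<close>, and \<open>kpow 0\<close> is k.\<close>

definition kpow :: "nat \<Rightarrow> 'g \<Rightarrow> real" where "kpow n = (conv k ^^ n) k"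

lemma kpow_Cc: "kpow n \<in> Cc"
  by (induction n) (auto simp: kpow_def Cc_conv, simp add: Cc_def k_cont k_supp)

lemma kpow_Suc: "conv k (kpow n) = kpow (Suc n)"
  by (simp add: kpow_def)

lemma kpow_shift_Cc: "(\<lambda>t. kpow n (t + x)) \<in> Cc"
  by (rule Cc_shift[OF kpow_Cc])

lemma conv_kpow_shift: "conv k (\<lambda>t. kpow n (t + x)) = (\<lambda>t. kpow (Suc n) (t + x))"
  using conv_shift[of k "kpow n" _ x] by (simp add: kpow_Suc fun_eq_iff)

text \<open>The matrix coefficient of a monomial at the cyclic vector. Symmetry of convolution and
  translation invariance reduce all inner products of translated powers to it.\<close>

definition gram :: "'g \<times> nat \<Rightarrow> real" where
  "gram p = ip (\<lambda>t. kpow (snd p) (t + fst p)) k"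

lemma gram_eq: "ip (\<lambda>t. kpow n (t + x)) (\<lambda>t. kpow m (t + y)) = gram (x - y, n + m)"
proof -
  have "ip (\<lambda>t. kpow n (t + x)) (kpow m) = ip (\<lambda>t. kpow (n + m) (t + x)) k" for x
  proof (induction m arbitrary: n)
    case (Suc m)
    have "ip (\<lambda>t. kpow n (t + x)) (kpow (Suc m)) = ip (conv k (\<lambda>t. kpow n (t + x))) (kpow m)"
      by (subst ip_conv) (auto simp: kpow_shift_Cc kpow_Cc kpow_Suc)
    then show ?case using Suc[of "Suc n"] by (simp add: conv_kpow_shift)
  qed (simp add: kpow_def)
  then show ?thesis unfolding gram_def by (subst ip_shift) (auto simp: kpow_Cc)
qed

section \<open>The state on the operator algebra and its representing vectors\<close>

definition Fn :: "'g opalg \<Rightarrow> real" where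
  "Fn = lin_ext (\<lambda>p c. Re c * gram p)"

text \<open>Real and imaginary part of the vector a k, kept apart because \<open>conv\<close> and
  \<open>ip\<close> work with real functions. Accordingly \<open>Fn (a * star b)\<close> is the real
  part of the inner product of the vectors a k and b k.\<close>

definition vre :: "'g opalg \<Rightarrow> 'g \<Rightarrow> real" where
  "vre a t = lin_ext (\<lambda>p c. Re c * kpow (snd p) (t + fst p)) a"

definition vim :: "'g opalg \<Rightarrow> 'g \<Rightarrow> real" where
  "vim a t = lin_ext (\<lambda>p c. Im c * kpow (snd p) (t + fst p)) a"

lemma Fn_add: "Fn (a + b) = Fn a + Fn b"
  unfolding Fn_def by (rule lin_ext_add) (auto simp: distrib_right)

lemma Fn_single: "Fn (Poly_Mapping.single p c) = Re c * gram p"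
  unfolding Fn_def by (subst lin_ext_single) auto

lemma vre_add: "vre (a + b) t = vre a t + vre b t" and vim_add: "vim (a + b) t = vim a t + vim b t"
  unfolding vre_def vim_def by (subst lin_ext_add; auto simp: distrib_right)+

lemma vre_single: "vre (Poly_Mapping.single (x, n) c) t = Re c * kpow n (t + x)"
  and vim_single: "vim (Poly_Mapping.single (x, n) c) t = Im c * kpow n (t + x)"
  unfolding vre_def vim_def by (subst lin_ext_single; auto)+

lemma v_Cc: "vre a \<in> Cc" "vim a \<in> Cc"
proof -
  have "vre a \<in> Cc \<and> vim a \<in> Cc"
  proof (induction a rule: poly_mapping_add_induct)
    case (1 p c)
    then show ?case using Cc_scale[OF kpow_shift_Cc]
      by (cases p) (simp add: vre_single[abs_def] vim_single[abs_def])
  next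
    case (2 a b)
    then show ?case by (simp add: vre_add[abs_def] vim_add[abs_def] Cc_add)
  qed
  then show "vre a \<in> Cc" "vim a \<in> Cc" by simp_all
qed

lemma Fn_star: "Fn (a * star b) = ip (vre a) (vre b) + ip (vim a) (vim b)"
proof (induction a rule: poly_mapping_add_induct)
  case (1 p c)
  show ?case
  proof (induction b rule: poly_mapping_add_induct)
    case (1 q d)
    obtain x n y m where pq: "p = (x, n)" "q = (y, m)" by (cases p; cases q)
    show ?case
      unfolding pq star_single mult_single Fn_single vre_single[abs_def] vim_single[abs_def]
        ip_scale[OF kpow_shift_Cc kpow_shift_Cc] gram_eq
      by (simp add: algebra_simps)
  next
    case (2 b b')
    then show ?case
      by (simp add: star_add distrib_left Fn_add vre_add[abs_def] vim_add[abs_def] ip_add_right v_Cc)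
  qed
next
  case (2 a a')
  then show ?case
    by (simp add: distrib_right Fn_add vre_add[abs_def] vim_add[abs_def] ip_add_left v_Cc)
qed

lemma v_smooth: "vre (smooth_el * a) t = conv k (vre a) t" "vim (smooth_el * a) t = conv k (vim a) t"
proof -
  have "vre (smooth_el * a) t = conv k (vre a) t \<and> vim (smooth_el * a) t = conv k (vim a) t"
  proof (induction a arbitrary: t rule: poly_mapping_add_induct)
    case (1 p c)
    then show ?case
      by (cases p) (simp add: smooth_el_def mult_single vre_single[abs_def] vim_single[abs_def]
          conv_scale kpow_shift_Cc conv_kpow_shift)
  next
    case (2 a b)
    then show ?case by (simp add: distrib_left vre_add[abs_def] vim_add[abs_def] conv_add v_Cc)
  qed
  then show "vre (smooth_el * a) t = conv k (vre a) t" "vim (smooth_el * a) t = conv k (vim a) t" by simp_all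
qed

lemma v_trans: "vre (trans_el x * a) t = vre a (t + x)" "vim (trans_el x * a) t = vim a (t + x)"
proof -
  have "vre (trans_el x * a) t = vre a (t + x) \<and> vim (trans_el x * a) t = vim a (t + x)"
  proof (induction a arbitrary: t rule: poly_mapping_add_induct)
    case (1 p c)
    then show ?case by (cases p) (simp add: trans_el_def mult_single vre_single vim_single add_ac)
  next
    case (2 a b)
    then show ?case by (simp add: distrib_left vre_add vim_add)
  qed
  then show "vre (trans_el x * a) t = vre a (t + x)" "vim (trans_el x * a) t = vim a (t + x)" by simp_all
qed

lemma Fn_star_nonneg: "0 \<le> Fn (a * star a)"
  unfolding Fn_star by (intro add_nonneg_nonneg ip_nonneg v_Cc)

lemma Fn_const: "Fn (const_el (of_real r) * a) = r * Fn a"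
proof (induction a rule: poly_mapping_add_induct)
  case (1 p c)
  then show ?case by (cases p) (simp add: const_el_def mult_single Fn_single)
qed (simp add: distrib_left Fn_add algebra_simps)

lemma Fn_minus: "Fn (- a) = - Fn a"
  using Fn_const[of "-1" a] by (simp add: const_el_minus const_el_1)

lemma Fn_diff: "Fn (a - b) = Fn a - Fn b"
  using Fn_add[of a "- b"] Fn_minus[of b] by simp

lemma v_minus: "vre (- a) t = - vre a t" "vim (- a) t = - vim a t"
proof -
  have "vre a t + vre (- a) t = vre 0 t" "vim a t + vim (- a) t = vim 0 t"
    by (simp_all add: vre_add[symmetric] vim_add[symmetric])
  moreover have "vre 0 t = 0" "vim 0 t = 0" by (simp_all add: vre_def vim_def lin_ext_def)
  ultimately show "vre (- a) t = - vre a t" "vim (- a) t = - vim a t" by simp_all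
qed

definition modulus :: "'g \<Rightarrow> real" where
  "modulus x = I (\<lambda>s. \<bar>k s - k (s - x)\<bar>)"

lemma Fn_smooth_le: "Fn ((smooth_el * smooth_el) * (b * star b)) \<le> (I (\<lambda>s. \<bar>k s\<bar>))\<^sup>2 * Fn (b * star b)"
proof -
  have "(smooth_el * smooth_el) * (b * star b) = (smooth_el * b) * star (smooth_el * b)"
    by (simp add: star_mult star_smooth mult_ac)
  then have "Fn ((smooth_el * smooth_el) * (b * star b))
      = ip (conv k (vre b)) (conv k (vre b)) + ip (conv k (vim b)) (conv k (vim b))"
    by (simp only: Fn_star v_smooth[abs_def])
  moreover have "ip (conv k u) (conv k u) \<le> (I (\<lambda>s. \<bar>k s\<bar>))\<^sup>2 * ip u u" if "u \<in> Cc" for u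
    using conv_norm_le[OF k_bcs CcD(1,2)[OF that]] by (simp add: ip_def power2_eq_square)
  ultimately show ?thesis using v_Cc[of b] by (simp add: Fn_star distrib_left add_mono)
qed

text \<open>Smoothing followed by 1 - T_x is convolution with the kernel k s - k (s - x), whose L^1
  norm is \<open>modulus x\<close>, so Young's inequality applies. By itself 1 - T_x need not have
  small norm for x near 0.\<close>

lemma Fn_modulus_le:
  "Fn ((smooth_el * smooth_el) * ((1 - trans_el x) * star (1 - trans_el x)) * (b * star b))
    \<le> (modulus x)\<^sup>2 * Fn (b * star b)"
proof -
  define a where "a = smooth_el * b - trans_el x * (smooth_el * b)"
  have "(smooth_el * smooth_el) * ((1 - trans_el x) * star (1 - trans_el x)) * (b * star b) = a * star a"
  proof -
    have "a = (smooth_el * (1 - trans_el x)) * b" by (simp add: a_def algebra_simps)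
    then show ?thesis by (simp only: star_mult star_smooth mult_ac)
  qed
  moreover have bk: "bcs (\<lambda>s. k s - k (s - x))"
    using bcs_diff[OF k_bcs bcs_translate[OF k_bcs, of "- x"]] by simp
  moreover have "vre a t = conv (\<lambda>s. k s - k (s - x)) (vre b) t" "vim a t = conv (\<lambda>s. k s - k (s - x)) (vim b) t" for t
  proof -
    have "vre a t = conv k (vre b) t - conv k (vre b) (t + x)" "vim a t = conv k (vim b) t - conv k (vim b) (t + x)"
      unfolding a_def diff_conv_add_uminus[of "smooth_el * b"] vre_add vim_add v_minus v_trans v_smooth by simp_all
    then show "vre a t = conv (\<lambda>s. k s - k (s - x)) (vre b) t" "vim a t = conv (\<lambda>s. k s - k (s - x)) (vim b) t"
      by (simp_all add: conv_diff_shift k_bcs CcD(3) v_Cc)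
  qed
  then have "vre a = conv (\<lambda>s. k s - k (s - x)) (vre b)" "vim a = conv (\<lambda>s. k s - k (s - x)) (vim b)"
    by (simp_all add: fun_eq_iff)
  moreover have "ip (conv (\<lambda>s. k s - k (s - x)) u) (conv (\<lambda>s. k s - k (s - x)) u) \<le> (modulus x)\<^sup>2 * ip u u"
    if "u \<in> Cc" for u
    using conv_norm_le[OF bk CcD(1,2)[OF that]] by (simp add: ip_def power2_eq_square modulus_def)
  ultimately show ?thesis using v_Cc[of b] by (simp add: Fn_star distrib_left add_mono)
qed

text \<open>In the square of a monomial the unitary translation cancels and a power of the smoothing
  operator remains, bounded by \<open>Fn_smooth_le\<close>. Sums are handled by the parallelogram
  identity, which costs a factor 2.\<close>

lemma Fn_bdd: "\<exists>M\<ge>0. \<forall>b. Fn ((a * star a) * (b * star b)) \<le> M * Fn (b * star b)"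
proof (induction a rule: poly_mapping_add_induct)
  case (1 p c)
  obtain x n where p: "p = (x, n)" by (cases p)
  define N where "N = (I (\<lambda>s. \<bar>k s\<bar>))\<^sup>2"
  have N: "0 \<le> N" by (simp add: N_def)
  have pw: "Fn ((smooth_el ^ n * smooth_el ^ n) * (b * star b)) \<le> N ^ n * Fn (b * star b)" for b n
  proof (induction n arbitrary: b)
    case (Suc n)
    have "(smooth_el ^ Suc n * smooth_el ^ Suc n) * (b * star b)
        = (smooth_el ^ n * smooth_el ^ n) * ((smooth_el * b) * star (smooth_el * b))"
      by (simp add: star_mult star_smooth mult_ac)
    also have "Fn \<dots> \<le> N ^ n * Fn ((smooth_el * b) * star (smooth_el * b))" by (rule Suc)
    also have "(smooth_el * b) * star (smooth_el * b) = (smooth_el * smooth_el) * (b * star b)"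
      by (simp add: star_mult star_smooth mult_ac)
    also have "N ^ n * Fn \<dots> \<le> N ^ n * (N * Fn (b * star b))"
      using Fn_smooth_le N unfolding N_def by (intro mult_left_mono) auto
    finally show ?case by (simp add: mult_ac)
  qed simp
  have sp: "smooth_el ^ n = (Poly_Mapping.single (0, n) 1 :: 'g opalg)" for n
    by (induction n) (auto simp: smooth_el_def mult_single zero_prod_def[symmetric])
  have "Poly_Mapping.single p c * star (Poly_Mapping.single p c)
      = const_el (of_real ((cmod c)\<^sup>2)) * (smooth_el ^ n * smooth_el ^ n)"
    by (simp add: p star_single mult_single sp const_el_def complex_norm_square[symmetric])
  then have "Fn ((Poly_Mapping.single p c * star (Poly_Mapping.single p c)) * (b * star b))
      \<le> ((cmod c)\<^sup>2 * N ^ n) * Fn (b * star b)" for b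
    using mult_left_mono[OF pw[of n b], of "(cmod c)\<^sup>2"] by (simp only: mult.assoc Fn_const) auto
  then show ?case using N by (intro exI[of _ "(cmod c)\<^sup>2 * N ^ n"]) auto
next
  case (2 a a')
  then obtain M M' where M: "M \<ge> 0" "M' \<ge> 0" "\<And>b. Fn ((a * star a) * (b * star b)) \<le> M * Fn (b * star b)"
    "\<And>b. Fn ((a' * star a') * (b * star b)) \<le> M' * Fn (b * star b)" by blast
  have "Fn (((a + a') * star (a + a')) * (b * star b)) \<le> (2 * M + 2 * M') * Fn (b * star b)" for b
  proof -
    have "((a + a') * star (a + a')) * (b * star b) + ((a - a') * b) * star ((a - a') * b)
        = ((a * star a) * (b * star b) + (a * star a) * (b * star b))
        + ((a' * star a') * (b * star b) + (a' * star a') * (b * star b))"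
      by (simp add: star_mult star_add star_diff algebra_simps)
    then have "Fn (((a + a') * star (a + a')) * (b * star b)) + Fn (((a - a') * b) * star ((a - a') * b))
        = 2 * Fn ((a * star a) * (b * star b)) + 2 * Fn ((a' * star a') * (b * star b))"
      by (simp only: Fn_add[symmetric]) (simp only: Fn_add mult_2)
    then show ?thesis
      using M(3)[of b] M(4)[of b] Fn_star_nonneg[of "(a - a') * b"] by (simp add: distrib_right)
  qed
  then show ?case using M by (intro exI[of _ "2 * M + 2 * M'"]) auto
qed

lemma positive_functional_Fn:
  "positive_functional {a :: 'g opalg. star a = a} (\<lambda>r. const_el (of_real r)) Fn"
proof
  fix a b :: "'g opalg" and r s :: real
  assume "a \<in> {a. star a = a}"
  then have a: "star a = a" by simp
  then obtain M where M: "\<And>b. Fn ((a * a) * (b * star b)) \<le> M * Fn (b * star b)"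
    using Fn_bdd[of a] by auto
  show "\<exists>M. \<forall>b\<in>{a. star a = a}. Fn (a * a * (b * b)) \<le> M * Fn (b * b)"
  proof (intro exI[of _ M] ballI)
    fix b :: "'g opalg" assume "b \<in> {a. star a = a}"
    then show "Fn (a * a * (b * b)) \<le> M * Fn (b * b)" using M[of b] by simp
  qed
  show "0 \<le> Fn (a * a)" using Fn_star_nonneg[of a] a by simp
  assume "b \<in> {a. star a = a}"
  then have b: "star b = b" by simp
  show "a + b \<in> {a. star a = a}" by (simp add: star_add a b)
  show "a * b \<in> {a. star a = a}" by (simp add: star_mult a b)
next
  fix a b :: "'g opalg" and r s :: real
  show "(const_el (complex_of_real r) :: 'g opalg) \<in> {a. star a = a}" by (simp add: star_const)
  show "(const_el (complex_of_real (r + s)) :: 'g opalg) = const_el (complex_of_real r) + const_el (complex_of_real s)"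
    by (simp add: const_el_add)
  show "(const_el (complex_of_real (r * s)) :: 'g opalg) = const_el (complex_of_real r) * const_el (complex_of_real s)"
    by (simp add: const_el_mult)
  show "(const_el (complex_of_real 1) :: 'g opalg) = 1" by (simp add: const_el_1)
  show "Fn (a + b) = Fn a + Fn b" by (rule Fn_add)
  show "Fn (const_el (complex_of_real r) * a) = r * Fn a" by (rule Fn_const)
qed

lemma modulus_small:
  assumes lc: "compact (K0 :: 'g set)" "0 \<in> interior K0" and d: "0 < d"
  shows "\<exists>O1. open O1 \<and> 0 \<in> O1 \<and> (\<forall>x\<in>O1. modulus x < d)"
proof -
  obtain K where K: "compact K" "\<And>x. x \<notin> K \<Longrightarrow> k x = 0" by (rule bcsE[OF k_bcs]) blast
  \<comment> \<open>For x in K0 both k and its translate k (s - x) vanish outside L, so one compact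
    set serves all small x.\<close>
  define L where "L = K \<union> (\<lambda>(u, v). u + v) ` (K \<times> K0)"
  have L: "compact L"
    unfolding L_def by (intro compact_Un K compact_continuous_image compact_Times lc)
      (auto simp: case_prod_beta intro!: continuous_intros)
  define g where "g t = (if t \<in> L then 1 else 0 :: real)" for t
  have g: "bcs g" by (rule bcsI[OF L, of _ 1]) (auto simp: g_def)
  have g0: "0 \<le> I g" by (intro nonneg g) (auto simp: g_def)
  define e where "e = d / (I g + 1)"
  have e: "0 < e" using d g0 by (simp add: e_def)
  obtain O1 where O1: "open O1" "0 \<in> O1" "\<And>s s'. s - s' \<in> O1 \<Longrightarrow> \<bar>k s - k s'\<bar> < e"
    using cpt_support_uniformly_continuous[OF k_cont k_supp e] by blast
  have "modulus x < d" if x: "x \<in> O1 \<inter> interior K0" for x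
  proof -
    have bk: "bcs (\<lambda>s. \<bar>k s - k (s - x)\<bar>)"
      using bcs_abs[OF bcs_diff[OF k_bcs bcs_translate[OF k_bcs, of "- x"]]] by simp
    have "\<bar>I (\<lambda>s. \<bar>k s - k (s - x)\<bar>)\<bar> \<le> e * I g"
    proof (intro abs_le bk g)
      fix s
      show "\<bar>\<bar>k s - k (s - x)\<bar>\<bar> \<le> e * g s"
      proof (cases "s \<in> L")
        case True
        then show ?thesis using O1(3)[of s "s - x"] x by (simp add: g_def)
      next
        case False
        have "s \<notin> K" using False by (simp add: L_def)
        moreover have "s - x \<notin> K"
        proof
          assume "s - x \<in> K"
          then have "(s - x, x) \<in> K \<times> K0" using x interior_subset by auto
          then have "(s - x) + x \<in> (\<lambda>(u, v). u + v) ` (K \<times> K0)" by (metis (no_types, lifting) case_prod_conv imageI)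
          then show False using False by (simp add: L_def)
        qed
        ultimately show ?thesis using K e by (simp add: g_def False)
      qed
    qed
    also have "e * I g < d" using d g0 by (simp add: e_def field_simps)
    finally show ?thesis by (simp add: modulus_def)
  qed
  then show ?thesis using O1 lc by (intro exI[of _ "O1 \<inter> interior K0"]) auto
qed

end

section \<open>Separation of points by characters\<close>

lemma LCA_bump:
  fixes W :: "'g::{topological_ab_group_add,t2_space} set"
  assumes lca: "LCA_group TYPE('g)" and W: "open W" "0 \<in> W"
  obtains f :: "'g \<Rightarrow> real" where "continuous_on UNIV f" "\<And>x. 0 \<le> f x" "\<And>x. x \<notin> W \<Longrightarrow> f x = 0" "0 < f 0"
proof -
  have "locally_compact_space (euclidean :: 'g topology)"
    unfolding locally_compact_space_def
  proof
    fix x :: 'g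
    obtain K where "compact K" "x \<in> interior K" using lca unfolding LCA_group_def by blast
    then show "\<exists>U K. openin euclidean U \<and> compactin euclidean K \<and> x \<in> U \<and> U \<subseteq> K"
      by (intro exI[of _ "interior K"] exI[of _ K]) (auto simp: interior_subset open_openin[symmetric])
  qed
  moreover have "Hausdorff_space (euclidean :: 'g topology)"
    unfolding Hausdorff_space_def disjnt_def open_openin[symmetric] using hausdorff by auto
  ultimately have "completely_regular_space (euclidean :: 'g topology)"
    by (intro locally_compact_regular_imp_completely_regular_space disjI1)
  moreover have "closedin (euclidean :: 'g topology) (- W)" using W by (simp add: closed_Compl)
  ultimately obtain f where f: "continuous_map euclidean (top_of_set {0..1::real}) f" "f 0 = 0" "f ` (- W) \<subseteq> {1}"
    unfolding completely_regular_space_def using W(2) by (metis ComplD Diff_iff UNIV_I topspace_euclidean)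
  have c: "continuous_on UNIV f" and r: "f x \<in> {0..1}" for x
    using f(1) by (auto simp: continuous_map_in_subtopology)
  show ?thesis
  proof (rule that[of "\<lambda>x. 1 - f x"])
    show "continuous_on UNIV (\<lambda>x. 1 - f x)" by (intro continuous_intros c)
    show "0 \<le> 1 - f x" for x using r[of x] by simp
    show "1 - f x = 0" if "x \<notin> W" for x using f(3) that by auto
  qed (simp add: f)
qed

text \<open>The element |1 - T_x|^2, written with \<open>cos_el\<close> so that a character of the
  self-adjoint part can be evaluated on it; the value is |\<theta> x - 1|^2.\<close>

definition dev_el :: "'g::ab_group_add \<Rightarrow> 'g opalg" where
  "dev_el x = const_el 2 - const_el 2 * cos_el x"

lemma star_dev: "star (dev_el x) = dev_el x"
  by (simp add: dev_el_def star_diff star_mult star_const star_cos)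

lemma dev_el_eq: "dev_el x = (1 + 1) - (trans_el x + trans_el (- x))"
proof -
  have "const_el 2 = (1 + 1 :: 'a opalg)" using const_el_add[of 1 1] by (simp add: const_el_1)
  moreover have "const_el 2 * cos_el x = trans_el x + trans_el (- x)"
    by (simp add: cos_el_def mult.assoc[symmetric] const_el_mult[symmetric] const_el_1)
  ultimately show ?thesis by (simp add: dev_el_def)
qed

lemma dev_el_square: "dev_el x = (1 - trans_el x) * star (1 - trans_el x)"
proof -
  have "trans_el x * trans_el (- x) = 1" by (simp add: trans_el_add[symmetric] trans_el_0)
  then show ?thesis
    by (simp add: dev_el_eq star_diff star_1 star_trans algebra_simps)
qed

text \<open>The character is chosen not to vanish on E, the product of \<open>dev_el y\<close> and
  the smoothing operator S. Nonvanishing on the first factor gives \<theta> y \<noteq> 1;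
  nonvanishing on S gives continuity, which a character of the abstract group could lack.\<close>

theorem characters_separate_points:
  fixes y :: "'g::{topological_ab_group_add,t2_space}"
  assumes lca: "LCA_group TYPE('g)" and y: "y \<noteq> 0"
  obtains \<theta> :: "'g \<Rightarrow> complex" where "continuous_on UNIV \<theta>" "\<And>x. cmod (\<theta> x) = 1"
    "\<And>x z. \<theta> (x + z) = \<theta> x * \<theta> z" "\<theta> y \<noteq> 1"
proof -
  obtain K0 :: "'g set" where K0: "compact K0" "0 \<in> interior K0"
    using lca unfolding LCA_group_def by blast
  define U where "U = interior K0 \<inter> - {y}"
  have U: "open U" "0 \<in> U" using K0 y by (auto simp: U_def)
  obtain W where W: "open W" "0 \<in> W" "\<And>a b. a \<in> W \<Longrightarrow> b \<in> W \<Longrightarrow> a + b \<in> U" "\<And>a. a \<in> W \<Longrightarrow> - a \<in> W"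
    by (rule zero_nhd_add[OF U]) blast
  obtain f :: "'g \<Rightarrow> real" where f: "continuous_on UNIV f" "\<And>x. 0 \<le> f x" "\<And>x. x \<notin> W \<Longrightarrow> f x = 0" "0 < f 0"
    by (rule LCA_bump[OF lca W(1,2)]) blast
  \<comment> \<open>Symmetrised to make convolution by h a self-adjoint operator; W = - W keeps the
    support inside W.\<close>
  define h where "h t = f t + f (- t)" for t
  have h: "continuous_on UNIV h"
    unfolding h_def by (intro continuous_intros f(1) continuous_on_compose2[OF f(1)]) auto
  have h0: "0 \<le> h t" for t using f by (simp add: h_def)
  have hW: "t \<in> W" if "h t \<noteq> 0" for t
  proof (rule ccontr)
    assume "t \<notin> W"
    moreover from this have "- t \<notin> W" using W(4)[of "- t"] by auto
    ultimately show False using that f(3) by (simp add: h_def)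
  qed
  have WK: "W \<subseteq> K0" using W(2,3) interior_subset by (force simp: U_def)
  have hsupp: "cpt_support h" unfolding cpt_support_def using K0 WK hW by blast
  obtain I :: "('g \<Rightarrow> real) \<Rightarrow> real" where I: "sym_haar_functional I"
    using sym_haar_functional_exists[OF lca] by blast
  interpret sym_haar_functional I by (rule I)
  interpret smoothing_operator I h
    by unfold_locales (simp_all add: h hsupp, simp add: h_def)
  interpret pf: positive_functional "{a :: 'g opalg. star a = a}" "\<lambda>r. const_el (of_real r)" Fn
    by (rule positive_functional_Fn)
  define S :: "'g opalg" where "S = smooth_el"
  define E where "E = dev_el y * S"
  have SH: "star S = S" by (simp add: S_def star_smooth)
  have EH: "star E = E" by (simp add: E_def star_mult star_dev SH)
  have F1: "0 < Fn 1"
  proof -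
    have "0 < ip (vre 1) (vre 1)"
    proof (rule ip_pos[OF v_Cc(1)])
      have "vre 1 0 = vre (Poly_Mapping.single (0, 0) 1) 0" by (simp add: zero_prod_def[symmetric])
      also have "\<dots> = h 0" by (simp add: vre_single kpow_def)
      finally show "vre 1 0 \<noteq> 0" using f(4) by (simp add: h_def)
    qed
    moreover have "Fn (1 * star 1) = ip (vre 1) (vre 1) + ip (vim 1) (vim 1)" by (rule Fn_star)
    ultimately show ?thesis using ip_nonneg[OF v_Cc(2), of 1] by (simp add: star_1)
  qed
  \<comment> \<open>At 0 the vector E h has the value 2 w 0 - w y - w (- y) with w = h * h the
    self-convolution. Differences of points of W lie in U, which omits y, so w vanishes at y and - y
    while w 0 > 0.\<close>
  have FE: "0 < Fn (E * E)"
  proof -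
    define w where "w = conv h h"
    have w: "vre S t = w t" for t
      by (simp add: S_def smooth_el_def vre_single kpow_def w_def)
    have "E = S + S + - (trans_el y * S) + - (trans_el (- y) * S)"
      by (simp add: E_def dev_el_eq algebra_simps)
    then have "vre E 0 = w 0 + w 0 - w y - w (- y)"
      by (simp only: vre_add v_minus v_trans w) simp
    moreover have z: "w x = 0" if x: "x = y \<or> x = - y" for x
    proof -
      have "h s * h (x + s) = 0" for s
      proof (rule ccontr)
        assume "\<not> ?thesis"
        then have "h s \<noteq> 0" "h (x + s) \<noteq> 0" by auto
        then have s: "s \<in> W" "x + s \<in> W" using hW by auto
        have "(x + s) + (- s) \<in> U" "s + - (x + s) \<in> U" by (intro W(3) s W(4))+
        then have "x \<in> U" "- x \<in> U" by simp_all
        then show False using x by (auto simp: U_def)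
      qed
      then have "w x = I (\<lambda>s. 0)" by (simp only: w_def conv_def)
      then show ?thesis by (simp add: zero)
    qed
    moreover have "0 < w 0"
    proof -
      have hC: "h \<in> Cc" by (simp add: Cc_def h hsupp)
      have "0 < ip h h" by (rule ip_pos[OF hC, of 0]) (use f(4) in \<open>simp add: h_def\<close>)
      then show ?thesis by (simp add: w_def conv_def ip_def)
    qed
    ultimately have "vre E 0 \<noteq> 0" using z[of y] z[of "- y"] by simp
    then have "0 < ip (vre E) (vre E)" by (rule ip_pos[OF v_Cc(1)])
    moreover have "Fn (E * star E) = ip (vre E) (vre E) + ip (vim E) (vim E)" by (rule Fn_star)
    ultimately show ?thesis using ip_nonneg[OF v_Cc(2), of E] by (simp add: EH)
  qed
  define e where "e = Fn (E * E) / (2 * Fn 1)"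
  have e: "0 < e" "e * Fn 1 < Fn (E * E)" using F1 FE by (simp_all add: e_def)
  have E': "E \<in> {a. star a = a}" using EH by simp
  obtain \<phi> :: "'g opalg \<Rightarrow> real" where \<phi>:
    "(\<forall>a\<in>{a. star a = a}. \<forall>b\<in>{a. star a = a}. \<phi> (a + b) = \<phi> a + \<phi> b)
    \<and> (\<forall>a\<in>{a. star a = a}. \<forall>b\<in>{a. star a = a}. \<phi> (a * b) = \<phi> a * \<phi> b)
    \<and> (\<forall>r. \<phi> (const_el (of_real r)) = r) \<and> (\<forall>a\<in>pf.Pos. 0 \<le> \<phi> a) \<and> e \<le> \<phi> (E * E)"
    using pf.character_exists[OF E' e(1) F1 e(2)] by blast
  have \<phi>add: "\<phi> (a + b) = \<phi> a + \<phi> b" if "star a = a" "star b = b" for a b using \<phi> that by blast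
  have \<phi>mult: "\<phi> (a * b) = \<phi> a * \<phi> b" if "star a = a" "star b = b" for a b using \<phi> that by blast
  have \<phi>c: "\<phi> (const_el (of_real r)) = r" for r using \<phi> by blast
  have \<phi>pos: "0 \<le> \<phi> a" if "a \<in> pf.Pos" for a using \<phi> that by blast
  have \<phi>E: "e \<le> \<phi> (E * E)" using \<phi> by blast
  have \<phi>1: "\<phi> 1 = 1" using \<phi>c[of 1] by (simp add: const_el_1)
  have \<phi>diff: "\<phi> (a - b) = \<phi> a - \<phi> b" if ab: "star a = a" "star b = b" for a b
  proof -
    have "\<phi> ((a - b) + b) = \<phi> (a - b) + \<phi> b" by (intro \<phi>add) (simp_all add: star_diff ab)
    then show ?thesis by simp
  qed
  have \<phi>dev: "\<phi> (dev_el x) = 2 - 2 * \<phi> (cos_el x)" for x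
    using \<phi>c[of 2] by (simp add: dev_el_def \<phi>diff \<phi>mult star_const star_mult star_cos)
  define \<theta> where "\<theta> x = Complex (\<phi> (cos_el x)) (\<phi> (sin_el x))" for x
  have \<theta>mult: "\<theta> (x + z) = \<theta> x * \<theta> z" for x z
    by (simp add: \<theta>_def complex_eq_iff cos_el_add sin_el_add \<phi>diff \<phi>add \<phi>mult star_mult star_cos star_sin)
  have sq1: "\<phi> (cos_el x) * \<phi> (cos_el x) + \<phi> (sin_el x) * \<phi> (sin_el x) = 1" for x
  proof -
    have "\<phi> (cos_el x * cos_el x + sin_el x * sin_el x) = 1" by (simp add: cos_sin_el \<phi>1)
    then show ?thesis by (simp add: \<phi>add \<phi>mult star_mult star_cos star_sin)
  qed
  have \<theta>norm: "cmod (\<theta> x) = 1" for x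
    using sq1[of x] by (simp add: \<theta>_def cmod_def power2_eq_square)
  have EE: "\<phi> (E * E) = (\<phi> (dev_el y) * \<phi> S) * (\<phi> (dev_el y) * \<phi> S)"
    unfolding E_def by (simp add: \<phi>mult star_mult star_dev SH)
  have nz: "\<phi> (dev_el y) \<noteq> 0" "\<phi> S \<noteq> 0" using EE \<phi>E e by auto
  have \<theta>y: "\<theta> y \<noteq> 1"
    using nz(1) by (auto simp: \<theta>_def complex_eq_iff \<phi>dev)
  have dist1: "(cmod (\<theta> x - 1))\<^sup>2 = \<phi> (dev_el x)" for x
    using sq1[of x] by (simp add: \<theta>_def cmod_power2 \<phi>dev) (simp add: power2_eq_square algebra_simps)
  \<comment> \<open>The estimate \<open>Fn_modulus_le\<close> places the scalar modulus squared
    minus S * S * \<open>dev_el x\<close> in \<open>pf.Pos\<close>, where \<phi> is nonnegative.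
    Dividing by the nonzero number \<phi> S turns this into continuity of \<theta> at 0.\<close>
  have small: "\<phi> S * \<phi> S * \<phi> (dev_el x) \<le> (modulus x)\<^sup>2" for x
  proof -
    have st: "star ((S * S) * dev_el x) = (S * S) * dev_el x" by (simp add: star_mult SH star_dev)
    have "const_el (of_real ((modulus x)\<^sup>2)) - (S * S) * dev_el x \<in> pf.Pos"
      unfolding pf.Pos_def
    proof (intro CollectI conjI ballI)
      show "star (const_el (of_real ((modulus x)\<^sup>2)) - (S * S) * dev_el x) = const_el (of_real ((modulus x)\<^sup>2)) - (S * S) * dev_el x"
        by (simp only: star_diff st star_const complex_cnj_complex_of_real)
      fix b :: "'g opalg" assume "b \<in> {a. star a = a}"
      then have b: "star b = b" by simp
      have "Fn ((S * S) * dev_el x * (b * b)) \<le> (modulus x)\<^sup>2 * Fn (b * b)"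
        using Fn_modulus_le[of x b] unfolding b S_def dev_el_square[symmetric] .
      then show "0 \<le> Fn ((const_el (of_real ((modulus x)\<^sup>2)) - (S * S) * dev_el x) * (b * b))"
        by (simp only: left_diff_distrib Fn_diff Fn_const diff_ge_0_iff_ge)
    qed
    then have "0 \<le> \<phi> (const_el (of_real ((modulus x)\<^sup>2)) - (S * S) * dev_el x)" by (rule \<phi>pos)
    also have "\<dots> = (modulus x)\<^sup>2 - \<phi> ((S * S) * dev_el x)"
      by (subst \<phi>diff) (simp_all only: st \<phi>c star_const complex_cnj_complex_of_real)
    also have "\<phi> ((S * S) * dev_el x) = \<phi> S * \<phi> S * \<phi> (dev_el x)"
      by (simp add: \<phi>mult star_mult SH star_dev)
    finally show ?thesis by simp
  qed
  have \<theta>cont: "continuous_on UNIV \<theta>"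
  proof (rule continuous_on_UNIV_nhdI)
    fix x and d :: real assume d: "0 < d"
    then have d': "0 < d * \<bar>\<phi> S\<bar>" using nz by simp
    obtain V where V: "open V" "0 \<in> V" "\<And>x. x \<in> V \<Longrightarrow> modulus x < d * \<bar>\<phi> S\<bar>"
      using modulus_small[OF K0 d'] by blast
    have "dist (\<theta> z) (\<theta> x) < d" if z: "z - x \<in> V" for z
    proof -
      have m0: "0 \<le> modulus (z - x)"
        unfolding modulus_def by (intro nonneg bcs_abs bcs_diff k_bcs)
          (use bcs_translate[OF k_bcs, of "- (z - x)"] in \<open>simp_all add: algebra_simps\<close>)
      have "(\<bar>\<phi> S\<bar> * cmod (\<theta> (z - x) - 1))\<^sup>2 \<le> (modulus (z - x))\<^sup>2"
        using small[of "z - x"] by (simp add: power_mult_distrib dist1 power2_eq_square[of "\<phi> S"])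
      then have "\<bar>\<phi> S\<bar> * cmod (\<theta> (z - x) - 1) \<le> modulus (z - x)" using m0 by (rule power2_le_imp_le)
      also have "\<dots> < d * \<bar>\<phi> S\<bar>" using V(3) z by blast
      finally have 1: "cmod (\<theta> (z - x) - 1) < d" using nz by (simp add: mult.commute[of d])
      have "\<theta> z = \<theta> (z - x) * \<theta> x" by (simp add: \<theta>mult[symmetric])
      then have "\<theta> z - \<theta> x = (\<theta> (z - x) - 1) * \<theta> x" by (simp add: algebra_simps)
      then have "cmod (\<theta> z - \<theta> x) = cmod (\<theta> (z - x) - 1)" by (simp add: norm_mult \<theta>norm)
      then show ?thesis using 1 by (simp add: dist_norm)
    qed
    then show "\<exists>U. open U \<and> x \<in> U \<and> (\<forall>y\<in>U. dist (\<theta> y) (\<theta> x) < d)"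
      using V open_translate_nhd(1)[OF V(1), of x] by (intro exI[of _ "{z. z - x \<in> V}"]) auto
  qed
  show ?thesis by (rule that[OF \<theta>cont \<theta>norm \<theta>mult \<theta>y])
qed

text \<open>The circle has no small subgroups: squaring w multiplies |w - 1|^2 by |w + 1|^2 = 4 - |w
  - 1|^2, which is at least 3 while |w - 1| < 1, so repeated squaring leaves the unit disc around 1
  unless z = 1.\<close>

lemma unit_complex_powers:
  fixes z :: complex
  assumes z: "cmod z = 1" and n: "\<And>n. cmod (z ^ (2 ^ n) - 1) < 1"
  shows "z = 1"
proof (rule ccontr)
  assume z1: "z \<noteq> 1"
  define a where "a n = (cmod (z ^ (2 ^ n) - 1))\<^sup>2" for n
  have par: "(cmod (w + 1))\<^sup>2 + (cmod (w - 1))\<^sup>2 = 4" if "cmod w = 1" for w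
    using that by (simp add: cmod_def power2_eq_square) (simp add: algebra_simps)
  have step: "3 * a n \<le> a (Suc n)" for n
  proof -
    define w where "w = z ^ (2 ^ n)"
    have w: "cmod w = 1" by (simp add: w_def norm_power z)
    have "z ^ (2 ^ Suc n) - 1 = (w - 1) * (w + 1)"
      by (simp add: w_def power_mult power2_eq_square algebra_simps)
    then have "a (Suc n) = (cmod (w - 1))\<^sup>2 * (cmod (w + 1))\<^sup>2"
      by (simp add: a_def norm_mult power_mult_distrib)
    moreover have "3 \<le> (cmod (w + 1))\<^sup>2"
    proof -
      have "(cmod (w - 1))\<^sup>2 \<le> 1" using n[of n] by (simp add: w_def power_le_one)
      then show ?thesis using par[OF w] by linarith
    qed
    ultimately show ?thesis
      using mult_left_mono[of 3 "(cmod (w + 1))\<^sup>2" "(cmod (w - 1))\<^sup>2"] by (simp add: a_def w_def mult.commute)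
  qed
  have "3 ^ n * a 0 \<le> a n" for n
  proof (induction n)
    case (Suc n)
    then show ?case using step[of n] by simp
  qed simp
  moreover have "a n \<le> 1" for n using n[of n] by (simp add: a_def power_le_one)
  ultimately have "3 ^ n * a 0 \<le> 1" for n by (meson order_trans)
  moreover have "0 < a 0" using z1 by (simp add: a_def)
  ultimately have "3 ^ n \<le> 1 / a 0" for n by (simp add: field_simps)
  then show False using real_arch_pow[of 3 "1 / a 0"] by (meson linorder_not_less numeral_less_iff one_less_numeral_iff semiring_norm(77))
qed

section \<open>The dual group\<close>

locale dual_group =
  fixes chi :: "'g::{topological_ab_group_add,t2_space} \<Rightarrow> 'c::{topological_space,ab_group_add} \<Rightarrow> complex"
  assumes dual: "dual_pairing chi"
begin

lemma chi_cont: "continuous_on UNIV (\<lambda>x. chi x \<gamma>)"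
  and chi_norm [simp]: "cmod (chi x \<gamma>) = 1"
  and chi_add_left: "chi (x + y) \<gamma> = chi x \<gamma> * chi y \<gamma>"
  and chi_add: "chi x (\<gamma> + \<gamma>') = chi x \<gamma> * chi x \<gamma>'"
  and chi_sep: "(\<And>x. chi x \<gamma> = chi x \<gamma>') \<Longrightarrow> \<gamma> = \<gamma>'"
  and chi_surj: "continuous_on UNIV f \<Longrightarrow> (\<And>x. cmod (f x) = 1) \<Longrightarrow> (\<And>x y. f (x + y) = f x * f y)
      \<Longrightarrow> \<exists>\<gamma>. \<forall>x. f x = chi x \<gamma>"
  and open_dual_iff: "open S \<longleftrightarrow> (\<forall>\<gamma>\<in>S. \<exists>K e. compact K \<and> e > 0 \<and>
            {\<gamma>'. \<forall>x\<in>K. cmod (chi x \<gamma>' - chi x \<gamma>) < e} \<subseteq> S)"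
proof -
  note d = dual[unfolded dual_pairing_def]
  show "continuous_on UNIV (\<lambda>x. chi x \<gamma>)" using d by (elim conjE) simp
  show "cmod (chi x \<gamma>) = 1" using d by (elim conjE) simp
  show "chi (x + y) \<gamma> = chi x \<gamma> * chi y \<gamma>" using d by (elim conjE) simp
  show "chi x (\<gamma> + \<gamma>') = chi x \<gamma> * chi x \<gamma>'" using d by (elim conjE) simp
  show "\<gamma> = \<gamma>'" if "\<And>x. chi x \<gamma> = chi x \<gamma>'"
    using d[THEN conjunct2, THEN conjunct2, THEN conjunct2, THEN conjunct2, THEN conjunct1] that by blast
  show "\<exists>\<gamma>. \<forall>x. f x = chi x \<gamma>"
    if "continuous_on UNIV f" "\<And>x. cmod (f x) = 1" "\<And>x y. f (x + y) = f x * f y"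
    using d[THEN conjunct2, THEN conjunct2, THEN conjunct2, THEN conjunct2, THEN conjunct2, THEN conjunct1] that
    by blast
  show "open S \<longleftrightarrow> (\<forall>\<gamma>\<in>S. \<exists>K e. compact K \<and> e > 0 \<and>
            {\<gamma>'. \<forall>x\<in>K. cmod (chi x \<gamma>' - chi x \<gamma>) < e} \<subseteq> S)"
    by (rule d[THEN conjunct2, THEN conjunct2, THEN conjunct2, THEN conjunct2, THEN conjunct2, THEN conjunct2, THEN spec])
qed

lemma chi_nonzero [simp]: "chi x \<gamma> \<noteq> 0"
  using chi_norm[of x \<gamma>] by (metis norm_zero zero_neq_one)

lemma chi_zero [simp]: "chi x 0 = 1" "chi 0 \<gamma> = 1"
  using chi_add[of x 0 0] chi_add_left[of 0 0 \<gamma>] by simp_all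

lemma chi_minus: "chi x (- \<gamma>) = cnj (chi x \<gamma>)"
proof -
  have "chi x \<gamma> * chi x (- \<gamma>) = 1" using chi_add[of x \<gamma> "- \<gamma>"] by simp
  moreover have "chi x \<gamma> * cnj (chi x \<gamma>) = 1" by (simp add: complex_norm_square[symmetric])
  ultimately show ?thesis by (metis chi_nonzero mult_cancel_left)
qed

lemma chi_diff: "chi x (\<gamma> - \<gamma>') = chi x \<gamma> * cnj (chi x \<gamma>')"
  using chi_add[of x \<gamma> "- \<gamma>'"] by (simp add: chi_minus)

lemma chi_diff_dist:
  "cmod (chi x (\<gamma> - \<delta>) - chi x (\<gamma>' - \<delta>')) \<le> cmod (chi x \<gamma> - chi x \<gamma>') + cmod (chi x \<delta> - chi x \<delta>')"
proof -
  have "chi x (\<gamma> - \<delta>) - chi x (\<gamma>' - \<delta>')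
      = (chi x \<gamma> - chi x \<gamma>') * cnj (chi x \<delta>) + chi x \<gamma>' * cnj (chi x \<delta> - chi x \<delta>')"
    by (simp add: chi_diff algebra_simps)
  also have "cmod \<dots> \<le> cmod ((chi x \<gamma> - chi x \<gamma>') * cnj (chi x \<delta>)) + cmod (chi x \<gamma>' * cnj (chi x \<delta> - chi x \<delta>'))"
    by (rule norm_triangle_ineq)
  finally show ?thesis by (simp only: norm_mult complex_mod_cnj chi_norm mult_1 mult_1_right)
qed

section \<open>The dual as a topological group\<close>

definition char_nhd :: "'g set \<Rightarrow> real \<Rightarrow> 'c \<Rightarrow> 'c set" where
  "char_nhd K e \<gamma> = {\<gamma>'. \<forall>x\<in>K. cmod (chi x \<gamma>' - chi x \<gamma>) < e}"

lemma char_nhd_self: "0 < e \<Longrightarrow> \<gamma> \<in> char_nhd K e \<gamma>"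
  by (simp add: char_nhd_def)

text \<open>On the compact set K the distance between the two characters attains its maximum, which
  leaves a uniform margin d below e.\<close>

lemma open_char_nhd:
  assumes K: "compact K" and e: "0 < e" shows "open (char_nhd K e \<gamma>)"
  unfolding open_dual_iff
proof
  fix \<delta> assume \<delta>: "\<delta> \<in> char_nhd K e \<gamma>"
  have "\<exists>d>0. \<forall>x\<in>K. cmod (chi x \<delta> - chi x \<gamma>) \<le> e - d"
  proof (cases "K = {}")
    case False
    have "continuous_on K (\<lambda>x. cmod (chi x \<delta> - chi x \<gamma>))"
      by (intro continuous_intros continuous_on_subset[OF chi_cont]) auto
    then obtain x0 where x0: "x0 \<in> K" "\<And>x. x \<in> K \<Longrightarrow> cmod (chi x \<delta> - chi x \<gamma>) \<le> cmod (chi x0 \<delta> - chi x0 \<gamma>)"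
      using continuous_attains_sup[OF K False] by blast
    then show ?thesis using \<delta> by (intro exI[of _ "e - cmod (chi x0 \<delta> - chi x0 \<gamma>)"]) (auto simp: char_nhd_def)
  qed (auto intro: zero_less_one)
  then obtain d where d: "d > 0" "\<And>x. x \<in> K \<Longrightarrow> cmod (chi x \<delta> - chi x \<gamma>) \<le> e - d" by blast
  have "{\<gamma>'. \<forall>x\<in>K. cmod (chi x \<gamma>' - chi x \<delta>) < d} \<subseteq> char_nhd K e \<gamma>"
  proof
    fix \<gamma>' assume g: "\<gamma>' \<in> {\<gamma>'. \<forall>x\<in>K. cmod (chi x \<gamma>' - chi x \<delta>) < d}"
    have "cmod (chi x \<gamma>' - chi x \<gamma>) < e" if "x \<in> K" for x
    proof -
      have "cmod (chi x \<gamma>' - chi x \<gamma>) \<le> cmod (chi x \<gamma>' - chi x \<delta>) + cmod (chi x \<delta> - chi x \<gamma>)"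
        by (metis add_diff_eq diff_add_cancel norm_triangle_ineq)
      then show ?thesis using d(2)[OF that] g that by force
    qed
    then show "\<gamma>' \<in> char_nhd K e \<gamma>" by (simp add: char_nhd_def)
  qed
  then show "\<exists>K' e'. compact K' \<and> e' > 0 \<and> {\<gamma>'. \<forall>x\<in>K'. cmod (chi x \<gamma>' - chi x \<delta>) < e'} \<subseteq> char_nhd K e \<gamma>"
    using K d(1) by blast
qed

lemma open_dualE:
  assumes "open S" "\<gamma> \<in> S"
  obtains K e where "compact K" "K \<noteq> {}" "0 < e" "char_nhd K e \<gamma> \<subseteq> S"
proof -
  obtain K e where K: "compact K" "e > 0" "{\<gamma>'. \<forall>x\<in>K. cmod (chi x \<gamma>' - chi x \<gamma>) < e} \<subseteq> S"
    using open_dual_iff[THEN iffD1, OF assms(1), THEN bspec, OF assms(2)] by blast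
  have "char_nhd (insert 0 K) e \<gamma> \<subseteq> S" using K(3) by (auto simp: char_nhd_def)
  then show ?thesis using K(1,2) by (intro that[of "insert 0 K" e]) auto
qed

text \<open>The type of the dual is merely a topological space and an abelian group; compatibility
  of the two structures has to be extracted from the compact-open description of its open
  sets.\<close>

lemma dual_diff_continuous: "continuous_on UNIV (\<lambda>p::'c \<times> 'c. fst p - snd p)"
  unfolding continuous_on_open_vimage[OF open_UNIV]
proof (intro allI impI)
  fix B :: "'c set" assume B: "open B"
  show "open ((\<lambda>p. fst p - snd p) -` B \<inter> UNIV)"
    unfolding open_prod_def
  proof
    fix p assume "p \<in> (\<lambda>p. fst p - snd p) -` B \<inter> UNIV"
    then have pB: "fst p - snd p \<in> B" by simp
    obtain K e where K: "compact K" "0 < e" "char_nhd K e (fst p - snd p) \<subseteq> B"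
      by (rule open_dualE[OF B pB]) blast
    have e2: "0 < e / 2" using K by simp
    have "char_nhd K (e / 2) (fst p) \<times> char_nhd K (e / 2) (snd p) \<subseteq> (\<lambda>p. fst p - snd p) -` B \<inter> UNIV"
    proof clarsimp
      fix a b assume ab: "a \<in> char_nhd K (e / 2) (fst p)" "b \<in> char_nhd K (e / 2) (snd p)"
      have "cmod (chi x (a - b) - chi x (fst p - snd p)) < e" if "x \<in> K" for x
      proof -
        have "cmod (chi x a - chi x (fst p)) < e / 2" "cmod (chi x b - chi x (snd p)) < e / 2"
          using ab that by (simp_all add: char_nhd_def)
        then show ?thesis using chi_diff_dist[of x a b "fst p" "snd p"] by linarith
      qed
      then show "a - b \<in> B" using K(3) by (auto simp: char_nhd_def)
    qed
    then show "\<exists>A B'. open A \<and> open B' \<and> p \<in> A \<times> B' \<and> A \<times> B' \<subseteq> (\<lambda>p. fst p - snd p) -` B \<inter> UNIV"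
      using open_char_nhd[OF K(1) e2] char_nhd_self[OF e2]
      by (intro exI[of _ "char_nhd K (e / 2) (fst p)"] exI[of _ "char_nhd K (e / 2) (snd p)"]) (auto simp: mem_Times_iff)
  qed
qed

lemma dual_continuous_diff:
  assumes "continuous_on S f" "continuous_on S (g :: _ \<Rightarrow> 'c)" shows "continuous_on S (\<lambda>x. f x - g x)"
  using continuous_on_compose2[OF dual_diff_continuous continuous_on_Pair[OF assms]] by simp

lemma dual_continuous_add:
  assumes "continuous_on S f" "continuous_on S (g :: _ \<Rightarrow> 'c)" shows "continuous_on S (\<lambda>x. f x + g x)"
  using dual_continuous_diff[OF assms(1) dual_continuous_diff[OF continuous_on_const[of S 0] assms(2)]] by simp

lemma dual_compact_diff:
  assumes "compact A" "compact (B :: 'c set)" shows "compact {a - b |a b. a \<in> A \<and> b \<in> B}"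
proof -
  have "compact ((\<lambda>p. fst p - snd p) ` (A \<times> B))"
    by (intro compact_continuous_image compact_Times assms continuous_on_subset[OF dual_diff_continuous]) auto
  moreover have "(\<lambda>p. fst p - snd p) ` (A \<times> B) = {a - b |a b. a \<in> A \<and> b \<in> B}" by force
  ultimately show ?thesis by simp
qed

lemma dual_compact_add:
  assumes "compact A" "compact (B :: 'c set)" shows "compact {a + b |a b. a \<in> A \<and> b \<in> B}"
proof -
  have "compact ((\<lambda>p. fst p + snd p) ` (A \<times> B))"
    by (intro compact_continuous_image compact_Times assms dual_continuous_add continuous_intros)
  moreover have "(\<lambda>p. fst p + snd p) ` (A \<times> B) = {a + b |a b. a \<in> A \<and> b \<in> B}" by force
  ultimately show ?thesis by simp
qed

lemma dual_open_translate: "open (U :: 'c set) \<Longrightarrow> open {x. x - a \<in> U}"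
proof -
  assume U: "open U"
  have "open ((\<lambda>x. x - a) -` U)"
    by (intro open_vimage U dual_continuous_diff continuous_intros)
  then show ?thesis by (simp add: vimage_def)
qed

lemma dual_Hausdorff: "Hausdorff_space (euclidean :: 'c topology)"
  unfolding Hausdorff_space_def disjnt_def open_openin[symmetric]
proof (intro allI impI, elim conjE)
  fix \<gamma> \<gamma>' :: 'c assume "\<gamma> \<noteq> \<gamma>'"
  then obtain x where "chi x \<gamma> \<noteq> chi x \<gamma>'" using chi_sep by blast
  define e where "e = cmod (chi x \<gamma> - chi x \<gamma>') / 2"
  have e: "0 < e" using \<open>chi x \<gamma> \<noteq> chi x \<gamma>'\<close> by (simp add: e_def)
  have "char_nhd {x} e \<gamma> \<inter> char_nhd {x} e \<gamma>' = {}"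
  proof (rule ccontr)
    assume "\<not> ?thesis"
    then obtain \<delta> where d: "cmod (chi x \<delta> - chi x \<gamma>) < e" "cmod (chi x \<delta> - chi x \<gamma>') < e"
      by (auto simp: char_nhd_def)
    have "cmod (chi x \<gamma> - chi x \<gamma>') \<le> cmod (chi x \<gamma> - chi x \<delta>) + cmod (chi x \<delta> - chi x \<gamma>')"
      by (metis add_diff_eq diff_add_cancel norm_triangle_ineq)
    then show False using d by (simp add: e_def norm_minus_commute)
  qed
  then show "\<exists>U V. open U \<and> open V \<and> \<gamma> \<in> U \<and> \<gamma>' \<in> V \<and> U \<inter> V = {}"
    using open_char_nhd[OF _ e, of "{x}"] char_nhd_self[OF e] by (metis compact_insert compact_empty)
qed

lemma dual_compact_closed: "compact (K :: 'c set) \<Longrightarrow> closed K"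
  using compactin_imp_closedin[OF dual_Hausdorff, of K] by simp

lemma dual_compact_Int_closed: "compact (K :: 'c set) \<Longrightarrow> closed F \<Longrightarrow> F \<subseteq> K \<Longrightarrow> compact F"
  by (metis compact_Int_closed inf.absorb_iff2)

text \<open>Kfam is cofinal among the compact sets: thicken by V and take the closure, since an open
  set lies in the interior of its closure. The limit along Kfam can thus be tested on arbitrary
  compact sets. Adding 0 keeps the thickening nonempty.\<close>

lemma Kfam_superset:
  assumes V: "open (V :: 'c set)" "0 \<in> V" "compact (closure V)" and K: "compact K"
  shows "\<exists>\<Omega>\<in>(Kfam :: 'c set set). K \<subseteq> \<Omega>"
proof -
  define L where "L = insert 0 K"
  have L: "compact L" using K by (simp add: L_def)
  define U where "U = (\<Union>a\<in>L. {x. x - a \<in> V})"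
  have U: "open U" unfolding U_def by (intro open_UN ballI dual_open_translate V)
  have LU: "L \<subseteq> U" using V by (auto simp: U_def)
  define M where "M = {a + b |a b. a \<in> L \<and> b \<in> closure V}"
  have M: "compact M" unfolding M_def by (intro dual_compact_add L V)
  have "U \<subseteq> M"
  proof
    fix x assume "x \<in> U"
    then obtain a where "a \<in> L" "x - a \<in> V" by (auto simp: U_def)
    moreover from this have "x = a + (x - a)" "x - a \<in> closure V" using closure_subset by auto
    ultimately show "x \<in> M" unfolding M_def by blast
  qed
  then have "closure U \<subseteq> M" using dual_compact_closed[OF M] by (rule closure_minimal)
  then have "compact (closure U)" by (rule dual_compact_Int_closed[OF M closed_closure])
  moreover have "U \<subseteq> interior (closure U)" using U closure_subset by (intro interior_maximal)
  moreover from this have "closure U \<subseteq> closure (interior (closure U))" by (rule closure_mono)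
  ultimately have "closure U \<in> Kfam" using LU by (auto simp: Kfam_def L_def)
  then show ?thesis using LU closure_subset by (auto simp: L_def)
qed

text \<open>Compactness would put every character within 1/2, uniformly on K0, of one of finitely
  many, hence within 1 of the constant 1 on a common neighbourhood U of 0. Powers of characters are
  characters, so all of them equal 1 on U, and separation of points leaves U = {0}, an open
  set.\<close>

theorem dual_not_compact:
  assumes lca: "LCA_group TYPE('g)" and nd: "\<not> open {0::'g}"
  shows "\<not> compact (UNIV :: 'c set)"
proof
  assume c: "compact (UNIV :: 'c set)"
  obtain K0 :: "'g set" where K0: "compact K0" "0 \<in> interior K0"
    using lca unfolding LCA_group_def by blast
  have op: "open (char_nhd K0 (1 / 2) \<gamma>)" for \<gamma> by (intro open_char_nhd K0) simp
  have cov: "UNIV \<subseteq> (\<Union>\<gamma>\<in>UNIV. char_nhd K0 (1 / 2) \<gamma>)" using char_nhd_self[of "1 / 2"] by auto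
  obtain F where F: "finite F" "UNIV \<subseteq> (\<Union>\<gamma>\<in>F. char_nhd K0 (1 / 2) \<gamma>)"
    by (rule compactE_image[OF c op cov])
  define U where "U = interior K0 \<inter> (\<Inter>\<gamma>\<in>F. {x. cmod (chi x \<gamma> - 1) < 1 / 2})"
  have "open {x. cmod (chi x \<gamma> - 1) < 1 / 2}" for \<gamma>
    by (intro open_Collect_less continuous_intros chi_cont)
  then have U: "open U" "0 \<in> U" using F K0 by (auto simp: U_def intro!: open_Int open_INT)
  have lt: "cmod (chi x \<gamma> - 1) < 1" if x: "x \<in> U" for x \<gamma>
  proof -
    obtain \<delta> where d: "\<delta> \<in> F" "\<gamma> \<in> char_nhd K0 (1 / 2) \<delta>" using F(2) by blast
    have "cmod (chi x \<gamma> - chi x \<delta>) < 1 / 2"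
      using d(2) x interior_subset by (auto simp: char_nhd_def U_def)
    moreover have "cmod (chi x \<delta> - 1) < 1 / 2" using d(1) x by (auto simp: U_def)
    moreover have "cmod (chi x \<gamma> - 1) \<le> cmod (chi x \<gamma> - chi x \<delta>) + cmod (chi x \<delta> - 1)"
      by (metis add_diff_eq diff_add_cancel norm_triangle_ineq)
    ultimately show ?thesis by linarith
  qed
  have one: "chi x \<gamma> = 1" if x: "x \<in> U" for x \<gamma>
  proof (rule unit_complex_powers)
    fix n
    have "\<exists>\<delta>. chi x \<gamma> ^ m = chi x \<delta>" for m
    proof (induction m)
      case 0 show ?case by (intro exI[of _ 0]) simp
    next
      case (Suc m)
      then obtain \<delta> where "chi x \<gamma> ^ m = chi x \<delta>" by blast
      then show ?case by (intro exI[of _ "\<gamma> + \<delta>"]) (simp add: chi_add)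
    qed
    then show "cmod (chi x \<gamma> ^ (2 ^ n) - 1) < 1" using lt[OF x] by metis
  qed simp
  have "U \<subseteq> {0}"
  proof
    fix x assume x: "x \<in> U"
    show "x \<in> {0}"
    proof (rule ccontr)
      assume "x \<notin> {0}"
      then have "x \<noteq> 0" by simp
      then obtain \<theta> :: "'g \<Rightarrow> complex" where "continuous_on UNIV \<theta>" "\<And>x. cmod (\<theta> x) = 1"
          "\<And>x z. \<theta> (x + z) = \<theta> x * \<theta> z" and n: "\<theta> x \<noteq> 1"
        by (rule characters_separate_points[OF lca]) blast
      then obtain \<gamma> where "\<forall>x. \<theta> x = chi x \<gamma>" using chi_surj[of \<theta>] by blast
      then show False using n one[OF x] by simp
    qed
  qed
  then have "U = {0}" using U by blast
  then show False using U nd by simp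
qed

end

section \<open>Positive definite functions on the dual group\<close>

lemma exponential_beats_power:
  fixes c :: real and k :: nat
  assumes c: "1 < c" and le: "\<And>n. c ^ n \<le> real (Suc n) ^ k"
  shows False
proof -
  have lc: "0 < ln c" using c by simp
  have ineq: "real n * ln c \<le> 2 * real k * sqrt (real (Suc n))" for n
  proof -
    have "ln (c ^ n) \<le> ln (real (Suc n) ^ k)" using le[of n] c by (subst ln_le_cancel_iff) auto
    then have "real n * ln c \<le> real k * ln (real (Suc n))" using c by (simp add: ln_realpow)
    also have "ln (real (Suc n)) = 2 * ln (sqrt (real (Suc n)))" by (simp add: ln_sqrt)
    also have "real k * (2 * ln (sqrt (real (Suc n)))) \<le> real k * (2 * sqrt (real (Suc n)))"
      by (intro mult_left_mono) (auto intro: ln_le_minus_one[THEN order_trans])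
    finally show ?thesis by simp
  qed
  \<comment> \<open>The inequality will be used at n = m * m - 1, where its square root is
    m.\<close>
  obtain m :: nat where m: "2 * real k / ln c + 1 < real m" using reals_Archimedean2 by blast
  have "0 \<le> 2 * real k / ln c" using lc by simp
  then have m1: "1 < real m" using m by linarith
  then have "1 \<le> m * m" by (cases m) auto
  then have s: "real (Suc (m * m - 1)) = real m * real m" by simp
  have "(real m * real m - 1) * ln c \<le> 2 * real k * real m"
    using ineq[of "m * m - 1"] \<open>1 \<le> m * m\<close> by (simp add: s of_nat_diff)
  also have "\<dots> \<le> 2 * real k * (real m + 1)" by (intro mult_left_mono) auto
  finally have "(real m + 1) * ((real m - 1) * ln c) \<le> (real m + 1) * (2 * real k)" by (simp add: algebra_simps)
  then have "(real m - 1) * ln c \<le> 2 * real k" using m1 by (subst (asm) mult_le_cancel_left_pos) auto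
  then show False using m lc by (simp add: field_simps)
qed

text \<open>S n collects the combinations of elements of F with multiplicities at most n, so its
  size is at most (n + 1) ^ card F and some ratio of consecutive sizes is at most 1 + e. Since
  \<gamma> + S n lies in S (n + 1), the t that leave S n inject into the small difference.\<close>

lemma Folner_set:
  fixes F :: "'a::ab_group_add set"
  assumes F: "finite F" and e: "0 < e"
  obtains S where "finite S" "S \<noteq> {}" "\<And>\<gamma>. \<gamma> \<in> F \<Longrightarrow> (1 - e) * real (card S) \<le> real (card {t \<in> S. \<gamma> + t \<in> S})"
proof -
  define mul where "mul n \<gamma> = (\<Sum>j<n. \<gamma>)" for n :: nat and \<gamma> :: 'a
  define S where "S n = (\<lambda>k. \<Sum>\<gamma>\<in>F. mul (k \<gamma>) \<gamma>) ` (F \<rightarrow>\<^sub>E {..n})" for n :: nat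
  have fin: "finite (S n)" for n unfolding S_def using F by (intro finite_imageI finite_PiE) auto
  have ne: "S n \<noteq> {}" for n by (auto simp: S_def PiE_eq_empty_iff)
  have c0: "0 < card (S n)" for n using fin ne by (simp add: card_gt_0_iff)
  have crd: "card (S n) \<le> Suc n ^ card F" for n
  proof -
    have "card (S n) \<le> card (F \<rightarrow>\<^sub>E {..n})" unfolding S_def using F by (intro card_image_le finite_PiE) auto
    also have "\<dots> = Suc n ^ card F" using F by (subst card_PiE) auto
    finally show ?thesis .
  qed
  have sub: "S n \<subseteq> S (Suc n)" for n
    unfolding S_def by (intro image_mono PiE_mono) auto
  have shift: "\<gamma> + t \<in> S (Suc n)" if g: "\<gamma> \<in> F" and t: "t \<in> S n" for \<gamma> t n
  proof -
    obtain k where k: "k \<in> F \<rightarrow>\<^sub>E {..n}" "t = (\<Sum>\<gamma>\<in>F. mul (k \<gamma>) \<gamma>)" using t by (auto simp: S_def)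
    define k' where "k' = k(\<gamma> := Suc (k \<gamma>))"
    have "k' \<in> F \<rightarrow>\<^sub>E {..Suc n}"
      using k(1) g by (auto simp: k'_def PiE_iff extensional_def le_SucI)
    moreover have "(\<Sum>\<delta>\<in>F. mul (k' \<delta>) \<delta>) = \<gamma> + t"
    proof -
      have "(\<Sum>\<delta>\<in>F. mul (k' \<delta>) \<delta>) = mul (Suc (k \<gamma>)) \<gamma> + (\<Sum>\<delta>\<in>F - {\<gamma>}. mul (k \<delta>) \<delta>)"
        using F g by (subst sum.remove[of F \<gamma>]) (auto simp: k'_def intro!: sum.cong)
      moreover have "t = mul (k \<gamma>) \<gamma> + (\<Sum>\<delta>\<in>F - {\<gamma>}. mul (k \<delta>) \<delta>)"
        unfolding k(2) using F g by (subst sum.remove[of F \<gamma>]) auto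
      ultimately show ?thesis by (simp add: mul_def add_ac)
    qed
    ultimately show ?thesis unfolding S_def by (metis (no_types, lifting) image_eqI)
  qed
  have "\<exists>n. real (card (S (Suc n))) \<le> (1 + e) * real (card (S n))"
  proof (rule ccontr)
    assume "\<not> ?thesis"
    then have g: "(1 + e) * real (card (S n)) \<le> real (card (S (Suc n)))" for n by (meson le_cases)
    have "(1 + e) ^ n \<le> real (card (S n))" for n
    proof (induction n)
      case 0 then show ?case using c0[of 0] by simp
    next
      case (Suc n)
      have "(1 + e) ^ Suc n \<le> (1 + e) * real (card (S n))" using Suc e by (simp add: mult_left_mono)
      then show ?case using g[of n] by linarith
    qed
    also have "real (card (S n)) \<le> real (Suc n) ^ card F" for n
      using crd[of n] by (metis of_nat_le_iff of_nat_power)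
    finally show False using exponential_beats_power[of "1 + e" "card F"] e by simp
  qed
  then obtain n where n: "real (card (S (Suc n))) \<le> (1 + e) * real (card (S n))" by blast
  show ?thesis
  proof (rule that[OF fin ne])
    fix \<gamma> assume g: "\<gamma> \<in> F"
    define A where "A = {t \<in> S n. \<gamma> + t \<in> S n}"
    have "card (S n - A) \<le> card (S (Suc n) - S n)"
    proof (rule card_inj_on_le[of "\<lambda>t. \<gamma> + t"])
      show "(\<lambda>t. \<gamma> + t) ` (S n - A) \<subseteq> S (Suc n) - S n" using shift[OF g] by (auto simp: A_def)
    qed (use fin in \<open>auto simp: inj_on_def\<close>)
    moreover have "card (S n - A) = card (S n) - card A"
      by (intro card_Diff_subset) (auto simp: A_def fin)
    moreover have "card (S (Suc n) - S n) = card (S (Suc n)) - card (S n)"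
      by (intro card_Diff_subset sub fin)
    moreover have "card A \<le> card (S n)" "card (S n) \<le> card (S (Suc n))"
      using fin sub by (auto intro!: card_mono simp: A_def)
    ultimately have "real (card (S n)) - real (card A) \<le> real (card (S (Suc n))) - real (card (S n))" by linarith
    then show "(1 - e) * real (card (S n)) \<le> real (card {t \<in> S n. \<gamma> + t \<in> S n})"
      using n by (simp add: A_def algebra_simps)
  qed
qed

definition pos_def_fun :: "('a::ab_group_add \<Rightarrow> complex) \<Rightarrow> bool" where
  "pos_def_fun \<phi> \<longleftrightarrow> (\<forall>S a. finite S \<longrightarrow>
     (\<exists>r\<ge>0. (\<Sum>s\<in>S. \<Sum>t\<in>S. a s * cnj (a t) * \<phi> (s - t)) = complex_of_real r))"

context dual_group
begin

text \<open>Orthogonality of characters: translation by y multiplies the mean z of a character by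
  chi y \<gamma>, which differs from 1 for some y unless \<gamma> = 0. The mean acts on real
  functions, so z is assembled from the real and imaginary parts.\<close>

lemma mean_trig_poly:
  assumes m: "invariant_mean m" and A: "finite A"
  shows "m (\<lambda>x. Re (\<Sum>i\<in>A. a i * chi x (g i))) = Re (\<Sum>i\<in>A. if g i = 0 then a i else 0)"
proof -
  note madd = invariant_meanD(1)[OF m] and msc = invariant_meanD(2)[OF m]
    and m1 = invariant_meanD(4)[OF m] and minv = invariant_meanD(5)[OF m]
  have bR: "bounded (range (\<lambda>x. Re (chi x \<gamma>)))" for \<gamma>
    unfolding bounded_range_iff by (metis abs_Re_le_cmod chi_norm)
  have bI: "bounded (range (\<lambda>x. Im (chi x \<gamma>)))" for \<gamma>
    unfolding bounded_range_iff by (metis abs_Im_le_cmod chi_norm)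
  have sc: "bounded (range (\<lambda>x. c * f x))" if "bounded (range f)" for f :: "'g \<Rightarrow> real" and c
    using bounded_scaling[OF that, of c] by (simp add: image_image)
  have van: "m (\<lambda>x. Re (chi x \<gamma>)) = 0 \<and> m (\<lambda>x. Im (chi x \<gamma>)) = 0" if g: "\<gamma> \<noteq> 0" for \<gamma>
  proof -
    obtain y where y: "chi y \<gamma> \<noteq> 1" using chi_sep[of \<gamma> 0] g by auto
    define z where "z = Complex (m (\<lambda>x. Re (chi x \<gamma>))) (m (\<lambda>x. Im (chi x \<gamma>)))"
    have "m (\<lambda>x. Re (chi x \<gamma>)) = m (\<lambda>x. Re (chi (x + y) \<gamma>))" using minv[OF bR[of \<gamma>], of y] by simp
    also have "(\<lambda>x. Re (chi (x + y) \<gamma>)) = (\<lambda>x. Re (chi y \<gamma>) * Re (chi x \<gamma>) + (- Im (chi y \<gamma>)) * Im (chi x \<gamma>))"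
      by (simp add: chi_add_left mult.commute)
    also have "m \<dots> = Re (chi y \<gamma>) * m (\<lambda>x. Re (chi x \<gamma>)) + (- Im (chi y \<gamma>)) * m (\<lambda>x. Im (chi x \<gamma>))"
      by (simp only: madd[OF sc[OF bR] sc[OF bI]] msc[OF bR] msc[OF bI])
    finally have 1: "Re z = Re (chi y \<gamma> * z)" by (simp add: z_def)
    have "m (\<lambda>x. Im (chi x \<gamma>)) = m (\<lambda>x. Im (chi (x + y) \<gamma>))" using minv[OF bI[of \<gamma>], of y] by simp
    also have "(\<lambda>x. Im (chi (x + y) \<gamma>)) = (\<lambda>x. Re (chi y \<gamma>) * Im (chi x \<gamma>) + Im (chi y \<gamma>) * Re (chi x \<gamma>))"
      by (simp add: chi_add_left mult.commute add.commute)
    also have "m \<dots> = Re (chi y \<gamma>) * m (\<lambda>x. Im (chi x \<gamma>)) + Im (chi y \<gamma>) * m (\<lambda>x. Re (chi x \<gamma>))"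
      by (simp only: madd[OF sc[OF bI] sc[OF bR]] msc[OF bR] msc[OF bI])
    finally have "Im z = Im (chi y \<gamma> * z)" by (simp add: z_def)
    with 1 have "z = chi y \<gamma> * z" by (rule complex_eqI)
    then have "z = 0" using y by auto
    then show ?thesis by (simp add: z_def complex_eq_iff)
  qed
  have single: "m (\<lambda>x. Re (a * chi x \<gamma>)) = Re (if \<gamma> = 0 then a else 0)" for a \<gamma>
  proof -
    have "(\<lambda>x. Re (a * chi x \<gamma>)) = (\<lambda>x. Re a * Re (chi x \<gamma>) + (- Im a) * Im (chi x \<gamma>))" by simp
    then have "m (\<lambda>x. Re (a * chi x \<gamma>)) = Re a * m (\<lambda>x. Re (chi x \<gamma>)) + (- Im a) * m (\<lambda>x. Im (chi x \<gamma>))"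
      by (simp only: madd[OF sc[OF bR] sc[OF bI]] msc[OF bR] msc[OF bI])
    moreover have "m (\<lambda>x. Im (chi x 0)) = 0"
      using msc[of "\<lambda>_. 1" 0] by simp
    ultimately show ?thesis using van[of \<gamma>] m1 by auto
  qed
  show ?thesis
    using A
  proof (induction A)
    case empty
    then show ?case using msc[of "\<lambda>_. 1" 0] by simp
  next
    case (insert i A)
    have bs: "bounded (range (\<lambda>x. Re (a i * chi x (g i))))"
      unfolding bounded_range_iff by (metis abs_Re_le_cmod norm_mult chi_norm mult.right_neutral)
    have bS: "bounded (range (\<lambda>x. Re (\<Sum>i\<in>A. a i * chi x (g i))))"
    proof -
      have "\<bar>Re (\<Sum>i\<in>A. a i * chi x (g i))\<bar> \<le> (\<Sum>i\<in>A. cmod (a i))" for x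
      proof -
        have "cmod (\<Sum>i\<in>A. a i * chi x (g i)) \<le> (\<Sum>i\<in>A. cmod (a i * chi x (g i)))" by (rule norm_sum)
        then show ?thesis using abs_Re_le_cmod[of "\<Sum>i\<in>A. a i * chi x (g i)"] by (simp add: norm_mult)
      qed
      then show ?thesis unfolding bounded_range_iff by blast
    qed
    have "m (\<lambda>x. Re (\<Sum>i\<in>insert i A. a i * chi x (g i)))
        = m (\<lambda>x. Re (a i * chi x (g i)) + Re (\<Sum>i\<in>A. a i * chi x (g i)))"
    proof -
      have "(\<lambda>x. Re (\<Sum>i\<in>insert i A. a i * chi x (g i)))
          = (\<lambda>x. Re (a i * chi x (g i)) + Re (\<Sum>i\<in>A. a i * chi x (g i)))"
        using insert(1,2) by (auto simp: fun_eq_iff)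
      then show ?thesis by (rule arg_cong)
    qed
    also have "\<dots> = Re (if g i = 0 then a i else 0) + Re (\<Sum>i\<in>A. if g i = 0 then a i else 0)"
      by (simp only: madd[OF bs bS] single insert(3))
    also have "\<dots> = Re (\<Sum>i\<in>insert i A. if g i = 0 then a i else 0)"
      using insert(1,2) by simp
    finally show ?case .
  qed
qed

text \<open>Q is a Fejer-type kernel: nonnegative by positive definiteness, with mean n * \<phi> 0,
  and the mean of P Q weights each term c \<gamma> * \<phi> \<gamma> by the overlap count N
  \<gamma>. Averaging (B - Re P) Q \<ge> 0 gives the bound with weights N \<gamma> / n, which the
  Folner property brings within e of 1.\<close>

lemma pos_def_fun_bound_Re:
  assumes pd: "pos_def_fun \<phi>" and A: "finite A" and B: "\<And>x. cmod (\<Sum>\<gamma>\<in>A. c \<gamma> * chi x \<gamma>) \<le> B"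
  shows "Re (\<Sum>\<gamma>\<in>A. c \<gamma> * \<phi> \<gamma>) \<le> B * Re (\<phi> 0)"
proof (rule field_le_epsilon)
  fix d :: real assume d: "0 < d"
  define M where "M = (\<Sum>\<gamma>\<in>A. cmod (c \<gamma> * \<phi> \<gamma>))"
  have M: "0 \<le> M" unfolding M_def by (intro sum_nonneg) auto
  \<comment> \<open>Replacing every weight N \<gamma> / n by 1 costs at most e * M in total, and
    this is at most d.\<close>
  define e where "e = d / (M + 1)"
  have e: "0 < e" using d M by (simp add: e_def)
  obtain S where S: "finite S" "S \<noteq> {}"
      "\<And>\<gamma>. \<gamma> \<in> A \<Longrightarrow> (1 - e) * real (card S) \<le> real (card {t \<in> S. \<gamma> + t \<in> S})"
    by (rule Folner_set[OF A e]) blast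
  define n where "n = real (card S)"
  have n: "0 < n" using S by (simp add: n_def card_gt_0_iff)
  define N where "N \<gamma> = real (card {t \<in> S. \<gamma> + t \<in> S})" for \<gamma>
  have N: "(1 - e) * n \<le> N \<gamma>" "N \<gamma> \<le> n" if "\<gamma> \<in> A" for \<gamma>
    using S(3)[OF that] S(1) by (auto simp: N_def n_def intro!: card_mono)
  obtain m :: "('g \<Rightarrow> real) \<Rightarrow> real" where m: "invariant_mean m" using invariant_mean_exists by blast
  define P where "P x = (\<Sum>\<gamma>\<in>A. c \<gamma> * chi x \<gamma>)" for x
  define Q where "Q x = (\<Sum>(s, t)\<in>S \<times> S. \<phi> (s - t) * chi x (t - s))" for x
  have Qr: "\<exists>r\<ge>0. Q x = of_real r" for x
  proof -
    have "Q x = (\<Sum>s\<in>S. \<Sum>t\<in>S. cnj (chi x s) * cnj (cnj (chi x t)) * \<phi> (s - t))"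
      unfolding Q_def sum.cartesian_product[symmetric]
      by (intro sum.cong refl) (simp add: chi_diff mult_ac)
    then show ?thesis
      using pd[unfolded pos_def_fun_def, rule_format, OF S(1), of "\<lambda>s. cnj (chi x s)"] by simp
  qed
  have PQ: "P x * Q x = (\<Sum>(\<gamma>, s, t)\<in>A \<times> (S \<times> S). (c \<gamma> * \<phi> (s - t)) * chi x (\<gamma> + (t - s)))" for x
    unfolding P_def Q_def sum_product sum.cartesian_product
    by (intro sum.cong refl) (auto simp: chi_add mult_ac)
  have mQ: "m (\<lambda>x. Re (Q x)) = n * Re (\<phi> 0)"
  proof -
    have "m (\<lambda>x. Re (Q x)) = Re (\<Sum>p\<in>S \<times> S. if snd p - fst p = 0 then \<phi> (fst p - snd p) else 0)"
      unfolding Q_def case_prod_beta using S(1) by (intro mean_trig_poly[OF m]) simp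
    also have "(\<Sum>p\<in>S \<times> S. if snd p - fst p = 0 then \<phi> (fst p - snd p) else 0)
        = (\<Sum>s\<in>S. \<Sum>t\<in>S. if t = s then \<phi> 0 else 0)"
      unfolding sum.cartesian_product by (intro sum.cong refl) auto
    also have "\<dots> = of_real n * \<phi> 0" using S(1) by (simp add: n_def)
    finally show ?thesis by simp
  qed
  have mPQ: "m (\<lambda>x. Re (P x * Q x)) = Re (\<Sum>\<gamma>\<in>A. of_real (N \<gamma>) * (c \<gamma> * \<phi> \<gamma>))"
  proof -
    have "m (\<lambda>x. Re (P x * Q x)) = Re (\<Sum>p\<in>A \<times> (S \<times> S).
        if fst p + (snd (snd p) - fst (snd p)) = 0 then c (fst p) * \<phi> (fst (snd p) - snd (snd p)) else 0)"
      unfolding PQ case_prod_beta using S(1) A by (intro mean_trig_poly[OF m]) simp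
    also have "(\<Sum>p\<in>A \<times> (S \<times> S).
        if fst p + (snd (snd p) - fst (snd p)) = 0 then c (fst p) * \<phi> (fst (snd p) - snd (snd p)) else 0)
        = (\<Sum>\<gamma>\<in>A. \<Sum>t\<in>S. \<Sum>s\<in>S. if s = \<gamma> + t then c \<gamma> * \<phi> \<gamma> else 0)"
    proof -
      have "(\<Sum>\<gamma>\<in>A. \<Sum>t\<in>S. \<Sum>s\<in>S. if s = \<gamma> + t then c \<gamma> * \<phi> \<gamma> else 0)
          = (\<Sum>\<gamma>\<in>A. \<Sum>s\<in>S. \<Sum>t\<in>S. if s = \<gamma> + t then c \<gamma> * \<phi> \<gamma> else 0)"
        by (intro sum.cong refl sum.swap)
      then show ?thesis unfolding sum.cartesian_product
        by (auto intro!: sum.cong simp: algebra_simps)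
    qed
    also have "\<dots> = (\<Sum>\<gamma>\<in>A. of_real (N \<gamma>) * (c \<gamma> * \<phi> \<gamma>))"
    proof (intro sum.cong refl)
      fix \<gamma>
      have "(\<Sum>t\<in>S. \<Sum>s\<in>S. if s = \<gamma> + t then c \<gamma> * \<phi> \<gamma> else 0) = (\<Sum>t\<in>S. if \<gamma> + t \<in> S then c \<gamma> * \<phi> \<gamma> else 0)"
        using S(1) by (intro sum.cong refl) simp
      also have "\<dots> = (\<Sum>t\<in>{t \<in> S. \<gamma> + t \<in> S}. c \<gamma> * \<phi> \<gamma>)"
        using S(1) by (intro sum.inter_filter[symmetric])
      finally show "(\<Sum>t\<in>S. \<Sum>s\<in>S. if s = \<gamma> + t then c \<gamma> * \<phi> \<gamma> else 0) = of_real (N \<gamma>) * (c \<gamma> * \<phi> \<gamma>)"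
        by (simp add: N_def)
    qed
    finally show ?thesis .
  qed
  have Q0: "0 \<le> Re (Q x)" for x using Qr[of x] by auto
  have Pb: "cmod (P x) \<le> B" for x unfolding P_def by (rule B)
  have B0: "0 \<le> B" using Pb[of 0] norm_ge_zero order_trans by blast
  have Qb: "\<exists>C. \<forall>x. cmod (Q x) \<le> C"
  proof (intro exI allI)
    fix x
    have "cmod (Q x) \<le> (\<Sum>p\<in>S \<times> S. cmod (\<phi> (fst p - snd p) * chi x (snd p - fst p)))"
      unfolding Q_def case_prod_beta by (rule norm_sum)
    then show "cmod (Q x) \<le> (\<Sum>p\<in>S \<times> S. cmod (\<phi> (fst p - snd p)))" by (simp add: norm_mult)
  qed
  then obtain C where C: "\<And>x. cmod (Q x) \<le> C" by blast
  have bQ: "bounded (range (\<lambda>x. Re (Q x)))"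
    unfolding bounded_range_iff using C abs_Re_le_cmod order_trans by blast
  have bPQ: "bounded (range (\<lambda>x. Re (P x * Q x)))"
    unfolding bounded_range_iff
  proof (intro exI allI)
    fix x
    have "cmod (P x * Q x) \<le> B * C" unfolding norm_mult by (intro mult_mono Pb C B0) auto
    then show "\<bar>Re (P x * Q x)\<bar> \<le> B * C" using abs_Re_le_cmod[of "P x * Q x"] by linarith
  qed
  have pt: "0 \<le> B * Re (Q x) + (-1) * Re (P x * Q x)" for x
  proof -
    obtain r where r: "r \<ge> 0" "Q x = of_real r" using Qr by blast
    have "Re (P x) \<le> B" using Pb[of x] complex_Re_le_cmod[of "P x"] by linarith
    then show ?thesis using mult_right_mono[of "Re (P x)" B r] r by simp
  qed
  have sc: "bounded (range (\<lambda>x. c * f x))" if "bounded (range f)" for f :: "'g \<Rightarrow> real" and c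
    using bounded_scaling[OF that, of c] by (simp add: image_image)
  note madd = invariant_meanD(1)[OF m] and msc = invariant_meanD(2)[OF m] and mpos = invariant_meanD(3)[OF m]
  have "0 \<le> m (\<lambda>x. B * Re (Q x) + (-1) * Re (P x * Q x))"
    by (rule mpos[OF bounded_plus_comp[OF sc[OF bQ] sc[OF bPQ]] pt])
  also have "\<dots> = B * m (\<lambda>x. Re (Q x)) + (-1) * m (\<lambda>x. Re (P x * Q x))"
    by (simp only: madd[OF sc[OF bQ] sc[OF bPQ]] msc[OF bQ] msc[OF bPQ])
  finally have "0 \<le> B * (n * Re (\<phi> 0)) + (-1) * Re (\<Sum>\<gamma>\<in>A. of_real (N \<gamma>) * (c \<gamma> * \<phi> \<gamma>))"
    by (simp only: mQ mPQ)
  then have main: "Re (\<Sum>\<gamma>\<in>A. of_real (N \<gamma>) * (c \<gamma> * \<phi> \<gamma>)) \<le> B * (n * Re (\<phi> 0))"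
    by linarith
  have "n * Re (\<Sum>\<gamma>\<in>A. c \<gamma> * \<phi> \<gamma>) - Re (\<Sum>\<gamma>\<in>A. of_real (N \<gamma>) * (c \<gamma> * \<phi> \<gamma>))
      = (\<Sum>\<gamma>\<in>A. (n - N \<gamma>) * Re (c \<gamma> * \<phi> \<gamma>))"
    by (simp add: sum_distrib_left sum_subtractf[symmetric] left_diff_distrib)
  also have "\<dots> \<le> (\<Sum>\<gamma>\<in>A. (e * n) * cmod (c \<gamma> * \<phi> \<gamma>))"
  proof (rule sum_mono)
    fix \<gamma> assume g: "\<gamma> \<in> A"
    have "(n - N \<gamma>) * Re (c \<gamma> * \<phi> \<gamma>) \<le> (n - N \<gamma>) * cmod (c \<gamma> * \<phi> \<gamma>)"
      using N(2)[OF g] by (intro mult_left_mono complex_Re_le_cmod) simp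
    also have "\<dots> \<le> (e * n) * cmod (c \<gamma> * \<phi> \<gamma>)"
      using N(1)[OF g] by (intro mult_right_mono) (auto simp: algebra_simps)
    finally show "(n - N \<gamma>) * Re (c \<gamma> * \<phi> \<gamma>) \<le> (e * n) * cmod (c \<gamma> * \<phi> \<gamma>)" .
  qed
  also have "\<dots> = n * (e * M)" by (simp add: M_def sum_distrib_left mult_ac)
  finally have "n * Re (\<Sum>\<gamma>\<in>A. c \<gamma> * \<phi> \<gamma>) \<le> n * (B * Re (\<phi> 0) + e * M)"
    using main by (simp add: algebra_simps)
  then have "Re (\<Sum>\<gamma>\<in>A. c \<gamma> * \<phi> \<gamma>) \<le> B * Re (\<phi> 0) + e * M" using n by simp
  also have "e * M \<le> d" using d M by (simp add: e_def field_simps)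
  finally show "Re (\<Sum>\<gamma>\<in>A. c \<gamma> * \<phi> \<gamma>) \<le> B * Re (\<phi> 0) + d" by simp
qed

text \<open>Rotating the coefficients by the phase of the sum makes the sum real without enlarging
  the sup norm.\<close>

theorem pos_def_fun_bound:
  assumes pd: "pos_def_fun \<phi>" and A: "finite A" and B: "\<And>x. cmod (\<Sum>\<gamma>\<in>A. c \<gamma> * chi x \<gamma>) \<le> B"
  shows "cmod (\<Sum>\<gamma>\<in>A. c \<gamma> * \<phi> \<gamma>) \<le> B * Re (\<phi> 0)"
proof -
  define L where "L = (\<Sum>\<gamma>\<in>A. c \<gamma> * \<phi> \<gamma>)"
  define w where "w = cnj (sgn L)"
  have w: "w * L = of_real (cmod L)"
  proof -
    have "cnj L * L = of_real (cmod L) * of_real (cmod L)"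
      using complex_norm_square[of L] by (simp add: power2_eq_square mult.commute)
    then show ?thesis by (simp add: w_def sgn_eq)
  qed
  have w1: "cmod w \<le> 1" by (simp add: w_def norm_sgn)
  have "Re (\<Sum>\<gamma>\<in>A. (w * c \<gamma>) * \<phi> \<gamma>) \<le> B * Re (\<phi> 0)"
  proof (rule pos_def_fun_bound_Re[OF pd A])
    fix x
    have "(\<Sum>\<gamma>\<in>A. w * c \<gamma> * chi x \<gamma>) = w * (\<Sum>\<gamma>\<in>A. c \<gamma> * chi x \<gamma>)" by (simp add: sum_distrib_left mult_ac)
    then have "cmod (\<Sum>\<gamma>\<in>A. w * c \<gamma> * chi x \<gamma>) \<le> 1 * B"
      unfolding norm_mult by (simp only: norm_mult) (intro mult_mono w1 B, auto)
    then show "cmod (\<Sum>\<gamma>\<in>A. w * c \<gamma> * chi x \<gamma>) \<le> B" by simp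
  qed
  moreover have "(\<Sum>\<gamma>\<in>A. (w * c \<gamma>) * \<phi> \<gamma>) = w * L" by (simp add: L_def sum_distrib_left mult_ac)
  ultimately show ?thesis unfolding w L_def[symmetric] by simp
qed

end

section \<open>Local norms\<close>

definition pair :: "('c \<Rightarrow> complex) \<Rightarrow> ('c \<Rightarrow> complex) \<Rightarrow> complex" where
  "pair c \<phi> = (\<Sum>\<gamma> | c \<gamma> \<noteq> 0. c \<gamma> * \<phi> \<gamma>)"

lemma pair_superset: "finite A \<Longrightarrow> {\<gamma>. c \<gamma> \<noteq> 0} \<subseteq> A \<Longrightarrow> pair c \<phi> = (\<Sum>\<gamma>\<in>A. c \<gamma> * \<phi> \<gamma>)"
  unfolding pair_def by (intro sum.mono_neutral_left) auto

lemma pair_add: "pair c (\<lambda>\<gamma>. \<phi> \<gamma> + \<psi> \<gamma>) = pair c \<phi> + pair c \<psi>"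
  by (simp add: pair_def distrib_left sum.distrib)

lemma pair_scale: "pair c (\<lambda>\<gamma>. a * \<phi> \<gamma>) = a * pair c \<phi>"
  by (simp add: pair_def sum_distrib_left mult_ac)

lemma pair_cong: "(\<And>\<gamma>. c \<gamma> \<noteq> 0 \<Longrightarrow> \<phi> \<gamma> = \<psi> \<gamma>) \<Longrightarrow> pair c \<phi> = pair c \<psi>"
  unfolding pair_def by (intro sum.cong) auto

lemma pair_scale_coeff: "a \<noteq> 0 \<Longrightarrow> pair (\<lambda>\<gamma>. a * c \<gamma>) \<phi> = a * pair c \<phi>"
  by (simp add: pair_def sum_distrib_left mult_ac)

lemma pair_mult:
  assumes "finite {\<gamma>. c \<gamma> \<noteq> 0}"
  shows "pair (\<lambda>\<gamma>. c \<gamma> * \<phi> \<gamma>) \<psi> = pair c (\<lambda>\<gamma>. \<phi> \<gamma> * \<psi> \<gamma>)"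
  using pair_superset[OF assms, of "\<lambda>\<gamma>. c \<gamma> * \<phi> \<gamma>" \<psi>] by (auto simp: pair_def mult.assoc)

lemma tp_eval_pair: "tp_eval chi c x = pair c (chi x)"
  by (simp add: tp_eval_def pair_def)

locale dual_nbhd = dual_group chi
  for chi :: "'g::{topological_ab_group_add,t2_space} \<Rightarrow> 'c::{topological_space,ab_group_add} \<Rightarrow> complex" +
  fixes V :: "'c set"
  assumes V_open: "open V" and V_0: "0 \<in> V" and V_compact: "compact (closure V)"
begin

abbreviation nb :: "'c \<Rightarrow> 'c set" where "nb \<gamma> \<equiv> (\<lambda>v. v + \<gamma>) ` closure V"

lemma closure_V_0: "0 \<in> closure V"
  using V_0 closure_subset by blast

lemma nb_self: "\<gamma> \<in> nb \<gamma>"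
  using closure_V_0 by force

definition unit_ball :: "'c \<Rightarrow> ('c \<Rightarrow> complex) set" where
  "unit_ball \<gamma> = {c \<in> span_coeffs (nb \<gamma>). \<forall>x. cmod (tp_eval chi c x) \<le> 1}"

text \<open>The local norm as a predicate on real bounds; extended reals then occur only in bridging
  facts such as \<open>loc_norm_le_iff\<close>.\<close>

definition loc_le :: "('c \<Rightarrow> complex) \<Rightarrow> 'c \<Rightarrow> real \<Rightarrow> bool" where
  "loc_le \<phi> \<gamma> M \<longleftrightarrow> (\<forall>c\<in>unit_ball \<gamma>. cmod (pair c \<phi>) \<le> M)"

lemma loc_norm_le_iff: "loc_norm chi (closure V) \<phi> \<gamma> \<le> ereal M \<longleftrightarrow> loc_le \<phi> \<gamma> M"
  by (simp add: loc_norm_def loc_le_def unit_ball_def SUP_le_iff pair_def)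

lemma zero_unit_ball: "(\<lambda>_. 0) \<in> unit_ball \<gamma>"
  by (simp add: unit_ball_def span_coeffs_def tp_eval_def)

lemma loc_le_nonneg: "loc_le \<phi> \<gamma> M \<Longrightarrow> 0 \<le> M"
  using zero_unit_ball[of \<gamma>] by (auto simp: loc_le_def pair_def)

lemma loc_norm_nonneg: "0 \<le> loc_norm chi (closure V) \<phi> \<gamma>"
proof -
  have "ereal (cmod (\<Sum>\<gamma>'\<in>{\<gamma>'. (\<lambda>_. 0::complex) \<gamma>' \<noteq> 0}. (\<lambda>_. 0) \<gamma>' * \<phi> \<gamma>')) \<le> loc_norm chi (closure V) \<phi> \<gamma>"
    unfolding loc_norm_def using zero_unit_ball[of \<gamma>] by (intro SUP_upper) (simp add: unit_ball_def)
  then show ?thesis by (simp add: zero_ereal_def)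
qed

lemma bse_norm_le_iff: "bse_norm chi (closure V) \<phi> \<le> ereal M \<longleftrightarrow> (\<forall>\<gamma>. loc_le \<phi> \<gamma> M)"
  by (simp add: bse_norm_def SUP_le_iff loc_norm_le_iff)

lemma bse_norm_nonneg: "0 \<le> bse_norm chi (closure V) \<phi>"
  unfolding bse_norm_def using loc_norm_nonneg by (intro SUP_upper2[of 0]) auto

lemma bse_norm_eq: "bse_norm chi (closure V) \<phi> < \<infinity> \<Longrightarrow> bse_norm chi (closure V) \<phi> = ereal (Anorm chi (closure V) \<phi>)"
  unfolding Anorm_def using bse_norm_nonneg[of \<phi>]
  by (cases "bse_norm chi (closure V) \<phi>") auto

lemma loc_le_mono: "loc_le \<phi> \<gamma> M \<Longrightarrow> M \<le> N \<Longrightarrow> loc_le \<phi> \<gamma> N"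
  by (force simp: loc_le_def)

lemma loc_le_coeff_bound:
  assumes l: "loc_le \<phi> \<gamma> M" and c: "c \<in> span_coeffs (nb \<gamma>)" and B: "\<And>x. cmod (tp_eval chi c x) \<le> B"
  shows "cmod (pair c \<phi>) \<le> M * B"
proof (rule field_le_epsilon)
  fix e :: real assume e: "0 < e"
  have M: "0 \<le> M" using loc_le_nonneg[OF l] .
  have B0: "0 \<le> B" using B[of 0] norm_ge_zero order_trans by blast
  \<comment> \<open>The scaling factor must be positive even when B = 0; the excess over B costs M *
    e / (M + 1), which is at most e.\<close>
  define D where "D = B + e / (M + 1)"
  have D: "0 < D" using e M B0 by (simp add: D_def add_nonneg_pos)
  define b :: complex where "b = of_real (1 / D)"
  have b: "b \<noteq> 0" "cmod b = 1 / D" using D by (simp_all add: b_def norm_divide)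
  have "(\<lambda>\<gamma>. b * c \<gamma>) \<in> unit_ball \<gamma>"
    unfolding unit_ball_def
  proof (intro CollectI conjI allI)
    show "(\<lambda>\<gamma>. b * c \<gamma>) \<in> span_coeffs (nb \<gamma>)" using c b by (simp add: span_coeffs_def)
    fix x
    have "B \<le> D" using e M by (simp add: D_def)
    then have "cmod (pair c (chi x)) / D \<le> 1" using B[of x] D by (simp add: tp_eval_pair)
    then show "cmod (tp_eval chi (\<lambda>\<gamma>. b * c \<gamma>) x) \<le> 1"
      by (simp add: tp_eval_pair pair_scale_coeff b norm_mult)
  qed
  then have "cmod (pair (\<lambda>\<gamma>. b * c \<gamma>) \<phi>) \<le> M" using l by (simp add: loc_le_def)
  then have "cmod (pair c \<phi>) \<le> M * D" using D by (simp add: pair_scale_coeff b norm_mult field_simps)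
  also have "\<dots> \<le> M * B + e" using e M by (simp add: D_def field_simps)
  finally show "cmod (pair c \<phi>) \<le> M * B + e" .
qed

lemma loc_le_add: "loc_le \<phi> \<gamma> M \<Longrightarrow> loc_le \<psi> \<gamma> N \<Longrightarrow> loc_le (\<lambda>\<gamma>. \<phi> \<gamma> + \<psi> \<gamma>) \<gamma> (M + N)"
  unfolding loc_le_def pair_add by (meson add_mono norm_triangle_ineq order_trans)

lemma loc_le_scale: "loc_le \<phi> \<gamma> M \<Longrightarrow> loc_le (\<lambda>\<gamma>. a * \<phi> \<gamma>) \<gamma> (cmod a * M)"
  unfolding loc_le_def pair_scale norm_mult by (simp add: mult_left_mono)

lemma loc_le_diff: "loc_le \<phi> \<gamma> M \<Longrightarrow> loc_le \<psi> \<gamma> N \<Longrightarrow> loc_le (\<lambda>\<gamma>. \<phi> \<gamma> - \<psi> \<gamma>) \<gamma> (M + N)"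
  using loc_le_add[of \<phi> \<gamma> M "\<lambda>\<gamma>. -1 * \<psi> \<gamma>" N] loc_le_scale[of \<psi> \<gamma> N "-1"] by simp

text \<open>The polynomial with coefficients c * \<phi> takes at x the value of \<phi> paired with c
  \<delta> * chi x \<delta>, the coefficients of a translate of the original polynomial and hence
  again in the unit ball. So its sup norm is at most M, and \<psi> is paired with it.\<close>

lemma loc_le_mult:
  assumes "loc_le \<phi> \<gamma> M" "loc_le \<psi> \<gamma> N"
  shows "loc_le (\<lambda>\<gamma>. \<phi> \<gamma> * \<psi> \<gamma>) \<gamma> (M * N)"
  unfolding loc_le_def
proof
  fix c assume c: "c \<in> unit_ball \<gamma>"
  then have fin: "finite {\<gamma>. c \<gamma> \<noteq> 0}" and sub: "{\<gamma>. c \<gamma> \<noteq> 0} \<subseteq> nb \<gamma>"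
    and tp: "\<And>x. cmod (pair c (chi x)) \<le> 1" by (auto simp: unit_ball_def span_coeffs_def tp_eval_pair)
  define q where "q \<delta> = c \<delta> * \<phi> \<delta>" for \<delta>
  have q: "q \<in> span_coeffs (nb \<gamma>)"
    using fin sub unfolding span_coeffs_def by (auto simp: q_def elim!: rev_finite_subset)
  have "cmod (tp_eval chi q x) \<le> M" for x
  proof -
    define c' where "c' \<delta> = c \<delta> * chi x \<delta>" for \<delta>
    have nz: "{\<delta>. c' \<delta> \<noteq> 0} = {\<delta>. c \<delta> \<noteq> 0}" by (simp add: c'_def)
    have "pair c' (chi y) = pair c (chi (x + y))" for y
      unfolding pair_def nz by (intro sum.cong refl) (simp add: c'_def chi_add_left)
    then have "c' \<in> unit_ball \<gamma>"
      using fin sub tp unfolding unit_ball_def span_coeffs_def tp_eval_pair by (simp add: nz)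
    then have "cmod (pair c' \<phi>) \<le> M" using assms(1) by (simp add: loc_le_def)
    moreover have "pair c' \<phi> = pair q (chi x)"
      unfolding c'_def q_def pair_mult[OF fin] by (simp add: mult.commute)
    ultimately show ?thesis by (simp add: tp_eval_pair)
  qed
  then have "cmod (pair q \<psi>) \<le> N * M" by (rule loc_le_coeff_bound[OF assms(2) q])
  then show "cmod (pair c (\<lambda>\<gamma>. \<phi> \<gamma> * \<psi> \<gamma>)) \<le> M * N"
    unfolding q_def pair_mult[OF fin] by (simp add: mult.commute)
qed

lemma loc_le_point:
  assumes "loc_le \<phi> \<gamma> M" "\<delta> \<in> nb \<gamma>" shows "cmod (\<phi> \<delta>) \<le> M"
proof -
  define c where "c \<gamma>' = (if \<gamma>' = \<delta> then 1 else 0 :: complex)" for \<gamma>'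
  have s: "{\<gamma>'. c \<gamma>' \<noteq> 0} = {\<delta>}" by (auto simp: c_def)
  have p: "pair c f = f \<delta>" for f by (simp add: pair_def s) (simp add: c_def)
  have "c \<in> unit_ball \<gamma>"
    using assms(2) by (simp add: unit_ball_def span_coeffs_def s tp_eval_pair p)
  then show ?thesis using assms(1) p[of \<phi>] by (auto simp: loc_le_def)
qed

lemma loc_le_cong:
  assumes "loc_le \<phi> \<gamma> M" "\<And>\<delta>. \<delta> \<in> nb \<gamma> \<Longrightarrow> \<phi> \<delta> = \<psi> \<delta>" shows "loc_le \<psi> \<gamma> M"
proof -
  have "pair c \<psi> = pair c \<phi>" if "c \<in> unit_ball \<gamma>" for c
    using that assms(2) by (intro pair_cong) (auto simp: unit_ball_def span_coeffs_def)
  then show ?thesis using assms(1) by (simp add: loc_le_def)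
qed

lemma loc_le_zero: "0 \<le> M \<Longrightarrow> loc_le (\<lambda>_. 0) \<gamma> M"
  by (simp add: loc_le_def pair_def)

lemma loc_le_vanish:
  assumes "\<And>\<delta>. \<delta> \<in> nb \<gamma> \<Longrightarrow> \<phi> \<delta> = 0" "0 \<le> M" shows "loc_le \<phi> \<gamma> M"
  by (rule loc_le_cong[OF loc_le_zero[OF assms(2)]]) (simp add: assms(1))

text \<open>Shifting all frequencies by \<delta> multiplies the polynomial by a unimodular
  character, so the unit ball at \<gamma> is carried into the one at \<gamma> - \<delta>.\<close>

lemma loc_le_translate:
  assumes "loc_le \<phi> (\<gamma> - \<delta>) M" shows "loc_le (\<lambda>\<gamma>'. \<phi> (\<gamma>' - \<delta>)) \<gamma> M"
  unfolding loc_le_def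
proof
  fix c assume c: "c \<in> unit_ball \<gamma>"
  define c' where "c' \<gamma>' = c (\<gamma>' + \<delta>)" for \<gamma>'
  have s: "{\<gamma>'. c \<gamma>' \<noteq> 0} = (\<lambda>\<gamma>'. \<gamma>' + \<delta>) ` {\<gamma>'. c' \<gamma>' \<noteq> 0}"
  proof (intro equalityI subsetI)
    fix x assume "x \<in> {\<gamma>'. c \<gamma>' \<noteq> 0}"
    then show "x \<in> (\<lambda>\<gamma>'. \<gamma>' + \<delta>) ` {\<gamma>'. c' \<gamma>' \<noteq> 0}"
      by (intro image_eqI[of _ _ "x - \<delta>"]) (simp_all add: c'_def)
  qed (auto simp: c'_def)
  have fin: "finite {\<gamma>'. c \<gamma>' \<noteq> 0}" and sub: "{\<gamma>'. c \<gamma>' \<noteq> 0} \<subseteq> nb \<gamma>"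
    and tp: "\<And>x. cmod (pair c (chi x)) \<le> 1"
    using c by (auto simp: unit_ball_def span_coeffs_def tp_eval_pair)
  have inj: "inj_on (\<lambda>\<gamma>'. \<gamma>' + \<delta>) A" for A by (simp add: inj_on_def)
  have fin': "finite {\<gamma>'. c' \<gamma>' \<noteq> 0}" using fin unfolding s by (rule finite_imageD) (rule inj)
  have p: "pair c f = pair c' (\<lambda>\<gamma>'. f (\<gamma>' + \<delta>))" for f
    unfolding pair_def s by (subst sum.reindex[OF inj]) (simp add: c'_def)
  have "c' \<in> unit_ball (\<gamma> - \<delta>)"
    unfolding unit_ball_def span_coeffs_def
  proof (intro CollectI conjI allI subsetI fin')
    fix \<gamma>' assume "\<gamma>' \<in> {\<gamma>'. c' \<gamma>' \<noteq> 0}"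
    then have "\<gamma>' + \<delta> \<in> nb \<gamma>" using sub by (auto simp: c'_def)
    then obtain v where "v \<in> closure V" "\<gamma>' + \<delta> = v + \<gamma>" by blast
    then have "\<gamma>' = v + (\<gamma> - \<delta>)" by (metis add_diff_cancel_right' add_diff_eq)
    then show "\<gamma>' \<in> nb (\<gamma> - \<delta>)" using \<open>v \<in> closure V\<close> by blast
  next
    fix x
    have "pair c (chi x) = chi x \<delta> * pair c' (chi x)"
      unfolding p[of "chi x"] chi_add pair_scale[symmetric] by (simp add: mult.commute)
    then show "cmod (tp_eval chi c' x) \<le> 1" using tp[of x] by (simp add: tp_eval_pair norm_mult)
  qed
  then have "cmod (pair c' \<phi>) \<le> M" using assms by (simp add: loc_le_def)
  then show "cmod (pair c (\<lambda>\<gamma>'. \<phi> (\<gamma>' - \<delta>))) \<le> M" by (simp add: p)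
qed

text \<open>Each pairing involves finitely many values, so local bounds survive pointwise limits;
  this is the lower semicontinuity behind completeness.\<close>

lemma loc_le_limit:
  assumes l: "\<And>\<delta>. (\<lambda>n. f n \<delta>) \<longlonglongrightarrow> \<phi> \<delta>" and b: "\<And>n. n \<ge> N \<Longrightarrow> loc_le (f n) \<gamma> M"
  shows "loc_le \<phi> \<gamma> M"
  unfolding loc_le_def
proof
  fix c assume c: "c \<in> unit_ball \<gamma>"
  have "(\<lambda>n. cmod (pair c (f n))) \<longlonglongrightarrow> cmod (pair c \<phi>)"
    unfolding pair_def by (intro tendsto_intros l)
  then show "cmod (pair c \<phi>) \<le> M"
    by (rule LIMSEQ_le_const2) (use b c in \<open>auto simp: loc_le_def\<close>)
qed

text \<open>Membership in \<open>Aalg\<close> with the limit along Kfam replaced by compact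
  exceptional sets and the norms by real bounds; the equivalence rests on
  \<open>Kfam_superset\<close>.\<close>

definition in_A :: "('c \<Rightarrow> complex) \<Rightarrow> bool" where
  "in_A \<psi> \<longleftrightarrow> continuous_on UNIV \<psi> \<and> (\<exists>M. \<forall>\<gamma>. loc_le \<psi> \<gamma> M) \<and>
     (\<forall>e>0. \<exists>K. compact K \<and> (\<forall>\<gamma>. \<gamma> \<notin> K \<longrightarrow> loc_le \<psi> \<gamma> e))"

lemma Aalg_iff: "\<psi> \<in> Aalg chi (closure V) \<longleftrightarrow> in_A \<psi>"
proof
  assume a: "\<psi> \<in> Aalg chi (closure V)"
  then have c: "continuous_on UNIV \<psi>" and fin: "bse_norm chi (closure V) \<psi> < \<infinity>"
    and van: "\<And>e. 0 < e \<Longrightarrow> \<exists>\<Omega>0\<in>Kfam. \<forall>\<Omega>\<in>Kfam. \<Omega>0 \<subseteq> \<Omega> \<longrightarrow>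
       (SUP \<gamma>\<in>- \<Omega>. loc_norm chi (closure V) \<psi> \<gamma>) \<le> ereal e"
    by (auto simp: Aalg_def C_BSE_def Cb_def)
  have "\<forall>\<gamma>. loc_le \<psi> \<gamma> (Anorm chi (closure V) \<psi>)"
    using bse_norm_eq[OF fin] by (simp add: bse_norm_le_iff[symmetric])
  moreover have "\<exists>K. compact K \<and> (\<forall>\<gamma>. \<gamma> \<notin> K \<longrightarrow> loc_le \<psi> \<gamma> e)" if e: "0 < e" for e
  proof -
    obtain \<Omega> where O: "\<Omega> \<in> Kfam" "(SUP \<gamma>\<in>- \<Omega>. loc_norm chi (closure V) \<psi> \<gamma>) \<le> ereal e"
      using van[OF e] by blast
    have "loc_le \<psi> \<gamma> e" if "\<gamma> \<notin> \<Omega>" for \<gamma>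
      using O(2) that by (simp add: SUP_le_iff loc_norm_le_iff)
    then show ?thesis using O(1) by (auto simp: Kfam_def)
  qed
  ultimately show "in_A \<psi>" using c by (auto simp: in_A_def)
next
  assume "in_A \<psi>"
  then obtain M where c: "continuous_on UNIV \<psi>" and M: "\<And>\<gamma>. loc_le \<psi> \<gamma> M"
    and van: "\<And>e. 0 < e \<Longrightarrow> \<exists>K. compact K \<and> (\<forall>\<gamma>. \<gamma> \<notin> K \<longrightarrow> loc_le \<psi> \<gamma> e)"
    by (auto simp: in_A_def)
  have "bounded (range \<psi>)"
    using loc_le_point[OF M nb_self] by (auto simp: bounded_iff)
  moreover have "bse_norm chi (closure V) \<psi> \<le> ereal M" using M by (simp add: bse_norm_le_iff)
  then have "bse_norm chi (closure V) \<psi> < \<infinity>" by (rule le_less_trans) simp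
  moreover have "\<exists>\<Omega>0\<in>Kfam. \<forall>\<Omega>\<in>Kfam. \<Omega>0 \<subseteq> \<Omega> \<longrightarrow>
       (SUP \<gamma>\<in>- \<Omega>. loc_norm chi (closure V) \<psi> \<gamma>) \<le> ereal e" if e: "0 < e" for e
  proof -
    obtain K where K: "compact K" "\<And>\<gamma>. \<gamma> \<notin> K \<Longrightarrow> loc_le \<psi> \<gamma> e" using van[OF e] by blast
    obtain \<Omega>0 where O: "\<Omega>0 \<in> Kfam" "K \<subseteq> \<Omega>0" using Kfam_superset[OF V_open V_0 V_compact K(1)] by blast
    have "(SUP \<gamma>\<in>- \<Omega>. loc_norm chi (closure V) \<psi> \<gamma>) \<le> ereal e" if "\<Omega>0 \<subseteq> \<Omega>" for \<Omega>
      using that O(2) K(2) by (auto simp: SUP_le_iff loc_norm_le_iff)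
    then show ?thesis using O(1) by blast
  qed
  ultimately show "\<psi> \<in> Aalg chi (closure V)" using c by (auto simp: Aalg_def C_BSE_def Cb_def)
qed

section \<open>Norm, operations and completeness of the algebra\<close>

abbreviation An :: "('c \<Rightarrow> complex) \<Rightarrow> real" where "An \<equiv> Anorm chi (closure V)"

lemma An_le: "(\<And>\<gamma>. loc_le \<psi> \<gamma> M) \<Longrightarrow> An \<psi> \<le> M"
  and loc_le_An: "(\<And>\<gamma>. loc_le \<psi> \<gamma> M) \<Longrightarrow> loc_le \<psi> \<gamma> (An \<psi>)"
proof -
  assume M: "\<And>\<gamma>. loc_le \<psi> \<gamma> M"
  then have 1: "bse_norm chi (closure V) \<psi> \<le> ereal M" by (simp add: bse_norm_le_iff)
  then have "bse_norm chi (closure V) \<psi> < \<infinity>" by (rule le_less_trans) simp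
  from bse_norm_eq[OF this] have 2: "bse_norm chi (closure V) \<psi> = ereal (An \<psi>)" .
  from 1 2 show "An \<psi> \<le> M" by simp
  from 2 have "bse_norm chi (closure V) \<psi> \<le> ereal (An \<psi>)" by simp
  then show "loc_le \<psi> \<gamma> (An \<psi>)" unfolding bse_norm_le_iff by blast
qed

lemma in_A_loc: "in_A \<psi> \<Longrightarrow> loc_le \<psi> \<gamma> (An \<psi>)"
  using loc_le_An unfolding in_A_def by blast

lemma in_A_nonneg: "in_A \<psi> \<Longrightarrow> 0 \<le> An \<psi>"
  using loc_le_nonneg[OF in_A_loc] .

lemma in_A_point: "in_A \<psi> \<Longrightarrow> cmod (\<psi> \<gamma>) \<le> An \<psi>"
  by (rule loc_le_point[OF in_A_loc nb_self])

lemma in_A_cont: "in_A \<psi> \<Longrightarrow> continuous_on UNIV \<psi>"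
  by (simp add: in_A_def)

lemma in_A_vanish: "in_A \<psi> \<Longrightarrow> 0 < e \<Longrightarrow> \<exists>K. compact K \<and> (\<forall>\<gamma>. \<gamma> \<notin> K \<longrightarrow> loc_le \<psi> \<gamma> e)"
  by (simp add: in_A_def)

lemma in_AI:
  assumes "continuous_on UNIV \<psi>" "\<And>\<gamma>. loc_le \<psi> \<gamma> M"
    "\<And>e. 0 < e \<Longrightarrow> \<exists>K. compact K \<and> (\<forall>\<gamma>. \<gamma> \<notin> K \<longrightarrow> loc_le \<psi> \<gamma> e)"
  shows "in_A \<psi>"
  using assms by (auto simp: in_A_def)

text \<open>For \<gamma> outside the compact set K - closure V the window at \<gamma> misses K, so
  the local norm there is 0.\<close>

lemma in_A_cpt:
  assumes "continuous_on UNIV \<psi>" "\<And>\<gamma>. loc_le \<psi> \<gamma> M" and K: "compact K" "\<And>\<gamma>. \<gamma> \<notin> K \<Longrightarrow> \<psi> \<gamma> = 0"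
  shows "in_A \<psi>"
proof (rule in_AI[OF assms(1,2)])
  fix e :: real assume e: "0 < e"
  have "loc_le \<psi> \<gamma> e" if g: "\<gamma> \<notin> {a - b |a b. a \<in> K \<and> b \<in> closure V}" for \<gamma>
  proof (rule loc_le_vanish)
    fix \<delta> assume "\<delta> \<in> nb \<gamma>"
    then obtain v where v: "v \<in> closure V" "\<delta> = v + \<gamma>" by blast
    then have "\<gamma> = \<delta> - v" by simp
    then have "\<delta> \<notin> K" using g v(1) by blast
    then show "\<psi> \<delta> = 0" by (rule K(2))
  qed (use e in simp)
  then show "\<exists>K. compact K \<and> (\<forall>\<gamma>. \<gamma> \<notin> K \<longrightarrow> loc_le \<psi> \<gamma> e)"
    using dual_compact_diff[OF K(1) V_compact] by blast
qed

lemma in_A_0: "in_A (\<lambda>_. 0)"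
  by (rule in_A_cpt[of _ 0 "{}"]) (auto intro: loc_le_zero)

lemma in_A_add:
  assumes "in_A \<phi>" "in_A \<psi>"
  shows "in_A (\<lambda>\<gamma>. \<phi> \<gamma> + \<psi> \<gamma>)" and "An (\<lambda>\<gamma>. \<phi> \<gamma> + \<psi> \<gamma>) \<le> An \<phi> + An \<psi>"
proof -
  have l: "loc_le (\<lambda>\<gamma>. \<phi> \<gamma> + \<psi> \<gamma>) \<gamma> (An \<phi> + An \<psi>)" for \<gamma>
    by (intro loc_le_add in_A_loc assms)
  then show "An (\<lambda>\<gamma>. \<phi> \<gamma> + \<psi> \<gamma>) \<le> An \<phi> + An \<psi>" by (rule An_le)
  show "in_A (\<lambda>\<gamma>. \<phi> \<gamma> + \<psi> \<gamma>)"
  proof (rule in_AI[OF _ l])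
    show "continuous_on UNIV (\<lambda>\<gamma>. \<phi> \<gamma> + \<psi> \<gamma>)" by (intro continuous_intros in_A_cont assms)
    fix e :: real assume "0 < e"
    then have e: "0 < e / 2" by simp
    obtain K where K: "compact K" "\<forall>\<gamma>. \<gamma> \<notin> K \<longrightarrow> loc_le \<phi> \<gamma> (e / 2)" using in_A_vanish[OF assms(1) e] by blast
    obtain L where L: "compact L" "\<forall>\<gamma>. \<gamma> \<notin> L \<longrightarrow> loc_le \<psi> \<gamma> (e / 2)" using in_A_vanish[OF assms(2) e] by blast
    have "loc_le (\<lambda>\<gamma>. \<phi> \<gamma> + \<psi> \<gamma>) \<gamma> e" if "\<gamma> \<notin> K \<union> L" for \<gamma>
      using loc_le_add[of \<phi> \<gamma> "e / 2" \<psi> "e / 2"] K L that by simp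
    then show "\<exists>K. compact K \<and> (\<forall>\<gamma>. \<gamma> \<notin> K \<longrightarrow> loc_le (\<lambda>\<gamma>. \<phi> \<gamma> + \<psi> \<gamma>) \<gamma> e)"
      using compact_Un[OF K(1) L(1)] by blast
  qed
qed

text \<open>Decay at infinity is inherited from \<phi> alone, so the other factor may be a
  multiplier without decay, for instance a constant.\<close>

lemma in_A_mult_bdd:
  assumes \<phi>: "in_A \<phi>" and c: "continuous_on UNIV \<psi>" and N: "\<And>\<gamma>. loc_le \<psi> \<gamma> N"
  shows "in_A (\<lambda>\<gamma>. \<phi> \<gamma> * \<psi> \<gamma>)" and "An (\<lambda>\<gamma>. \<phi> \<gamma> * \<psi> \<gamma>) \<le> An \<phi> * N"
proof -
  have l: "loc_le (\<lambda>\<gamma>. \<phi> \<gamma> * \<psi> \<gamma>) \<gamma> (An \<phi> * N)" for \<gamma>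
    by (intro loc_le_mult in_A_loc \<phi> N)
  then show "An (\<lambda>\<gamma>. \<phi> \<gamma> * \<psi> \<gamma>) \<le> An \<phi> * N" by (rule An_le)
  have N0: "0 \<le> N" using loc_le_nonneg[OF N] .
  show "in_A (\<lambda>\<gamma>. \<phi> \<gamma> * \<psi> \<gamma>)"
  proof (rule in_AI[OF _ l])
    show "continuous_on UNIV (\<lambda>\<gamma>. \<phi> \<gamma> * \<psi> \<gamma>)" by (intro continuous_intros in_A_cont \<phi> c)
    fix e :: real assume e0: "0 < e"
    then have e: "0 < e / (N + 1)" using N0 by simp
    obtain K where K: "compact K" "\<forall>\<gamma>. \<gamma> \<notin> K \<longrightarrow> loc_le \<phi> \<gamma> (e / (N + 1))" using in_A_vanish[OF \<phi> e] by blast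
    have "e / (N + 1) * N \<le> e" using e0 N0 by (simp add: field_simps)
    then have "loc_le (\<lambda>\<gamma>. \<phi> \<gamma> * \<psi> \<gamma>) \<gamma> e" if "\<gamma> \<notin> K" for \<gamma>
      using loc_le_mult[of \<phi> \<gamma> "e / (N + 1)" \<psi> N] K N that loc_le_mono by blast
    then show "\<exists>K. compact K \<and> (\<forall>\<gamma>. \<gamma> \<notin> K \<longrightarrow> loc_le (\<lambda>\<gamma>. \<phi> \<gamma> * \<psi> \<gamma>) \<gamma> e)"
      using K(1) by blast
  qed
qed

lemma in_A_mult:
  assumes "in_A \<phi>" "in_A \<psi>"
  shows "in_A (\<lambda>\<gamma>. \<phi> \<gamma> * \<psi> \<gamma>)" and "An (\<lambda>\<gamma>. \<phi> \<gamma> * \<psi> \<gamma>) \<le> An \<phi> * An \<psi>"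
  using in_A_mult_bdd[OF assms(1) in_A_cont[OF assms(2)] in_A_loc[OF assms(2)]] by auto

lemma loc_le_const: "loc_le (\<lambda>_. a) \<gamma> (cmod a)"
  unfolding loc_le_def
proof
  fix c assume c: "c \<in> unit_ball \<gamma>"
  have "pair c (\<lambda>_. a) = a * pair c (chi 0)" by (simp add: pair_scale[symmetric])
  moreover have "cmod (pair c (chi 0)) \<le> 1" using c by (simp add: unit_ball_def tp_eval_pair)
  ultimately show "cmod (pair c (\<lambda>_. a)) \<le> cmod a"
    using mult_left_mono[of "cmod (pair c (chi 0))" 1 "cmod a"] by (simp add: norm_mult)
qed

lemma in_A_scale:
  assumes "in_A \<phi>"
  shows "in_A (\<lambda>\<gamma>. a * \<phi> \<gamma>)" and "An (\<lambda>\<gamma>. a * \<phi> \<gamma>) = cmod a * An \<phi>"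
proof -
  have s: "in_A (\<lambda>\<gamma>. b * \<psi> \<gamma>) \<and> An (\<lambda>\<gamma>. b * \<psi> \<gamma>) \<le> cmod b * An \<psi>" if "in_A \<psi>" for b \<psi>
    using in_A_mult_bdd[OF that continuous_on_const loc_le_const, of b] by (simp add: mult.commute)
  then show i: "in_A (\<lambda>\<gamma>. a * \<phi> \<gamma>)" using assms by blast
  show "An (\<lambda>\<gamma>. a * \<phi> \<gamma>) = cmod a * An \<phi>"
  proof (cases "a = 0")
    case True
    then show ?thesis using s[OF assms, of a] in_A_nonneg[OF i] by simp
  next
    case False
    have "An (\<lambda>\<gamma>. inverse a * (a * \<phi> \<gamma>)) \<le> cmod (inverse a) * An (\<lambda>\<gamma>. a * \<phi> \<gamma>)" using s[OF i] by blast
    then have "cmod a * An \<phi> \<le> An (\<lambda>\<gamma>. a * \<phi> \<gamma>)"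
      using False by (simp add: mult.assoc[symmetric] norm_inverse norm_divide field_simps)
    then show ?thesis using s[OF assms, of a] by simp
  qed
qed

lemma in_A_diff:
  assumes "in_A \<phi>" "in_A \<psi>" shows "in_A (\<lambda>\<gamma>. \<phi> \<gamma> - \<psi> \<gamma>)"
  using in_A_add(1)[OF assms(1) in_A_scale(1)[OF assms(2), of "-1"]] by simp

lemma in_A_translate:
  assumes "in_A \<phi>"
  shows "in_A (\<lambda>\<gamma>. \<phi> (\<gamma> - \<delta>))" and "An (\<lambda>\<gamma>. \<phi> (\<gamma> - \<delta>)) = An \<phi>"
proof -
  have s: "in_A (\<lambda>\<gamma>. \<psi> (\<gamma> - \<eta>)) \<and> An (\<lambda>\<gamma>. \<psi> (\<gamma> - \<eta>)) \<le> An \<psi>" if \<psi>: "in_A \<psi>" for \<psi> \<eta>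
  proof -
    have l: "loc_le (\<lambda>\<gamma>. \<psi> (\<gamma> - \<eta>)) \<gamma> (An \<psi>)" for \<gamma> by (intro loc_le_translate in_A_loc \<psi>)
    have "in_A (\<lambda>\<gamma>. \<psi> (\<gamma> - \<eta>))"
    proof (rule in_AI[OF _ l])
      show "continuous_on UNIV (\<lambda>\<gamma>. \<psi> (\<gamma> - \<eta>))"
        by (intro continuous_on_compose2[OF in_A_cont[OF \<psi>]] dual_continuous_diff continuous_intros) auto
      fix e :: real assume "0 < e"
      then obtain K where K: "compact K" "\<forall>\<gamma>. \<gamma> \<notin> K \<longrightarrow> loc_le \<psi> \<gamma> e" using in_A_vanish[OF \<psi>] by blast
      have "compact {a + b |a b. a \<in> K \<and> b \<in> {\<eta>}}" by (intro dual_compact_add K) simp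
      moreover have "loc_le (\<lambda>\<gamma>. \<psi> (\<gamma> - \<eta>)) \<gamma> e" if g: "\<gamma> \<notin> {a + b |a b. a \<in> K \<and> b \<in> {\<eta>}}" for \<gamma>
      proof (rule loc_le_translate)
        have "\<gamma> - \<eta> \<notin> K" using g by force
        then show "loc_le \<psi> (\<gamma> - \<eta>) e" using K(2) by blast
      qed
      ultimately show "\<exists>K. compact K \<and> (\<forall>\<gamma>. \<gamma> \<notin> K \<longrightarrow> loc_le (\<lambda>\<gamma>. \<psi> (\<gamma> - \<eta>)) \<gamma> e)" by blast
    qed
    then show ?thesis using An_le[OF l] by blast
  qed
  show i: "in_A (\<lambda>\<gamma>. \<phi> (\<gamma> - \<delta>))" using s[OF assms] by blast
  have "An (\<lambda>\<gamma>. \<phi> (\<gamma> - - \<delta> - \<delta>)) \<le> An (\<lambda>\<gamma>. \<phi> (\<gamma> - \<delta>))" using s[OF i, of "- \<delta>"] by blast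
  then show "An (\<lambda>\<gamma>. \<phi> (\<gamma> - \<delta>)) = An \<phi>" using s[OF assms, of \<delta>] by simp
qed

text \<open>The norm dominates point values, which yields a pointwise limit g. Letting one index
  tend to infinity in the Cauchy condition gives local bounds for f n - g uniform in \<gamma>, and
  from these continuity and decay of g follow.\<close>

lemma in_A_complete:
  assumes f: "\<And>n. in_A (f n)"
    and cau: "\<And>e. 0 < e \<Longrightarrow> \<exists>N. \<forall>m\<ge>N. \<forall>n\<ge>N. An (\<lambda>\<gamma>. f m \<gamma> - f n \<gamma>) < e"
  shows "\<exists>g. in_A g \<and> (\<forall>\<gamma>. (\<lambda>n. f n \<gamma>) \<longlonglongrightarrow> g \<gamma>) \<and> (\<forall>e>0. \<exists>N. \<forall>n\<ge>N. An (\<lambda>\<gamma>. f n \<gamma> - g \<gamma>) < e)"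
proof -
  have "Cauchy (\<lambda>n. f n \<gamma>)" for \<gamma>
  proof (rule metric_CauchyI)
    fix e :: real assume "0 < e"
    then obtain N where N: "\<forall>m\<ge>N. \<forall>n\<ge>N. An (\<lambda>\<gamma>. f m \<gamma> - f n \<gamma>) < e" using cau by blast
    have "dist (f m \<gamma>) (f n \<gamma>) < e" if "m \<ge> N" "n \<ge> N" for m n
      using in_A_point[OF in_A_diff[OF f[of m] f[of n]], of \<gamma>] N that by (force simp: dist_norm)
    then show "\<exists>M. \<forall>m\<ge>M. \<forall>n\<ge>M. dist (f m \<gamma>) (f n \<gamma>) < e" by blast
  qed
  then have "\<forall>\<gamma>. \<exists>l. (\<lambda>n. f n \<gamma>) \<longlonglongrightarrow> l" using Cauchy_convergent convergent_def by blast
  then obtain g where g: "\<And>\<gamma>. (\<lambda>n. f n \<gamma>) \<longlonglongrightarrow> g \<gamma>" by metis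
  have close: "\<exists>N. \<forall>n\<ge>N. \<forall>\<gamma>. loc_le (\<lambda>\<gamma>. f n \<gamma> - g \<gamma>) \<gamma> e" if e: "0 < e" for e
  proof -
    obtain N where N: "\<forall>m\<ge>N. \<forall>n\<ge>N. An (\<lambda>\<gamma>. f m \<gamma> - f n \<gamma>) < e" using cau[OF e] by blast
    have "loc_le (\<lambda>\<gamma>. f n \<gamma> - g \<gamma>) \<gamma> e" if n: "n \<ge> N" for n \<gamma>
    proof (rule loc_le_limit)
      show "(\<lambda>m. f n \<delta> - f m \<delta>) \<longlonglongrightarrow> f n \<delta> - g \<delta>" for \<delta> by (intro tendsto_intros g)
      show "loc_le (\<lambda>\<delta>. f n \<delta> - f m \<delta>) \<gamma> e" if "m \<ge> N" for m
        using loc_le_mono[OF in_A_loc[OF in_A_diff[OF f[of n] f[of m]]], where N = e] N n that by (simp add: less_imp_le)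
    qed
    then show ?thesis by blast
  qed
  obtain N1 where N1: "\<forall>n\<ge>N1. \<forall>\<gamma>. loc_le (\<lambda>\<gamma>. f n \<gamma> - g \<gamma>) \<gamma> 1" using close[of 1] by auto
  have "in_A g"
  proof (rule in_AI)
    show "continuous_on UNIV g"
    proof (rule uniform_limit_theorem)
      show "\<forall>\<^sub>F n in sequentially. continuous_on UNIV (f n)" using in_A_cont[OF f] by simp
      show "uniform_limit UNIV f g sequentially"
        unfolding uniform_limit_iff
      proof (intro allI impI)
        fix e :: real assume "0 < e"
        then have e: "0 < e / 2" by simp
        obtain N where N: "\<forall>n\<ge>N. \<forall>\<gamma>. loc_le (\<lambda>\<gamma>. f n \<gamma> - g \<gamma>) \<gamma> (e / 2)" using close[OF e] by blast
        have "dist (f n \<gamma>) (g \<gamma>) < e" if "n \<ge> N" for n \<gamma>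
          using loc_le_point[OF N[rule_format, OF that] nb_self, of \<gamma>] e by (simp add: dist_norm)
        then show "\<forall>\<^sub>F n in sequentially. \<forall>x\<in>UNIV. dist (f n x) (g x) < e"
          by (auto simp: eventually_sequentially)
      qed
    qed simp
    show "loc_le g \<gamma> (An (f N1) + 1)" for \<gamma>
      using loc_le_diff[OF in_A_loc[OF f[of N1]] N1[rule_format, of N1 \<gamma>]] by simp
    fix e :: real assume "0 < e"
    then have e: "0 < e / 2" by simp
    obtain N where N: "\<forall>n\<ge>N. \<forall>\<gamma>. loc_le (\<lambda>\<gamma>. f n \<gamma> - g \<gamma>) \<gamma> (e / 2)" using close[OF e] by blast
    obtain K where K: "compact K" "\<forall>\<gamma>. \<gamma> \<notin> K \<longrightarrow> loc_le (f N) \<gamma> (e / 2)" using in_A_vanish[OF f e] by blast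
    have "loc_le g \<gamma> e" if "\<gamma> \<notin> K" for \<gamma>
      using loc_le_diff[OF K(2)[rule_format, OF that] N[rule_format, of N \<gamma>]] by simp
    then show "\<exists>K. compact K \<and> (\<forall>\<gamma>. \<gamma> \<notin> K \<longrightarrow> loc_le g \<gamma> e)" using K(1) by blast
  qed
  moreover have "\<exists>N. \<forall>n\<ge>N. An (\<lambda>\<gamma>. f n \<gamma> - g \<gamma>) < e" if "0 < e" for e
  proof -
    have e: "0 < e / 2" using that by simp
    obtain N where N: "\<forall>n\<ge>N. \<forall>\<gamma>. loc_le (\<lambda>\<gamma>. f n \<gamma> - g \<gamma>) \<gamma> (e / 2)" using close[OF e] by blast
    have "An (\<lambda>\<gamma>. f n \<gamma> - g \<gamma>) \<le> e / 2" if "n \<ge> N" for n using N that by (intro An_le) auto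
    then have "\<forall>n\<ge>N. An (\<lambda>\<gamma>. f n \<gamma> - g \<gamma>) < e" using e by force
    then show ?thesis by blast
  qed
  ultimately show ?thesis using g by blast
qed

end

section \<open>Local units\<close>

lemma norm_integral_le:
  fixes f :: "'a \<Rightarrow> 'b::{banach,second_countable_topology}"
  assumes "integrable M f" "integrable M g" "\<And>x. norm (f x) \<le> g x"
  shows "norm (\<integral>x. f x \<partial>M) \<le> (\<integral>x. g x \<partial>M)"
proof -
  have "norm (\<integral>x. f x \<partial>M) \<le> (\<integral>x. norm (f x) \<partial>M)" by (rule integral_norm_bound)
  also have "\<dots> \<le> (\<integral>x. g x \<partial>M)" by (intro integral_mono integrable_norm assms)
  finally show ?thesis .
qed

locale dual_haar = dual_nbhd chi V
  for chi :: "'g::{topological_ab_group_add,t2_space} \<Rightarrow> 'c::{topological_space,ab_group_add} \<Rightarrow> complex"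
    and V :: "'c set" +
  fixes \<mu> :: "'c measure"
  assumes haar: "haar_measure \<mu>"
begin

section \<open>Haar integration on the dual\<close>

lemma sets_mu [measurable_cong]: "sets \<mu> = sets borel" and space_mu [simp]: "space \<mu> = UNIV"
  and emeasure_translate: "A \<in> sets borel \<Longrightarrow> emeasure \<mu> ((\<lambda>x. \<gamma> + x) ` A) = emeasure \<mu> A"
  and emeasure_compact: "compact K \<Longrightarrow> emeasure \<mu> K < \<infinity>"
  and emeasure_open: "open U \<Longrightarrow> U \<noteq> {} \<Longrightarrow> 0 < emeasure \<mu> U"
proof -
  note h = haar[unfolded haar_measure_def]
  show "sets \<mu> = sets borel" "space \<mu> = UNIV" using h by (elim conjE; simp)+
  show "A \<in> sets borel \<Longrightarrow> emeasure \<mu> ((\<lambda>x. \<gamma> + x) ` A) = emeasure \<mu> A" using h by (elim conjE) blast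
  show "compact K \<Longrightarrow> emeasure \<mu> K < \<infinity>" using h by (elim conjE) blast
  show "open U \<Longrightarrow> U \<noteq> {} \<Longrightarrow> 0 < emeasure \<mu> U" using h by (elim conjE) blast
qed

lemma measurable_continuous: "continuous_on UNIV f \<Longrightarrow> (f :: 'c \<Rightarrow> 'b::topological_space) \<in> borel_measurable \<mu>"
  using borel_measurable_continuous_onI measurable_cong_sets[OF sets_mu refl] by blast

lemma measurable_translate: "(\<lambda>x. \<gamma> + x) \<in> measurable \<mu> \<mu>"
  unfolding measurable_cong_sets[OF sets_mu sets_mu]
  by (intro borel_measurable_continuous_onI dual_continuous_add continuous_intros)

lemma distr_translate: "distr \<mu> \<mu> (\<lambda>x. \<gamma> + x) = \<mu>"
proof (rule measure_eqI)
  fix A assume "A \<in> sets (distr \<mu> \<mu> (\<lambda>x. \<gamma> + x))"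
  then have A: "A \<in> sets \<mu>" by simp
  have "(\<lambda>x. \<gamma> + x) -` A \<inter> space \<mu> = (\<lambda>x. - \<gamma> + x) ` A"
  proof (intro equalityI subsetI)
    fix x assume "x \<in> (\<lambda>x. \<gamma> + x) -` A \<inter> space \<mu>"
    then show "x \<in> (\<lambda>x. - \<gamma> + x) ` A" by (intro image_eqI[of _ _ "\<gamma> + x"]) auto
  qed auto
  then have "emeasure (distr \<mu> \<mu> (\<lambda>x. \<gamma> + x)) A = emeasure \<mu> ((\<lambda>x. - \<gamma> + x) ` A)"
    by (simp add: emeasure_distr[OF measurable_translate A])
  then show "emeasure (distr \<mu> \<mu> (\<lambda>x. \<gamma> + x)) A = emeasure \<mu> A"
    using A emeasure_translate[of A "- \<gamma>"] by (simp add: sets_mu)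
qed simp

lemma integral_translate:
  fixes f :: "'c \<Rightarrow> 'b::{banach, second_countable_topology}"
  assumes "f \<in> borel_measurable \<mu>" shows "(\<integral>x. f (\<gamma> + x) \<partial>\<mu>) = (\<integral>x. f x \<partial>\<mu>)"
  using integral_distr[OF measurable_translate assms, of \<gamma>] by (simp add: distr_translate)

lemma nn_integral_translate:
  assumes "f \<in> borel_measurable \<mu>" shows "(\<integral>\<^sup>+x. f (\<gamma> + x) \<partial>\<mu>) = (\<integral>\<^sup>+x. f x \<partial>\<mu>)"
  using nn_integral_distr[OF measurable_translate, of f \<gamma>] assms by (simp add: distr_translate)

lemma compact_sets: "compact K \<Longrightarrow> K \<in> sets \<mu>"
  by (simp add: sets_mu borel_closed dual_compact_closed)

lemma integrable_cpt:
  fixes f :: "'c \<Rightarrow> 'b::{banach, second_countable_topology}"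
  assumes "f \<in> borel_measurable \<mu>" "compact K" "\<And>x. x \<notin> K \<Longrightarrow> f x = 0" "\<And>x. norm (f x) \<le> B"
  shows "integrable \<mu> f"
  by (rule integrableI_bounded_set[of K \<mu> f B]) (use assms compact_sets emeasure_compact in \<open>auto simp: less_top\<close>)

text \<open>A Lipschitz condition for the seminorm given by the supremum over K of |chi x \<gamma> -
  chi x \<gamma>'|. It passes through integrals over translates with an explicit constant; this
  yields continuity of convolutions although the dual need not be first countable, so that
  sequential limit theorems would not suffice.\<close>

definition dlip :: "'g set \<Rightarrow> real \<Rightarrow> ('c \<Rightarrow> real) \<Rightarrow> bool" where
  "dlip K L f \<longleftrightarrow> (\<forall>\<gamma> \<gamma>' r. (\<forall>x\<in>K. cmod (chi x \<gamma> - chi x \<gamma>') \<le> r) \<longrightarrow> 0 \<le> r \<longrightarrow> \<bar>f \<gamma> - f \<gamma>'\<bar> \<le> L * r)"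

lemma dlipD: "dlip K L f \<Longrightarrow> (\<And>x. x \<in> K \<Longrightarrow> cmod (chi x \<gamma> - chi x \<gamma>') \<le> r) \<Longrightarrow> 0 \<le> r \<Longrightarrow> \<bar>f \<gamma> - f \<gamma>'\<bar> \<le> L * r"
  by (simp add: dlip_def)

lemma dlip_continuous:
  assumes K: "compact K" and L: "0 \<le> L" and f: "dlip K L f"
  shows "continuous_on UNIV f"
proof (rule continuous_on_UNIV_nhdI)
  fix \<gamma> and e :: real assume e: "0 < e"
  define r where "r = e / (L + 1)"
  have r: "0 < r" using e L by (simp add: r_def)
  have Lr: "L * r < e" using e L by (simp add: r_def field_simps)
  have "dist (f \<delta>) (f \<gamma>) < e" if "\<delta> \<in> char_nhd K r \<gamma>" for \<delta>
  proof -
    have "\<bar>f \<delta> - f \<gamma>\<bar> \<le> L * r"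
      by (rule dlipD[OF f]) (use that r in \<open>auto simp: char_nhd_def less_imp_le\<close>)
    then show ?thesis using Lr by (simp add: dist_real_def)
  qed
  then show "\<exists>U. open U \<and> \<gamma> \<in> U \<and> (\<forall>y\<in>U. dist (f y) (f \<gamma>) < e)"
    using open_char_nhd[OF K r] char_nhd_self[OF r] by blast
qed

lemma chi_translate_dist: "cmod (chi x (\<gamma> + t) - chi x (\<gamma>' + t)) = cmod (chi x \<gamma> - chi x \<gamma>')"
proof -
  have "chi x (\<gamma> + t) - chi x (\<gamma>' + t) = (chi x \<gamma> - chi x \<gamma>') * chi x t"
    by (simp add: chi_add left_diff_distrib)
  then show ?thesis by (simp add: norm_mult)
qed

lemma dlip_bump:
  obtains f K where "compact K" "dlip K 1 f" "\<And>\<gamma>. 0 \<le> f \<gamma>" "\<And>\<gamma>. \<gamma> \<notin> V \<Longrightarrow> f \<gamma> = 0" "0 < f 0"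
proof -
  obtain K e where K: "compact K" "K \<noteq> {}" "0 < e" "char_nhd K e 0 \<subseteq> V"
    by (rule open_dualE[OF V_open V_0]) blast
  define s where "s \<gamma> = (SUP x\<in>K. cmod (chi x \<gamma> - 1))" for \<gamma>
  have le2: "cmod (chi x \<gamma> - 1) \<le> 2" for x \<gamma>
    using norm_triangle_ineq4[of "chi x \<gamma>" 1] by simp
  have bdd: "bdd_above ((\<lambda>x. cmod (chi x \<gamma> - 1)) ` K)" for \<gamma>
    using le2 by (auto simp: bdd_above_def)
  have up: "cmod (chi x \<gamma> - 1) \<le> s \<gamma>" if "x \<in> K" for x \<gamma>
    unfolding s_def by (rule cSUP_upper[OF that bdd])
  have s_le: "s \<gamma> \<le> s \<gamma>' + r" if "\<And>x. x \<in> K \<Longrightarrow> cmod (chi x \<gamma> - chi x \<gamma>') \<le> r" for \<gamma> \<gamma>' r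
    unfolding s_def[of \<gamma>]
  proof (rule cSUP_least[OF K(2)])
    fix x assume x: "x \<in> K"
    have "cmod (chi x \<gamma> - 1) \<le> cmod (chi x \<gamma> - chi x \<gamma>') + cmod (chi x \<gamma>' - 1)"
      by (metis add_diff_eq diff_add_cancel norm_triangle_ineq)
    then show "cmod (chi x \<gamma> - 1) \<le> s \<gamma>' + r" using that[OF x] up[OF x, of \<gamma>'] by linarith
  qed
  \<comment> \<open>Outside V some x in K has |chi x \<gamma> - 1| \<ge> e, so s \<gamma> \<ge> e
    and f vanishes; at 0 its value is e.\<close>
  define f where "f \<gamma> = max 0 (e - s \<gamma>)" for \<gamma>
  show ?thesis
  proof (rule that[OF K(1)])
    show "dlip K 1 f"
      unfolding dlip_def
    proof (intro allI impI)
      fix \<gamma> \<gamma>' r assume a: "\<forall>x\<in>K. cmod (chi x \<gamma> - chi x \<gamma>') \<le> r"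
      then have "s \<gamma> \<le> s \<gamma>' + r" "s \<gamma>' \<le> s \<gamma> + r"
        by (auto intro!: s_le simp: norm_minus_commute)
      then show "\<bar>f \<gamma> - f \<gamma>'\<bar> \<le> 1 * r" by (simp add: f_def max_def abs_if)
    qed
    show "0 \<le> f \<gamma>" for \<gamma> by (simp add: f_def)
    show "f \<gamma> = 0" if n: "\<gamma> \<notin> V" for \<gamma>
    proof -
      have "\<gamma> \<notin> char_nhd K e 0" using n K(4) by blast
      then obtain x where x: "x \<in> K" "e \<le> cmod (chi x \<gamma> - 1)" by (auto simp: char_nhd_def not_less)
      then show ?thesis using up[OF x(1), of \<gamma>] by (simp add: f_def)
    qed
    have "s 0 = 0" using K(2) by (simp add: s_def)
    then show "0 < f 0" using K(3) by (simp add: f_def)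
  qed
qed

lemma integral_pos:
  fixes g :: "'c \<Rightarrow> real"
  assumes c: "continuous_on UNIV g" and nn: "\<And>x. 0 \<le> g x" and i: "integrable \<mu> g" and p: "0 < g y"
  shows "0 < (\<integral>x. g x \<partial>\<mu>)"
proof -
  define U where "U = {x. 0 < g x}"
  have "open U" unfolding U_def by (intro open_Collect_less c continuous_intros)
  then have U: "0 < emeasure \<mu> U" using p by (intro emeasure_open) (auto simp: U_def)
  have "(\<integral>x. g x \<partial>\<mu>) \<noteq> 0"
  proof
    assume "(\<integral>x. g x \<partial>\<mu>) = 0"
    then have "AE x in \<mu>. g x = 0" using integral_nonneg_eq_0_iff_AE[OF i] nn by auto
    then have "AE x in \<mu>. x \<notin> U" by (auto simp: U_def)
    then have "emeasure \<mu> U = 0"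
      using \<open>open U\<close> by (subst (asm) AE_iff_measurable[of U]) (auto simp: sets_mu)
    then show False using U by simp
  qed
  moreover have "0 \<le> (\<integral>x. g x \<partial>\<mu>)" using nn by (intro integral_nonneg_AE) simp
  ultimately show ?thesis by simp
qed

text \<open>b is the autocorrelation of a bump f supported in V. By translation invariance b (s - t)
  is the inner product of two translates of f, so the quadratic form is the integral of |F|^2; the
  support lies in closure V - closure V.\<close>

lemma pos_def_bump:
  obtains b :: "'c \<Rightarrow> real" and K L S where "compact K" "0 \<le> L" "dlip K L b" "compact S" "\<And>\<gamma>. 0 \<le> b \<gamma>"
    "\<And>\<gamma>. \<gamma> \<notin> S \<Longrightarrow> b \<gamma> = 0" "0 < b 0" "pos_def_fun (\<lambda>\<gamma>. complex_of_real (b \<gamma>))"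
proof -
  obtain f K where K: "compact K" and f: "dlip K 1 f" and f0: "\<And>\<gamma>. 0 \<le> f \<gamma>"
    and fV: "\<And>\<gamma>. \<gamma> \<notin> V \<Longrightarrow> f \<gamma> = 0" and fp: "0 < f 0"
    by (rule dlip_bump) blast
  have fc: "continuous_on UNIV f" by (rule dlip_continuous[OF K _ f]) simp
  have fV': "f \<gamma> = 0" if "\<gamma> \<notin> closure V" for \<gamma> using fV closure_subset that by blast
  obtain B where B: "\<And>\<gamma>. f \<gamma> \<le> B"
  proof -
    have "compact (f ` closure V)" by (intro compact_continuous_image continuous_on_subset[OF fc] V_compact) auto
    then obtain B where B: "\<forall>x\<in>f ` closure V. norm x \<le> B" using compact_imp_bounded bounded_iff by metis
    have "f \<gamma> \<le> max B 0" for \<gamma> using B fV'[of \<gamma>] by (cases "\<gamma> \<in> closure V") fastforce+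
    then show ?thesis using that by blast
  qed
  have B0: "0 \<le> B" using B[of 0] f0[of 0] by linarith
  have ftc: "continuous_on UNIV (\<lambda>t. f (\<gamma> + t))" for \<gamma>
    by (intro continuous_on_compose2[OF fc] dual_continuous_add continuous_intros) auto
  have int0: "integrable \<mu> f"
    by (rule integrable_cpt[OF measurable_continuous[OF fc] V_compact, of B]) (use fV' f0 B in auto)
  have int1: "integrable \<mu> (\<lambda>t. f (\<gamma> + t) * f t)" for \<gamma>
  proof (rule integrable_cpt[OF measurable_continuous V_compact, of _ "B * B"])
    show "continuous_on UNIV (\<lambda>t. f (\<gamma> + t) * f t)" by (intro continuous_intros ftc fc)
    show "norm (f (\<gamma> + t) * f t) \<le> B * B" for t
      using f0 B B0 by (auto simp: abs_mult intro!: mult_mono)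
  qed (use fV' in auto)
  define b where "b \<gamma> = (\<integral>t. f (\<gamma> + t) * f t \<partial>\<mu>)" for \<gamma>
  define L where "L = (\<integral>t. f t \<partial>\<mu>)"
  define S where "S = {x - y |x y. x \<in> closure V \<and> y \<in> closure V}"
  have bst: "b (s - t) = (\<integral>r. f (s + r) * f (t + r) \<partial>\<mu>)" for s t
  proof -
    have "(\<lambda>r. f (s - t + r) * f r) \<in> borel_measurable \<mu>" using int1 by (rule borel_measurable_integrable)
    from integral_translate[OF this, of t] show ?thesis by (simp add: b_def add.assoc[symmetric])
  qed
  have int2: "integrable \<mu> (\<lambda>r. f (s + r) * f (t + r))" for s t
  proof -
    have "integrable (distr \<mu> \<mu> (\<lambda>x. t + x)) (\<lambda>r. f (s - t + r) * f r)"
      using int1[of "s - t"] by (simp add: distr_translate)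
    then have "integrable \<mu> (\<lambda>x. f (s - t + (t + x)) * f (t + x))"
      by (subst (asm) integrable_distr_eq[OF measurable_translate borel_measurable_integrable[OF int1]])
    then show ?thesis by (simp add: add.assoc[symmetric])
  qed
  show ?thesis
  proof (rule that[OF K])
    show L0: "0 \<le> L" unfolding L_def using f0 by (intro integral_nonneg_AE) simp
    show "dlip K L b"
      unfolding dlip_def
    proof (intro allI impI)
      fix \<gamma> \<gamma>' r assume a: "\<forall>x\<in>K. cmod (chi x \<gamma> - chi x \<gamma>') \<le> r" and r: "0 \<le> r"
      have fd: "\<bar>f (\<gamma> + t) - f (\<gamma>' + t)\<bar> \<le> 1 * r" for t
        by (rule dlipD[OF f _ r]) (use a in \<open>simp add: chi_translate_dist\<close>)
      have "b \<gamma> - b \<gamma>' = (\<integral>t. f (\<gamma> + t) * f t - f (\<gamma>' + t) * f t \<partial>\<mu>)"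
        unfolding b_def by (rule Bochner_Integration.integral_diff[symmetric]; rule int1)
      also have "\<bar>\<dots>\<bar> \<le> (\<integral>t. r * f t \<partial>\<mu>)"
        unfolding real_norm_def[symmetric]
      proof (rule norm_integral_le)
        show "integrable \<mu> (\<lambda>t. f (\<gamma> + t) * f t - f (\<gamma>' + t) * f t)"
          by (intro Bochner_Integration.integrable_diff int1)
        show "integrable \<mu> (\<lambda>t. r * f t)" by (intro integrable_mult_right int0)
        show "norm (f (\<gamma> + t) * f t - f (\<gamma>' + t) * f t) \<le> r * f t" for t
          using mult_right_mono[OF fd[of t] f0[of t]] f0[of t]
          by (simp add: left_diff_distrib[symmetric] abs_mult)
      qed
      finally show "\<bar>b \<gamma> - b \<gamma>'\<bar> \<le> L * r" by (simp add: L_def mult.commute)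
    qed
    show "compact S" unfolding S_def by (intro dual_compact_diff V_compact)
    show "0 \<le> b \<gamma>" for \<gamma> unfolding b_def using f0 by (intro integral_nonneg_AE) simp
    show "b \<gamma> = 0" if "\<gamma> \<notin> S" for \<gamma>
    proof -
      have "f (\<gamma> + t) * f t = 0" for t
      proof (rule ccontr)
        assume "f (\<gamma> + t) * f t \<noteq> 0"
        then have "\<gamma> + t \<in> closure V" "t \<in> closure V" using fV' by auto
        moreover have "\<gamma> = (\<gamma> + t) - t" by simp
        ultimately show False using that unfolding S_def by blast
      qed
      then have "(\<lambda>t. f (\<gamma> + t) * f t) = (\<lambda>t. 0)" by blast
      then show ?thesis by (simp add: b_def)
    qed
    have "0 < (\<integral>t. f (0 + t) * f t \<partial>\<mu>)"
      by (rule integral_pos[OF _ _ int1, of 0 0]) (use fp f0 in \<open>auto intro!: continuous_intros fc\<close>)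
    then show "0 < b 0" by (simp add: b_def)
    show "pos_def_fun (\<lambda>\<gamma>. complex_of_real (b \<gamma>))"
      unfolding pos_def_fun_def
    proof (intro allI impI)
      fix A :: "'c set" and a :: "'c \<Rightarrow> complex" assume A: "finite A"
      define F where "F r = (\<Sum>s\<in>A. a s * complex_of_real (f (s + r)))" for r
      have sq: "complex_of_real ((cmod (F r))\<^sup>2)
          = (\<Sum>s\<in>A. \<Sum>t\<in>A. a s * cnj (a t) * complex_of_real (f (s + r) * f (t + r)))" for r
        unfolding complex_norm_square F_def cnj_sum sum_product
        by (intro sum.cong refl) (simp add: mult_ac)
      have int3: "integrable \<mu> (\<lambda>r. a s * cnj (a t) * complex_of_real (f (s + r) * f (t + r)))" for s t
        by (intro integrable_mult_right integrable_of_real int2)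
      have "(\<Sum>s\<in>A. \<Sum>t\<in>A. a s * cnj (a t) * complex_of_real (b (s - t)))
          = (\<integral>r. (\<Sum>s\<in>A. \<Sum>t\<in>A. a s * cnj (a t) * complex_of_real (f (s + r) * f (t + r))) \<partial>\<mu>)"
        by (simp only: Bochner_Integration.integral_sum Bochner_Integration.integrable_sum int3 bst
            integral_mult_right_zero integral_complex_of_real)
      also have "\<dots> = complex_of_real (\<integral>r. (cmod (F r))\<^sup>2 \<partial>\<mu>)"
        unfolding sq[symmetric] by (rule integral_complex_of_real)
      finally show "\<exists>r\<ge>0. (\<Sum>s\<in>A. \<Sum>t\<in>A. a s * cnj (a t) * complex_of_real (b (s - t))) = complex_of_real r"
        by (intro exI[of _ "\<integral>r. (cmod (F r))\<^sup>2 \<partial>\<mu>"]) (auto intro!: integral_nonneg_AE)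
    qed
  qed
qed

lemma pos_def_loc_le:
  assumes "pos_def_fun \<phi>" shows "loc_le \<phi> \<gamma> (Re (\<phi> 0))"
  unfolding loc_le_def
proof
  fix c assume c: "c \<in> unit_ball \<gamma>"
  then have fin: "finite {\<gamma>. c \<gamma> \<noteq> 0}" by (simp add: unit_ball_def span_coeffs_def)
  have "cmod (\<Sum>\<gamma> | c \<gamma> \<noteq> 0. c \<gamma> * \<phi> \<gamma>) \<le> 1 * Re (\<phi> 0)"
    by (rule pos_def_fun_bound[OF assms fin]) (use c in \<open>auto simp: unit_ball_def tp_eval_def\<close>)
  then show "cmod (pair c \<phi>) \<le> Re (\<phi> 0)" by (simp add: pair_def)
qed

text \<open>u is the convolution of the indicator of E = Q - S with b, divided by the total mass
  \<kappa> of b. For \<gamma> in Q, b (\<gamma> - t) can be nonzero only for t in E, hence u = 1 on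
  Q.\<close>

theorem local_units:
  "\<exists>C. \<forall>K. compact K \<longrightarrow> (\<exists>u K'. continuous_on UNIV u \<and> (\<forall>\<gamma>. 0 \<le> u \<gamma> \<and> u \<gamma> \<le> 1) \<and> (\<forall>\<gamma>\<in>K. u \<gamma> = 1)
     \<and> compact K' \<and> (\<forall>\<gamma>. \<gamma> \<notin> K' \<longrightarrow> u \<gamma> = 0) \<and> (\<forall>\<gamma>. loc_le (\<lambda>\<gamma>. complex_of_real (u \<gamma>)) \<gamma> C))"
proof -
  obtain b K L S where K: "compact K" and L: "0 \<le> L" and bl: "dlip K L b" and S: "compact S"
    and b0: "\<And>\<gamma>. 0 \<le> b \<gamma>" and bS: "\<And>\<gamma>. \<gamma> \<notin> S \<Longrightarrow> b \<gamma> = 0" and bp: "0 < b 0"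
    and pd: "pos_def_fun (\<lambda>\<gamma>. complex_of_real (b \<gamma>))"
    by (rule pos_def_bump) blast
  have bc: "continuous_on UNIV b" by (rule dlip_continuous[OF K L bl])
  have lb: "loc_le (\<lambda>\<gamma>. complex_of_real (b \<gamma>)) \<gamma> (b 0)" for \<gamma> using pos_def_loc_le[OF pd] by simp
  have bB: "b \<gamma> \<le> b 0" for \<gamma> using loc_le_point[OF lb nb_self, of \<gamma>] b0[of \<gamma>] by simp
  have btc: "continuous_on UNIV (\<lambda>t. b (\<gamma> - t))" for \<gamma>
    by (intro continuous_on_compose2[OF bc] dual_continuous_diff continuous_intros) auto
  have int: "integrable \<mu> (\<lambda>t. b (\<gamma> - t))" for \<gamma>
  proof (rule integrable_cpt[OF measurable_continuous[OF btc], of "{x - y |x y. x \<in> {\<gamma>} \<and> y \<in> S}" _ "b 0"])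
    show "b (\<gamma> - t) = 0" if t: "t \<notin> {x - y |x y. x \<in> {\<gamma>} \<and> y \<in> S}" for t
    proof (rule bS, rule notI)
      assume "\<gamma> - t \<in> S"
      moreover have "t = \<gamma> - (\<gamma> - t)" by simp
      ultimately show False using t by blast
    qed
    show "compact {x - y |x y. x \<in> {\<gamma>} \<and> y \<in> S}" by (intro dual_compact_diff S) simp
    show "norm (b (\<gamma> - t)) \<le> b 0" for t using b0 bB by simp
  qed
  define \<kappa> where "\<kappa> = (\<integral>t. b (0 - t) \<partial>\<mu>)"
  have \<kappa>: "0 < \<kappa>" unfolding \<kappa>_def by (rule integral_pos[OF btc _ int, of _ 0]) (use b0 bp in auto)
  have \<kappa>eq: "(\<integral>t. b (\<gamma> - t) \<partial>\<mu>) = \<kappa>" for \<gamma>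
    using integral_translate[OF measurable_continuous[OF btc[of \<gamma>]], of \<gamma>] by (simp add: \<kappa>_def)
  define Z where "Z = {x - y |x y. x \<in> closure V \<and> y \<in> S}"
  have Z: "compact Z" unfolding Z_def by (intro dual_compact_diff V_compact S)
  \<comment> \<open>A polynomial with frequencies in the window at \<gamma>0 meets the translate of
    b by t only for t in \<gamma>0 + Z. Each translate has local norm at most b 0, so integration
    over t yields b 0 times the measure of Z, independent of Q.\<close>
  define C where "C = b 0 * measure \<mu> Z / \<kappa>"
  show ?thesis
  proof (intro exI[of _ C] allI impI)
    fix Q :: "'c set" assume Q: "compact Q"
    define E where "E = {x - y |x y. x \<in> Q \<and> y \<in> S}"
    have E: "compact E" unfolding E_def by (intro dual_compact_diff Q S)
    have Em: "E \<in> sets \<mu>" by (rule compact_sets[OF E])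
    define u where "u \<gamma> = (\<integral>t. indicator E t * b (\<gamma> - t) \<partial>\<mu>) / \<kappa>" for \<gamma>
    have intE: "integrable \<mu> (\<lambda>t. indicator E t * b (\<gamma> - t))" for \<gamma>
      using integrable_mult_indicator[OF Em int[of \<gamma>]] by simp
    have fE: "emeasure \<mu> E < \<infinity>" by (rule emeasure_compact[OF E])
    have intI: "integrable \<mu> (indicator E :: 'c \<Rightarrow> real)"
      using Em fE by (simp add: less_top)
    have u0: "0 \<le> u \<gamma>" for \<gamma>
      unfolding u_def using b0 \<kappa> by (intro divide_nonneg_pos integral_nonneg_AE) auto
    have u1: "u \<gamma> \<le> 1" for \<gamma>
    proof -
      have "(\<integral>t. indicator E t * b (\<gamma> - t) \<partial>\<mu>) \<le> (\<integral>t. b (\<gamma> - t) \<partial>\<mu>)"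
        by (intro integral_mono intE int) (use b0 in \<open>auto split: split_indicator\<close>)
      then show ?thesis using \<kappa> by (simp add: u_def \<kappa>eq)
    qed
    have uQ: "u \<gamma> = 1" if "\<gamma> \<in> Q" for \<gamma>
    proof -
      have "indicator E t * b (\<gamma> - t) = b (\<gamma> - t)" for t
      proof (cases "\<gamma> - t \<in> S")
        case True
        have "t = \<gamma> - (\<gamma> - t)" by simp
        then have "t \<in> E" unfolding E_def using that True by blast
        then show ?thesis by simp
      qed (simp add: bS)
      then have "(\<lambda>t. indicator E t * b (\<gamma> - t)) = (\<lambda>t. b (\<gamma> - t))" by blast
      then show ?thesis using \<kappa> by (simp add: u_def \<kappa>eq)
    qed
    have "dlip K (L * measure \<mu> E / \<kappa>) u"
      unfolding dlip_def
    proof (intro allI impI)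
      fix \<gamma> \<gamma>' r assume a: "\<forall>x\<in>K. cmod (chi x \<gamma> - chi x \<gamma>') \<le> r" and r: "0 \<le> r"
      have bd: "\<bar>b (\<gamma> - t) - b (\<gamma>' - t)\<bar> \<le> L * r" for t
        by (rule dlipD[OF bl _ r]) (use a chi_translate_dist[of _ \<gamma> "- t" \<gamma>'] in simp)
      have "u \<gamma> - u \<gamma>' = (\<integral>t. indicator E t * b (\<gamma> - t) - indicator E t * b (\<gamma>' - t) \<partial>\<mu>) / \<kappa>"
        unfolding u_def by (simp add: Bochner_Integration.integral_diff[OF intE intE] diff_divide_distrib)
      moreover have "\<bar>\<integral>t. indicator E t * b (\<gamma> - t) - indicator E t * b (\<gamma>' - t) \<partial>\<mu>\<bar> \<le> (\<integral>t. (L * r) * indicator E t \<partial>\<mu>)"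
        unfolding real_norm_def[symmetric]
      proof (rule norm_integral_le)
        show "integrable \<mu> (\<lambda>t. indicator E t * b (\<gamma> - t) - indicator E t * b (\<gamma>' - t))"
          by (intro Bochner_Integration.integrable_diff intE)
        show "integrable \<mu> (\<lambda>t. (L * r) * indicator E t)" by (intro integrable_mult_right intI)
        show "norm (indicator E t * b (\<gamma> - t) - indicator E t * b (\<gamma>' - t)) \<le> (L * r) * indicator E t" for t
          using bd[of t] by (auto split: split_indicator)
      qed
      moreover have "(\<integral>t. (L * r) * indicator E t \<partial>\<mu>) = (L * r) * measure \<mu> E" using Em fE by simp
      ultimately show "\<bar>u \<gamma> - u \<gamma>'\<bar> \<le> (L * measure \<mu> E / \<kappa>) * r"
        using \<kappa> by (simp add: abs_divide divide_right_mono mult_ac)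
    qed
    then have uc: "continuous_on UNIV u"
      by (rule dlip_continuous[OF K, rotated]) (use L \<kappa> in simp)
    define K' where "K' = {x + y |x y. x \<in> E \<and> y \<in> S}"
    have K': "compact K'" unfolding K'_def by (intro dual_compact_add E S)
    have uK': "u \<gamma> = 0" if "\<gamma> \<notin> K'" for \<gamma>
    proof -
      have "indicator E t * b (\<gamma> - t) = 0" for t
      proof (cases "t \<in> E \<and> \<gamma> - t \<in> S")
        case True
        have "\<gamma> = t + (\<gamma> - t)" by simp
        then show ?thesis using True that unfolding K'_def by blast
      qed (auto simp: bS)
      then have "(\<lambda>t. indicator E t * b (\<gamma> - t)) = (\<lambda>t. 0)" by blast
      then show ?thesis by (simp add: u_def)
    qed
    have "loc_le (\<lambda>\<gamma>. complex_of_real (u \<gamma>)) \<gamma>0 C" for \<gamma>0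
      unfolding loc_le_def
    proof
      fix c assume c: "c \<in> unit_ball \<gamma>0"
      then have sub: "{\<gamma>. c \<gamma> \<noteq> 0} \<subseteq> nb \<gamma>0" by (simp add: unit_ball_def span_coeffs_def)
      define Z0 where "Z0 = (\<lambda>x. \<gamma>0 + x) ` Z"
      have Z0: "Z0 \<in> sets \<mu>" "emeasure \<mu> Z0 = emeasure \<mu> Z"
      proof -
        have "compact Z0"
          unfolding Z0_def by (intro compact_continuous_image Z dual_continuous_add continuous_intros)
        then show "Z0 \<in> sets \<mu>" by (rule compact_sets)
        show "emeasure \<mu> Z0 = emeasure \<mu> Z"
          unfolding Z0_def using compact_sets[OF Z] by (intro emeasure_translate) (simp add: sets_mu)
      qed
      have fZ: "emeasure \<mu> Z0 < \<infinity>" using emeasure_compact[OF Z] Z0(2) by simp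
      define h where "h t = pair c (\<lambda>\<gamma>. complex_of_real (indicator E t * b (\<gamma> - t)))" for t
      have hle: "norm (h t) \<le> b 0 * indicator Z0 t" for t
      proof (cases "t \<in> Z0")
        case True
        have "loc_le (\<lambda>\<gamma>. complex_of_real (b (\<gamma> - t))) \<gamma>0 (b 0)" by (rule loc_le_translate[OF lb])
        then have "cmod (pair c (\<lambda>\<gamma>. complex_of_real (b (\<gamma> - t)))) \<le> b 0" using c by (simp add: loc_le_def)
        moreover have "h t = indicator E t * pair c (\<lambda>\<gamma>. complex_of_real (b (\<gamma> - t)))"
          unfolding h_def pair_scale[symmetric] by (intro pair_cong) (auto split: split_indicator)
        ultimately show ?thesis using True bp by (auto split: split_indicator)
      next
        case False
        have "b (\<gamma> - t) = 0" if c\<gamma>: "c \<gamma> \<noteq> 0" for \<gamma>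
        proof (rule bS, rule notI)
          assume s: "\<gamma> - t \<in> S"
          obtain v where v: "v \<in> closure V" "\<gamma> = v + \<gamma>0" using sub c\<gamma> by blast
          then have "t = \<gamma>0 + (v - (\<gamma> - t))" by (simp add: algebra_simps)
          then show False using False s v(1) unfolding Z0_def Z_def by blast
        qed
        then have "h t = pair c (\<lambda>_. 0)" unfolding h_def by (intro pair_cong) simp
        then show ?thesis using False by (simp add: pair_def)
      qed
      have inth: "integrable \<mu> h"
        unfolding h_def pair_def
        by (intro Bochner_Integration.integrable_sum integrable_mult_right integrable_of_real intE)
      have "pair c (\<lambda>\<gamma>. complex_of_real (u \<gamma>)) = (1 / complex_of_real \<kappa>) * (\<integral>t. h t \<partial>\<mu>)"
      proof -
        have "(\<integral>t. h t \<partial>\<mu>) = pair c (\<lambda>\<gamma>. complex_of_real (\<integral>t. indicator E t * b (\<gamma> - t) \<partial>\<mu>))"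
          unfolding h_def pair_def
          by (subst Bochner_Integration.integral_sum)
            (simp_all only: integrable_mult_right integrable_of_real intE integral_mult_right_zero integral_complex_of_real)
        then show ?thesis unfolding pair_scale[symmetric] u_def
          by (simp add: pair_scale[symmetric])
      qed
      then have "cmod (pair c (\<lambda>\<gamma>. complex_of_real (u \<gamma>))) = cmod (\<integral>t. h t \<partial>\<mu>) / \<kappa>"
        using \<kappa> by (simp add: norm_mult norm_divide)
      moreover have "cmod (\<integral>t. h t \<partial>\<mu>) \<le> (\<integral>t. b 0 * indicator Z0 t \<partial>\<mu>)"
        by (rule norm_integral_le[OF inth _ hle])
          (use Z0 fZ in \<open>auto intro!: integrable_mult_right simp: less_top\<close>)
      moreover have "(\<integral>t. b 0 * indicator Z0 t \<partial>\<mu>) = b 0 * measure \<mu> Z"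
      proof -
        have "measure \<mu> Z0 = measure \<mu> Z" by (simp add: measure_def Z0(2))
        then show ?thesis using Z0(1) fZ by simp
      qed
      ultimately show "cmod (pair c (\<lambda>\<gamma>. complex_of_real (u \<gamma>))) \<le> C"
        using \<kappa> bp by (simp add: C_def divide_right_mono)
    qed
    then show "\<exists>u K'. continuous_on UNIV u \<and> (\<forall>\<gamma>. 0 \<le> u \<gamma> \<and> u \<gamma> \<le> 1) \<and> (\<forall>\<gamma>\<in>Q. u \<gamma> = 1)
       \<and> compact K' \<and> (\<forall>\<gamma>. \<gamma> \<notin> K' \<longrightarrow> u \<gamma> = 0) \<and> (\<forall>\<gamma>. loc_le (\<lambda>\<gamma>. complex_of_real (u \<gamma>)) \<gamma> C)"
      using uc u0 u1 uQ K' uK' by blast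
  qed
qed

end

section \<open>Spaces of p-integrable functions\<close>

text \<open>With an argument equal to 0 the claim follows from s powr p \<le> s on [0, 1]; for
  positive arguments it is convexity.\<close>

lemma powr_convex_combination:
  fixes x y t p :: real
  assumes p: "1 \<le> p" and x: "0 \<le> x" and y: "0 \<le> y" and t: "0 \<le> t" "t \<le> 1"
  shows "(t * x + (1 - t) * y) powr p \<le> t * x powr p + (1 - t) * y powr p"
proof -
  have le1: "s powr p \<le> s" if "0 \<le> s" "s \<le> 1" for s :: real
    using powr_mono'[of 1 p s] p that by simp
  have half: "(s * z) powr p \<le> s * z powr p" if "0 \<le> s" "s \<le> 1" "0 \<le> z" for s z :: real
    using le1[OF that(1,2)] that by (simp add: powr_mult mult_right_mono)
  consider "x = 0" | "y = 0" | "0 < x" "0 < y" using x y by linarith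
  then show ?thesis
  proof cases
    case 1 then show ?thesis using half[of "1 - t" y] t y by simp
  next
    case 2 then show ?thesis using half[of t x] t x by simp
  next
    case 3
    then show ?thesis using convex_onD[OF powr_convex[OF p], of "1 - t" x y] t by simp
  qed
qed

section \<open>Minkowski's inequality and Fatou's lemma for p-integrable functions\<close>

abbreviation Lp_int :: "'a measure \<Rightarrow> real \<Rightarrow> ('a \<Rightarrow> complex) \<Rightarrow> ennreal" where
  "Lp_int M p f \<equiv> (\<integral>\<^sup>+x. ennreal (cmod (f x) powr p) \<partial>M)"

lemma Lp_norm_nonneg: "0 \<le> Lp_norm M p f"
  by (simp add: Lp_norm_def)

lemma Lp_int_eq:
  assumes p: "1 \<le> p" and f: "f \<in> Lp_set M p" shows "Lp_int M p f = ennreal (Lp_norm M p f powr p)"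
proof -
  have "Lp_norm M p f powr p = enn2real (Lp_int M p f)"
    using p by (simp add: Lp_norm_def powr_powr)
  then show ?thesis using f by (simp add: Lp_set_def)
qed

lemma Lp_norm_le:
  assumes p: "1 \<le> p" and f: "f \<in> borel_measurable M" and c: "0 \<le> c" and le: "Lp_int M p f \<le> ennreal (c powr p)"
  shows "f \<in> Lp_set M p" and "Lp_norm M p f \<le> c"
proof -
  show "f \<in> Lp_set M p" using f le by (auto simp: Lp_set_def intro: le_less_trans)
  have "enn2real (Lp_int M p f) \<le> c powr p" using enn2real_mono[OF le] by simp
  then have "Lp_norm M p f \<le> (c powr p) powr (1 / p)"
    unfolding Lp_norm_def using p by (intro powr_mono2) auto
  then show "Lp_norm M p f \<le> c" using p c by (simp add: powr_powr)
qed

lemma Lp_bound: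
  assumes p: "1 \<le> p" and g: "g \<in> Lp_set M p" and f: "f \<in> borel_measurable M" and c: "0 \<le> c"
    and le: "\<And>x. cmod (f x) \<le> c * cmod (g x)"
  shows "f \<in> Lp_set M p" and "Lp_norm M p f \<le> c * Lp_norm M p g"
proof -
  have gm: "g \<in> borel_measurable M" using g by (simp add: Lp_set_def)
  have "Lp_int M p f \<le> (\<integral>\<^sup>+x. ennreal (c powr p) * ennreal (cmod (g x) powr p) \<partial>M)"
  proof (rule nn_integral_mono)
    fix x
    have "cmod (f x) powr p \<le> (c * cmod (g x)) powr p" using p le by (intro powr_mono2) auto
    then show "ennreal (cmod (f x) powr p) \<le> ennreal (c powr p) * ennreal (cmod (g x) powr p)"
      using c by (simp add: powr_mult ennreal_mult[symmetric] ennreal_leI)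
  qed
  also have "\<dots> = ennreal (c powr p) * Lp_int M p g" using gm by (intro nn_integral_cmult) measurable
  also have "\<dots> = ennreal ((c * Lp_norm M p g) powr p)"
    using c Lp_norm_nonneg[of M p g] by (simp add: Lp_int_eq[OF p g] powr_mult ennreal_mult[symmetric])
  finally have "Lp_int M p f \<le> ennreal ((c * Lp_norm M p g) powr p)" .
  from Lp_norm_le[OF p f _ this] show "f \<in> Lp_set M p" "Lp_norm M p f \<le> c * Lp_norm M p g"
    using c Lp_norm_nonneg[of M p g] by auto
qed

lemma Lp_zero: "(\<lambda>_. 0) \<in> Lp_set M p" "Lp_norm M p (\<lambda>_. 0) = 0"
  by (simp_all add: Lp_set_def Lp_norm_def)

lemma Lp_scale:
  assumes p: "1 \<le> p" and f: "f \<in> Lp_set M p"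
  shows "(\<lambda>x. a * f x) \<in> Lp_set M p" and "Lp_norm M p (\<lambda>x. a * f x) = cmod a * Lp_norm M p f"
proof -
  have fm: "f \<in> borel_measurable M" using f by (simp add: Lp_set_def)
  then have m: "(\<lambda>x. a * f x) \<in> borel_measurable M" by measurable
  show i: "(\<lambda>x. a * f x) \<in> Lp_set M p" by (rule Lp_bound(1)[OF p f m, of "cmod a"]) (auto simp: norm_mult)
  have le: "Lp_norm M p (\<lambda>x. a * f x) \<le> cmod a * Lp_norm M p f"
    by (rule Lp_bound(2)[OF p f m]) (auto simp: norm_mult)
  show "Lp_norm M p (\<lambda>x. a * f x) = cmod a * Lp_norm M p f"
  proof (cases "a = 0")
    case True
    then show ?thesis by (simp add: Lp_zero)
  next
    case False
    have "Lp_norm M p f \<le> (1 / cmod a) * Lp_norm M p (\<lambda>x. a * f x)"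
      by (rule Lp_bound(2)[OF p i fm]) (use False in \<open>auto simp: norm_mult\<close>)
    then show ?thesis using le False by (simp add: field_simps)
  qed
qed

text \<open>Minkowski from convexity: |f| + |g| is a + b times the combination of |f| / a and |g| /
  b with weight t = a / (a + b). Taking a and b strictly above the two norms keeps the divisors
  positive; the excess is removed at the end by letting e tend to 0.\<close>

lemma Lp_add:
  assumes p: "1 \<le> p" and f: "f \<in> Lp_set M p" and g: "g \<in> Lp_set M p"
  shows "(\<lambda>x. f x + g x) \<in> Lp_set M p" and "Lp_norm M p (\<lambda>x. f x + g x) \<le> Lp_norm M p f + Lp_norm M p g"
proof -
  have fm: "f \<in> borel_measurable M" and gm: "g \<in> borel_measurable M" using f g by (simp_all add: Lp_set_def)
  then have m: "(\<lambda>x. f x + g x) \<in> borel_measurable M" by measurable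
  have main: "Lp_int M p (\<lambda>x. f x + g x) \<le> ennreal ((a + b) powr p)"
    if a: "Lp_norm M p f < a" and b: "Lp_norm M p g < b" for a b
  proof -
    have a0: "0 < a" and b0: "0 < b" using a b Lp_norm_nonneg[of M p] by (meson le_less_trans)+
    define t where "t = a / (a + b)"
    have t: "0 \<le> t" "t \<le> 1" "1 - t = b / (a + b)" using a0 b0 by (auto simp: t_def field_simps)
    define c where "c = (a + b) powr p * (t / a powr p)"
    define d where "d = (a + b) powr p * ((1 - t) / b powr p)"
    have cd: "0 \<le> c" "0 \<le> d" using t(1,2) a0 b0 by (auto simp: c_def d_def)
    have "Lp_int M p (\<lambda>x. f x + g x) \<le> (\<integral>\<^sup>+x. ennreal c * ennreal (cmod (f x) powr p) + ennreal d * ennreal (cmod (g x) powr p) \<partial>M)"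
    proof (rule nn_integral_mono)
      fix x
      have "cmod (f x + g x) powr p \<le> (cmod (f x) + cmod (g x)) powr p"
        using p by (intro powr_mono2 norm_triangle_ineq) auto
      also have "cmod (f x) + cmod (g x) = (a + b) * (t * (cmod (f x) / a) + (1 - t) * (cmod (g x) / b))"
      proof -
        have e: "(a + b) * t = a" "(a + b) * (1 - t) = b" using a0 b0 unfolding t(3) by (simp_all add: t_def)
        have "(a + b) * (t * (cmod (f x) / a) + (1 - t) * (cmod (g x) / b))
            = ((a + b) * t) * (cmod (f x) / a) + ((a + b) * (1 - t)) * (cmod (g x) / b)"
          by (simp only: distrib_left mult.assoc)
        then show ?thesis using a0 b0 unfolding e by simp
      qed
      also have "\<dots> powr p = (a + b) powr p * (t * (cmod (f x) / a) + (1 - t) * (cmod (g x) / b)) powr p"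
        by (rule powr_mult)
      also have "\<dots> \<le> (a + b) powr p * (t * (cmod (f x) / a) powr p + (1 - t) * (cmod (g x) / b) powr p)"
        by (intro mult_left_mono powr_convex_combination p t) (use a0 b0 in auto)
      also have "\<dots> = c * cmod (f x) powr p + d * cmod (g x) powr p"
        using a0 b0 by (simp add: c_def d_def powr_divide algebra_simps)
      finally show "ennreal (cmod (f x + g x) powr p) \<le> ennreal c * ennreal (cmod (f x) powr p) + ennreal d * ennreal (cmod (g x) powr p)"
        using cd by (simp add: ennreal_mult[symmetric] ennreal_plus[symmetric] ennreal_leI del: ennreal_plus)
    qed
    also have "\<dots> = ennreal c * Lp_int M p f + ennreal d * Lp_int M p g"
      using fm gm by (simp add: nn_integral_add nn_integral_cmult)
    also have "\<dots> = ennreal (c * Lp_norm M p f powr p + d * Lp_norm M p g powr p)"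
      using cd by (simp add: Lp_int_eq[OF p f] Lp_int_eq[OF p g] ennreal_mult[symmetric] ennreal_plus[symmetric] del: ennreal_plus)
    also have "\<dots> \<le> ennreal ((a + b) powr p)"
    proof (rule ennreal_leI)
      have "Lp_norm M p f powr p \<le> a powr p" "Lp_norm M p g powr p \<le> b powr p"
        using p a b Lp_norm_nonneg by (auto intro!: powr_mono2)
      then have "c * Lp_norm M p f powr p + d * Lp_norm M p g powr p \<le> c * a powr p + d * b powr p"
        using cd by (intro add_mono mult_left_mono) auto
      also have "\<dots> = (a + b) powr p * (t + (1 - t))"
        using a0 b0 by (simp add: c_def d_def) (simp add: algebra_simps)
      finally show "c * Lp_norm M p f powr p + d * Lp_norm M p g powr p \<le> (a + b) powr p" by simp
    qed
    finally show ?thesis .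
  qed
  have le: "(\<lambda>x. f x + g x) \<in> Lp_set M p \<and> Lp_norm M p (\<lambda>x. f x + g x) \<le> (Lp_norm M p f + Lp_norm M p g) + e"
    if e: "0 < e" for e
  proof -
    have "Lp_norm M p f < Lp_norm M p f + e / 2" "Lp_norm M p g < Lp_norm M p g + e / 2" using e by auto
    from main[OF this] have "Lp_int M p (\<lambda>x. f x + g x) \<le> ennreal ((Lp_norm M p f + Lp_norm M p g + e) powr p)"
      by (simp add: algebra_simps)
    from Lp_norm_le[OF p m _ this] show ?thesis using e Lp_norm_nonneg[of M p f] Lp_norm_nonneg[of M p g] by simp
  qed
  show "(\<lambda>x. f x + g x) \<in> Lp_set M p" using le[of 1] by simp
  show "Lp_norm M p (\<lambda>x. f x + g x) \<le> Lp_norm M p f + Lp_norm M p g"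
    by (rule field_le_epsilon) (use le in blast)
qed

lemma Lp_diff:
  assumes p: "1 \<le> p" and f: "f \<in> Lp_set M p" and g: "g \<in> Lp_set M p"
  shows "(\<lambda>x. f x - g x) \<in> Lp_set M p"
  using Lp_add(1)[OF p f Lp_scale(1)[OF p g, of "-1"]] by simp

text \<open>Fatou's lemma; the index is shifted by N so that the bound holds for every term of the
  sequence.\<close>

lemma Lp_limit:
  assumes p: "1 \<le> p" and f: "\<And>n. n \<ge> N \<Longrightarrow> f n \<in> Lp_set M p \<and> Lp_norm M p (f n) \<le> c"
    and g: "g \<in> borel_measurable M" and lim: "\<And>x. (\<lambda>n. f n x) \<longlonglongrightarrow> g x"
  shows "g \<in> Lp_set M p" and "Lp_norm M p g \<le> c"
proof -
  have c0: "0 \<le> c" using f[of N] Lp_norm_nonneg[of M p "f N"] by auto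
  have fm: "f (n + N) \<in> borel_measurable M" for n using f[of "n + N"] by (simp add: Lp_set_def)
  have lim': "(\<lambda>n. f (n + N) x) \<longlonglongrightarrow> g x" for x using lim by (rule LIMSEQ_ignore_initial_segment)
  have pt: "ennreal (cmod (g x) powr p) = liminf (\<lambda>n. ennreal (cmod (f (n + N) x) powr p))" for x
  proof -
    have "(\<lambda>n. cmod (f (n + N) x) powr p) \<longlonglongrightarrow> cmod (g x) powr p"
      using p by (intro tendsto_powr' tendsto_norm lim' tendsto_const) auto
    then have "(\<lambda>n. ennreal (cmod (f (n + N) x) powr p)) \<longlonglongrightarrow> ennreal (cmod (g x) powr p)"
      by (intro tendsto_ennrealI)
    then show ?thesis by (intro lim_imp_Liminf[symmetric]) auto
  qed
  have "Lp_int M p g = (\<integral>\<^sup>+x. liminf (\<lambda>n. ennreal (cmod (f (n + N) x) powr p)) \<partial>M)" by (simp add: pt)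
  also have "\<dots> \<le> liminf (\<lambda>n. Lp_int M p (f (n + N)))"
    by (rule nn_integral_liminf) (use fm in measurable)
  also have "\<dots> \<le> ennreal (c powr p)"
  proof -
    have "Lp_int M p (f (n + N)) \<le> ennreal (c powr p)" for n
      using f[of "n + N"] p Lp_norm_nonneg by (auto simp: Lp_int_eq intro!: ennreal_leI powr_mono2)
    then have "liminf (\<lambda>n. Lp_int M p (f (n + N))) \<le> liminf (\<lambda>n. ennreal (c powr p))"
      by (intro Liminf_mono always_eventually) auto
    then show ?thesis by (simp add: Liminf_const)
  qed
  finally have "Lp_int M p g \<le> ennreal (c powr p)" .
  from Lp_norm_le[OF p g c0 this] show "g \<in> Lp_set M p" "Lp_norm M p g \<le> c" by auto
qed

section \<open>The Segal algebra\<close>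

context dual_haar
begin

section \<open>Norms, approximate units and the Segal axioms\<close>

lemma Ap_iff: "\<psi> \<in> Ap_set chi (closure V) \<mu> p \<longleftrightarrow> in_A \<psi> \<and> \<psi> \<in> Lp_set \<mu> p"
  by (simp add: Ap_set_def Aalg_iff)

lemma Ap_measurable: "in_A \<psi> \<Longrightarrow> \<psi> \<in> borel_measurable \<mu>"
  by (rule measurable_continuous[OF in_A_cont])

lemma Lp_cpt:
  assumes p: "1 \<le> p" and c: "continuous_on UNIV \<psi>" and K: "compact K" "\<And>\<gamma>. \<gamma> \<notin> K \<Longrightarrow> \<psi> \<gamma> = 0"
    and B: "\<And>\<gamma>. cmod (\<psi> \<gamma>) \<le> B"
  shows "\<psi> \<in> Lp_set \<mu> p"
proof -
  have B0: "0 \<le> B" using B norm_ge_zero order_trans by blast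
  have "Lp_int \<mu> p \<psi> \<le> (\<integral>\<^sup>+x. ennreal (B powr p) * indicator K x \<partial>\<mu>)"
    using K(2) B p by (intro nn_integral_mono) (auto split: split_indicator intro!: ennreal_leI powr_mono2)
  also have "\<dots> = ennreal (B powr p) * emeasure \<mu> K"
    by (rule nn_integral_cmult_indicator[OF compact_sets[OF K(1)]])
  also have "\<dots> < \<infinity>" using emeasure_compact[OF K(1)] by (simp add: ennreal_mult_less_top)
  finally show ?thesis using measurable_continuous[OF c] by (simp add: Lp_set_def)
qed

lemma Lp_translate:
  assumes f: "f \<in> borel_measurable \<mu>"
  shows "Lp_int \<mu> p (\<lambda>\<gamma>. f (\<gamma> - \<delta>)) = Lp_int \<mu> p f"
proof -
  have "(\<lambda>\<gamma>. ennreal (cmod (f \<gamma>) powr p)) \<in> borel_measurable \<mu>" using f by measurable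
  from nn_integral_translate[OF this, of "- \<delta>"] show ?thesis by simp
qed

text \<open>The dual need not be \<sigma>-compact, so the compact set is taken from \<phi> itself:
  the set where |\<phi>| \<ge> 1 / (n + 1) is compact because point values vanish at infinity
  together with the local norms, and the integral over its complement tends to 0 by dominated
  convergence.\<close>

lemma Lp_tail:
  assumes p: "1 \<le> p" and \<phi>: "in_A \<phi>" "\<phi> \<in> Lp_set \<mu> p" and e: "0 < e"
  obtains K where "compact K" "\<And>u. continuous_on UNIV u \<Longrightarrow> (\<And>\<gamma>. 0 \<le> u \<gamma> \<and> u \<gamma> \<le> 1) \<Longrightarrow> (\<And>\<gamma>. \<gamma> \<in> K \<Longrightarrow> u \<gamma> = (1::real))
    \<Longrightarrow> Lp_norm \<mu> p (\<lambda>\<gamma>. \<phi> \<gamma> - complex_of_real (u \<gamma>) * \<phi> \<gamma>) \<le> e"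
proof -
  have m: "\<phi> \<in> borel_measurable \<mu>" using \<phi> by (simp add: Lp_set_def)
  have cn: "continuous_on UNIV (\<lambda>\<gamma>. cmod (\<phi> \<gamma>))" by (intro continuous_intros in_A_cont \<phi>)
  define A where "A n = {\<gamma>. cmod (\<phi> \<gamma>) < 1 / real (Suc n)}" for n
  have oA: "open (A n)" for n unfolding A_def by (intro open_Collect_less cn continuous_intros)
  have Am: "A n \<in> sets \<mu>" for n using oA by (simp add: sets_mu)
  have lim: "(\<lambda>n. \<integral>\<^sup>+\<gamma>. ennreal (cmod (\<phi> \<gamma>) powr p) * indicator (A n) \<gamma> \<partial>\<mu>) \<longlonglongrightarrow> (\<integral>\<^sup>+\<gamma>. 0 \<partial>\<mu>)"
  proof (rule nn_integral_dominated_convergence[where w = "\<lambda>\<gamma>. ennreal (cmod (\<phi> \<gamma>) powr p)"])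
    show "(\<lambda>\<gamma>. ennreal (cmod (\<phi> \<gamma>) powr p) * indicator (A n) \<gamma>) \<in> borel_measurable \<mu>" for n
      using m Am by measurable
    show "(\<lambda>\<gamma>. ennreal (cmod (\<phi> \<gamma>) powr p)) \<in> borel_measurable \<mu>" using m by measurable
    show "Lp_int \<mu> p \<phi> < \<infinity>" using \<phi> by (simp add: Lp_set_def)
    show "AE \<gamma> in \<mu>. ennreal (cmod (\<phi> \<gamma>) powr p) * indicator (A n) \<gamma> \<le> ennreal (cmod (\<phi> \<gamma>) powr p)" for n
      by (auto split: split_indicator)
    have "(\<lambda>n. ennreal (cmod (\<phi> \<gamma>) powr p) * indicator (A n) \<gamma>) \<longlonglongrightarrow> 0" for \<gamma>
    proof (cases "\<phi> \<gamma> = 0")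
      case True then show ?thesis by simp
    next
      case False
      then obtain N where N: "inverse (real (Suc N)) < cmod (\<phi> \<gamma>)"
        using reals_Archimedean[of "cmod (\<phi> \<gamma>)"] by auto
      have "\<gamma> \<notin> A n" if "n \<ge> N" for n
      proof -
        have "1 / real (Suc n) \<le> inverse (real (Suc N))" using that by (simp add: field_simps)
        then show ?thesis using N by (simp add: A_def)
      qed
      then have "\<forall>\<^sub>F n in sequentially. ennreal (cmod (\<phi> \<gamma>) powr p) * indicator (A n) \<gamma> = 0"
        by (auto simp: eventually_sequentially intro!: exI[of _ N])
      then show ?thesis by (rule tendsto_eventually)
    qed
    then show "AE \<gamma> in \<mu>. (\<lambda>n. ennreal (cmod (\<phi> \<gamma>) powr p) * indicator (A n) \<gamma>) \<longlonglongrightarrow> 0" by simp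
  qed simp
  have "0 < ennreal (e powr p)" using e by simp
  then have "\<forall>\<^sub>F n in sequentially. (\<integral>\<^sup>+\<gamma>. ennreal (cmod (\<phi> \<gamma>) powr p) * indicator (A n) \<gamma> \<partial>\<mu>) < ennreal (e powr p)"
    using lim by (intro order_tendstoD(2)[of _ 0]) simp_all
  then obtain n where n: "(\<integral>\<^sup>+\<gamma>. ennreal (cmod (\<phi> \<gamma>) powr p) * indicator (A n) \<gamma> \<partial>\<mu>) < ennreal (e powr p)"
    by (auto simp: eventually_sequentially)
  define K where "K = - A n"
  have "compact K"
  proof -
    have "0 < 1 / real (Suc n) / 2" by simp
    then obtain L where L: "compact L" "\<And>\<gamma>. \<gamma> \<notin> L \<Longrightarrow> loc_le \<phi> \<gamma> (1 / real (Suc n) / 2)"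
      using in_A_vanish[OF \<phi>(1)] by blast
    have "K \<subseteq> L"
    proof
      fix \<gamma> assume g: "\<gamma> \<in> K"
      show "\<gamma> \<in> L"
      proof (rule ccontr)
        assume "\<gamma> \<notin> L"
        then have "cmod (\<phi> \<gamma>) \<le> 1 / real (Suc n) / 2" using loc_le_point[OF L(2) nb_self] by blast
        moreover have "1 / real (Suc n) / 2 < 1 / real (Suc n)" by (simp add: field_simps)
        ultimately show False using g by (simp add: K_def A_def)
      qed
    qed
    moreover have "closed K" using oA by (simp add: K_def closed_Compl)
    ultimately show ?thesis using dual_compact_Int_closed[OF L(1)] by blast
  qed
  moreover have "Lp_norm \<mu> p (\<lambda>\<gamma>. \<phi> \<gamma> - complex_of_real (u \<gamma>) * \<phi> \<gamma>) \<le> e"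
    if u: "continuous_on UNIV u" "\<And>\<gamma>. 0 \<le> u \<gamma> \<and> u \<gamma> \<le> 1" "\<And>\<gamma>. \<gamma> \<in> K \<Longrightarrow> u \<gamma> = (1::real)" for u
  proof (rule Lp_norm_le(2)[OF p])
    show "(\<lambda>\<gamma>. \<phi> \<gamma> - complex_of_real (u \<gamma>) * \<phi> \<gamma>) \<in> borel_measurable \<mu>"
      by (intro measurable_continuous continuous_intros in_A_cont \<phi> u)
    have "Lp_int \<mu> p (\<lambda>\<gamma>. \<phi> \<gamma> - complex_of_real (u \<gamma>) * \<phi> \<gamma>)
        \<le> (\<integral>\<^sup>+\<gamma>. ennreal (cmod (\<phi> \<gamma>) powr p) * indicator (A n) \<gamma> \<partial>\<mu>)"
    proof (rule nn_integral_mono)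
      fix \<gamma>
      have eq: "\<phi> \<gamma> - complex_of_real (u \<gamma>) * \<phi> \<gamma> = complex_of_real (1 - u \<gamma>) * \<phi> \<gamma>" by (simp add: algebra_simps)
      show "ennreal (cmod (\<phi> \<gamma> - complex_of_real (u \<gamma>) * \<phi> \<gamma>) powr p) \<le> ennreal (cmod (\<phi> \<gamma>) powr p) * indicator (A n) \<gamma>"
      proof (cases "\<gamma> \<in> K")
        case True
        then show ?thesis by (simp add: u(3))
      next
        case False
        have "cmod (\<phi> \<gamma> - complex_of_real (u \<gamma>) * \<phi> \<gamma>) \<le> cmod (\<phi> \<gamma>)"
          unfolding eq norm_mult norm_of_real using u(2)[of \<gamma>] by (intro mult_left_le_one_le) auto
        then show ?thesis using False p by (auto simp: K_def intro!: ennreal_leI powr_mono2)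
      qed
    qed
    also note n
    finally show "Lp_int \<mu> p (\<lambda>\<gamma>. \<phi> \<gamma> - complex_of_real (u \<gamma>) * \<phi> \<gamma>) \<le> ennreal (e powr p)" by simp
  qed (use e in simp)
  ultimately show ?thesis by (rule that)
qed

text \<open>With u = 1 on closure V + K the error vanishes on the whole window at each \<gamma> in
  K; off K it is at most e1 * (1 + C0), which is e because C0 does not depend on K. The extra set Q
  lets u also be prescribed where the L^p norm requires it.\<close>

lemma compact_approx_unit:
  obtains C where "0 \<le> C"
    "\<And>\<phi> e Q. in_A \<phi> \<Longrightarrow> 0 < e \<Longrightarrow> compact Q \<Longrightarrow>
      \<exists>u K'. continuous_on UNIV u \<and> (\<forall>\<gamma>. 0 \<le> u \<gamma> \<and> u \<gamma> \<le> 1) \<and> (\<forall>\<gamma>\<in>Q. u \<gamma> = (1::real)) \<and> compact K' \<and>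
        (\<forall>\<gamma>. \<gamma> \<notin> K' \<longrightarrow> u \<gamma> = 0) \<and> (\<forall>\<gamma>. loc_le (\<lambda>\<gamma>. complex_of_real (u \<gamma>)) \<gamma> C) \<and>
        An (\<lambda>\<gamma>. \<phi> \<gamma> - complex_of_real (u \<gamma>) * \<phi> \<gamma>) \<le> e"
proof -
  obtain C0 where C0: "\<And>K. compact K \<Longrightarrow> \<exists>u K'. continuous_on UNIV u \<and> (\<forall>\<gamma>. 0 \<le> u \<gamma> \<and> u \<gamma> \<le> 1)
     \<and> (\<forall>\<gamma>\<in>K. u \<gamma> = (1::real)) \<and> compact K' \<and> (\<forall>\<gamma>. \<gamma> \<notin> K' \<longrightarrow> u \<gamma> = 0)
     \<and> (\<forall>\<gamma>. loc_le (\<lambda>\<gamma>. complex_of_real (u \<gamma>)) \<gamma> C0)"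
    using local_units by blast
  have C0nn: "0 \<le> C0" using C0[OF compact_empty] loc_le_nonneg by blast
  show ?thesis
  proof (rule that[OF C0nn])
    fix \<phi> and e :: real and Q :: "'c set" assume \<phi>: "in_A \<phi>" and e: "0 < e" and Q: "compact Q"
    define e1 where "e1 = e / (1 + C0)"
    have e1: "0 < e1" "e1 * (1 + C0) = e" using e C0nn by (simp_all add: e1_def)
    obtain K where K: "compact K" "\<And>\<gamma>. \<gamma> \<notin> K \<Longrightarrow> loc_le \<phi> \<gamma> e1" using in_A_vanish[OF \<phi> e1(1)] by blast
    define W where "W = Q \<union> {a + b |a b. a \<in> closure V \<and> b \<in> K}"
    have W: "compact W" unfolding W_def by (intro compact_Un Q dual_compact_add V_compact K)
    obtain u K' where u: "continuous_on UNIV u" "\<And>\<gamma>. 0 \<le> u \<gamma> \<and> u \<gamma> \<le> 1" "\<And>\<gamma>. \<gamma> \<in> W \<Longrightarrow> u \<gamma> = (1::real)"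
      "compact K'" "\<And>\<gamma>. \<gamma> \<notin> K' \<Longrightarrow> u \<gamma> = 0" "\<And>\<gamma>. loc_le (\<lambda>\<gamma>. complex_of_real (u \<gamma>)) \<gamma> C0"
      using C0[OF W] by blast
    have eq: "(\<lambda>\<gamma>. \<phi> \<gamma> - complex_of_real (u \<gamma>) * \<phi> \<gamma>) = (\<lambda>\<gamma>. \<phi> \<gamma> * (1 - complex_of_real (u \<gamma>)))"
      by (simp add: algebra_simps)
    have "loc_le (\<lambda>\<gamma>. \<phi> \<gamma> - complex_of_real (u \<gamma>) * \<phi> \<gamma>) \<gamma> e" for \<gamma>
    proof (cases "\<gamma> \<in> K")
      case True
      have "\<phi> \<delta> - complex_of_real (u \<delta>) * \<phi> \<delta> = 0" if "\<delta> \<in> nb \<gamma>" for \<delta>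
        using u(3)[of \<delta>] that True by (auto simp: W_def)
      then show ?thesis using e by (intro loc_le_vanish) auto
    next
      case False
      have "loc_le (\<lambda>\<gamma>. \<phi> \<gamma> * (1 - complex_of_real (u \<gamma>))) \<gamma> (e1 * (cmod 1 + C0))"
        by (intro loc_le_mult K(2) False loc_le_diff loc_le_const u(6))
      then show ?thesis unfolding eq using e1(2) by simp
    qed
    then have "An (\<lambda>\<gamma>. \<phi> \<gamma> - complex_of_real (u \<gamma>) * \<phi> \<gamma>) \<le> e" by (rule An_le)
    moreover have "\<forall>\<gamma>\<in>Q. u \<gamma> = 1" using u(3) by (simp add: W_def)
    ultimately show "\<exists>u K'. continuous_on UNIV u \<and> (\<forall>\<gamma>. 0 \<le> u \<gamma> \<and> u \<gamma> \<le> 1) \<and> (\<forall>\<gamma>\<in>Q. u \<gamma> = (1::real)) \<and> compact K' \<and>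
        (\<forall>\<gamma>. \<gamma> \<notin> K' \<longrightarrow> u \<gamma> = 0) \<and> (\<forall>\<gamma>. loc_le (\<lambda>\<gamma>. complex_of_real (u \<gamma>)) \<gamma> C0) \<and>
        An (\<lambda>\<gamma>. \<phi> \<gamma> - complex_of_real (u \<gamma>) * \<phi> \<gamma>) \<le> e"
      using u by blast
  qed
qed

abbreviation Apn :: "real \<Rightarrow> ('c \<Rightarrow> complex) \<Rightarrow> real" where
  "Apn p \<equiv> Ap_norm chi (closure V) \<mu> p"

lemma Ap_unit_in:
  assumes p: "1 \<le> p" and u: "continuous_on UNIV u" "\<And>\<gamma>. 0 \<le> u \<gamma> \<and> u \<gamma> \<le> (1::real)"
    "compact K'" "\<And>\<gamma>. \<gamma> \<notin> K' \<Longrightarrow> u \<gamma> = 0" "\<And>\<gamma>. loc_le (\<lambda>\<gamma>. complex_of_real (u \<gamma>)) \<gamma> C"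
  shows "in_A (\<lambda>\<gamma>. complex_of_real (u \<gamma>))" "(\<lambda>\<gamma>. complex_of_real (u \<gamma>)) \<in> Lp_set \<mu> p"
proof -
  have c: "continuous_on UNIV (\<lambda>\<gamma>. complex_of_real (u \<gamma>))" by (intro continuous_intros u)
  show "in_A (\<lambda>\<gamma>. complex_of_real (u \<gamma>))" by (rule in_A_cpt[OF c u(5) u(3)]) (simp add: u(4))
  show "(\<lambda>\<gamma>. complex_of_real (u \<gamma>)) \<in> Lp_set \<mu> p"
    by (rule Lp_cpt[OF p c u(3), of 1]) (use u(2,4) in auto)
qed

lemma Lp_mult_A:
  assumes p: "1 \<le> p" and "\<phi> \<in> Lp_set \<mu> p" "in_A \<phi>" "in_A \<psi>"
  shows "(\<lambda>\<gamma>. \<phi> \<gamma> * \<psi> \<gamma>) \<in> Lp_set \<mu> p" "Lp_norm \<mu> p (\<lambda>\<gamma>. \<phi> \<gamma> * \<psi> \<gamma>) \<le> An \<psi> * Lp_norm \<mu> p \<phi>"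
proof -
  have m: "(\<lambda>\<gamma>. \<phi> \<gamma> * \<psi> \<gamma>) \<in> borel_measurable \<mu>" by (rule Ap_measurable[OF in_A_mult(1)[OF assms(3,4)]])
  have le: "cmod (\<phi> \<gamma> * \<psi> \<gamma>) \<le> An \<psi> * cmod (\<phi> \<gamma>)" for \<gamma>
    using mult_left_mono[OF in_A_point[OF assms(4), of \<gamma>], of "cmod (\<phi> \<gamma>)"] by (simp add: norm_mult mult.commute)
  show "(\<lambda>\<gamma>. \<phi> \<gamma> * \<psi> \<gamma>) \<in> Lp_set \<mu> p" "Lp_norm \<mu> p (\<lambda>\<gamma>. \<phi> \<gamma> * \<psi> \<gamma>) \<le> An \<psi> * Lp_norm \<mu> p \<phi>"
    using Lp_bound[OF p assms(2) m in_A_nonneg[OF assms(4)] le] by auto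
qed

text \<open>The limit is found in the algebra and is a pointwise limit, so Fatou's lemma shows L^p
  convergence to the very same function; functions are never identified almost everywhere.
  Definiteness of the norm comes from its domination of point values.\<close>

lemma Ap_banach:
  assumes p: "1 \<le> p"
  shows "banach_fun_space (Ap_set chi (closure V) \<mu> p) (Apn p)"
  unfolding banach_fun_space_def
proof (intro conjI ballI allI impI)
  let ?A = "Ap_set chi (closure V) \<mu> p"
  show "(\<lambda>_. 0) \<in> ?A" by (simp add: Ap_iff in_A_0 Lp_zero)
  show "(\<lambda>\<gamma>. \<phi> \<gamma> + \<psi> \<gamma>) \<in> ?A" if "\<phi> \<in> ?A" "\<psi> \<in> ?A" for \<phi> \<psi>
    using that by (auto simp: Ap_iff intro: in_A_add Lp_add[OF p])
  show "(\<lambda>\<gamma>. a * \<phi> \<gamma>) \<in> ?A" if "\<phi> \<in> ?A" for \<phi> a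
    using that by (auto simp: Ap_iff intro: in_A_scale Lp_scale[OF p])
  show nn: "0 \<le> Apn p \<phi>" if "\<phi> \<in> ?A" for \<phi>
    using that by (auto simp: Ap_iff Ap_norm_def intro!: add_nonneg_nonneg in_A_nonneg Lp_norm_nonneg)
  show "(Apn p \<phi> = 0) = (\<phi> = (\<lambda>_. 0))" if a: "\<phi> \<in> ?A" for \<phi>
  proof
    assume "Apn p \<phi> = 0"
    then have "An \<phi> \<le> 0" using Lp_norm_nonneg[of \<mu> p \<phi>] by (simp add: Ap_norm_def)
    moreover have "cmod (\<phi> \<gamma>) \<le> An \<phi>" for \<gamma> using a by (simp add: Ap_iff in_A_point)
    ultimately have "cmod (\<phi> \<gamma>) \<le> 0" for \<gamma> using order_trans by blast
    then show "\<phi> = (\<lambda>_. 0)" by auto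
  next
    assume z: "\<phi> = (\<lambda>_. 0)"
    have "An (\<lambda>_. 0) \<le> 0" by (intro An_le loc_le_zero) simp
    then show "Apn p \<phi> = 0" using in_A_nonneg[OF in_A_0] by (simp add: z Ap_norm_def Lp_zero)
  qed
  show "Apn p (\<lambda>\<gamma>. a * \<phi> \<gamma>) = cmod a * Apn p \<phi>" if "\<phi> \<in> ?A" for \<phi> a
    using that by (simp add: Ap_iff Ap_norm_def in_A_scale Lp_scale[OF p] distrib_left)
  show "Apn p (\<lambda>\<gamma>. \<phi> \<gamma> + \<psi> \<gamma>) \<le> Apn p \<phi> + Apn p \<psi>" if "\<phi> \<in> ?A" "\<psi> \<in> ?A" for \<phi> \<psi>
  proof -
    have "An (\<lambda>\<gamma>. \<phi> \<gamma> + \<psi> \<gamma>) \<le> An \<phi> + An \<psi>" using that by (intro in_A_add) (auto simp: Ap_iff)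
    moreover have "Lp_norm \<mu> p (\<lambda>\<gamma>. \<phi> \<gamma> + \<psi> \<gamma>) \<le> Lp_norm \<mu> p \<phi> + Lp_norm \<mu> p \<psi>"
      using that by (intro Lp_add[OF p]) (auto simp: Ap_iff)
    ultimately show ?thesis by (simp add: Ap_norm_def)
  qed
  fix f :: "nat \<Rightarrow> 'c \<Rightarrow> complex"
  assume "(\<forall>n. f n \<in> ?A) \<and> (\<forall>e>0. \<exists>N. \<forall>m\<ge>N. \<forall>n\<ge>N. Apn p (\<lambda>\<gamma>. f m \<gamma> - f n \<gamma>) < e)"
  then have fA: "in_A (f n)" and fL: "f n \<in> Lp_set \<mu> p"
    and cau: "\<And>e. 0 < e \<Longrightarrow> \<exists>N. \<forall>m\<ge>N. \<forall>n\<ge>N. Apn p (\<lambda>\<gamma>. f m \<gamma> - f n \<gamma>) < e" for n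
    by (auto simp: Ap_iff)
  have cauA: "\<exists>N. \<forall>m\<ge>N. \<forall>n\<ge>N. An (\<lambda>\<gamma>. f m \<gamma> - f n \<gamma>) < e" if e: "0 < e" for e
  proof -
    obtain N where N: "\<forall>m\<ge>N. \<forall>n\<ge>N. Apn p (\<lambda>\<gamma>. f m \<gamma> - f n \<gamma>) < e" using cau[OF e] by blast
    have "An (\<lambda>\<gamma>. f m \<gamma> - f n \<gamma>) < e" if "m \<ge> N" "n \<ge> N" for m n
      using N that Lp_norm_nonneg[of \<mu> p "\<lambda>\<gamma>. f m \<gamma> - f n \<gamma>"] by (force simp: Ap_norm_def)
    then show ?thesis by blast
  qed
  obtain g where g: "in_A g" "\<And>\<gamma>. (\<lambda>n. f n \<gamma>) \<longlonglongrightarrow> g \<gamma>"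
    "\<And>e. 0 < e \<Longrightarrow> \<exists>N. \<forall>n\<ge>N. An (\<lambda>\<gamma>. f n \<gamma> - g \<gamma>) < e"
    using in_A_complete[OF fA cauA] by blast
  have Lclose: "\<exists>N. \<forall>n\<ge>N. (\<lambda>\<gamma>. f n \<gamma> - g \<gamma>) \<in> Lp_set \<mu> p \<and> Lp_norm \<mu> p (\<lambda>\<gamma>. f n \<gamma> - g \<gamma>) \<le> e" if e: "0 < e" for e
  proof -
    obtain N where N: "\<forall>m\<ge>N. \<forall>n\<ge>N. Apn p (\<lambda>\<gamma>. f m \<gamma> - f n \<gamma>) < e" using cau[OF e] by blast
    have "(\<lambda>\<gamma>. f n \<gamma> - g \<gamma>) \<in> Lp_set \<mu> p \<and> Lp_norm \<mu> p (\<lambda>\<gamma>. f n \<gamma> - g \<gamma>) \<le> e" if n: "n \<ge> N" for n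
    proof -
      have b: "(\<lambda>\<gamma>. f n \<gamma> - f m \<gamma>) \<in> Lp_set \<mu> p \<and> Lp_norm \<mu> p (\<lambda>\<gamma>. f n \<gamma> - f m \<gamma>) \<le> e" if "m \<ge> N" for m
        using N n that in_A_nonneg[OF in_A_diff[OF fA fA], of n m] Lp_diff[OF p fL fL, of n m]
        by (force simp: Ap_norm_def)
      have l: "(\<lambda>m. f n \<gamma> - f m \<gamma>) \<longlonglongrightarrow> f n \<gamma> - g \<gamma>" for \<gamma> by (intro tendsto_intros g)
      show ?thesis using Lp_limit[OF p b Ap_measurable[OF in_A_diff[OF fA g(1)]] l] by blast
    qed
    then show ?thesis by blast
  qed
  have gL: "g \<in> Lp_set \<mu> p"
  proof -
    obtain N where "(\<lambda>\<gamma>. f N \<gamma> - g \<gamma>) \<in> Lp_set \<mu> p" using Lclose[of 1] by auto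
    from Lp_diff[OF p fL[of N] this] show ?thesis by simp
  qed
  show "\<exists>g\<in>?A. \<forall>e>0. \<exists>N. \<forall>n\<ge>N. Apn p (\<lambda>\<gamma>. f n \<gamma> - g \<gamma>) < e"
  proof (intro bexI[of _ g] allI impI)
    show "g \<in> ?A" using g(1) gL by (simp add: Ap_iff)
    fix e :: real assume "0 < e"
    then have e: "0 < e / 2" by simp
    obtain N where N: "\<forall>n\<ge>N. An (\<lambda>\<gamma>. f n \<gamma> - g \<gamma>) < e / 2" using g(3)[OF e] by blast
    obtain M where M: "\<forall>n\<ge>M. Lp_norm \<mu> p (\<lambda>\<gamma>. f n \<gamma> - g \<gamma>) \<le> e / 2" using Lclose[OF e] by blast
    have "Apn p (\<lambda>\<gamma>. f n \<gamma> - g \<gamma>) < e" if "n \<ge> max N M" for n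
      using N[rule_format, of n] M[rule_format, of n] that by (simp add: Ap_norm_def)
    then show "\<exists>N. \<forall>n\<ge>N. Apn p (\<lambda>\<gamma>. f n \<gamma> - g \<gamma>) < e" by blast
  qed
qed

theorem Ap_segal:
  assumes p: "1 \<le> p"
  shows "segal_algebra chi (closure V) (Ap_set chi (closure V) \<mu> p) (Apn p)"
  unfolding segal_algebra_def
proof (intro conjI ballI allI impI)
  let ?A = "Ap_set chi (closure V) \<mu> p"
  show "?A \<subseteq> Aalg chi (closure V)" by (simp add: Ap_set_def)
  show "(\<lambda>\<gamma>. \<phi> \<gamma> * \<psi> \<gamma>) \<in> ?A" if "\<phi> \<in> ?A" "\<psi> \<in> Aalg chi (closure V)" for \<phi> \<psi>
    using that by (auto simp: Ap_iff Aalg_iff intro: in_A_mult Lp_mult_A[OF p])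
  show "banach_fun_space ?A (Apn p)" by (rule Ap_banach[OF p])
  show "An \<phi> \<le> Apn p \<phi>" for \<phi> using Lp_norm_nonneg by (simp add: Ap_norm_def)
  show "Apn p (\<lambda>\<gamma>. \<phi> \<gamma> * \<psi> \<gamma>) \<le> Apn p \<phi> * An \<psi>" if "\<phi> \<in> ?A" "\<psi> \<in> Aalg chi (closure V)" for \<phi> \<psi>
  proof -
    have i: "in_A \<phi>" "in_A \<psi>" "\<phi> \<in> Lp_set \<mu> p" using that by (simp_all add: Ap_iff Aalg_iff)
    show ?thesis using in_A_mult(2)[OF i(1,2)] Lp_mult_A(2)[OF p i(3,1,2)]
      unfolding Ap_norm_def distrib_right by (simp add: mult.commute[of "Lp_norm \<mu> p \<phi>"])
  qed
  obtain C where C: "\<And>\<phi> e Q. in_A \<phi> \<Longrightarrow> 0 < e \<Longrightarrow> compact Q \<Longrightarrow>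
      \<exists>u K'. continuous_on UNIV u \<and> (\<forall>\<gamma>. 0 \<le> u \<gamma> \<and> u \<gamma> \<le> 1) \<and> (\<forall>\<gamma>\<in>Q. u \<gamma> = (1::real)) \<and> compact K' \<and>
        (\<forall>\<gamma>. \<gamma> \<notin> K' \<longrightarrow> u \<gamma> = 0) \<and> (\<forall>\<gamma>. loc_le (\<lambda>\<gamma>. complex_of_real (u \<gamma>)) \<gamma> C) \<and>
        An (\<lambda>\<gamma>. \<phi> \<gamma> - complex_of_real (u \<gamma>) * \<phi> \<gamma>) \<le> e"
    by (rule compact_approx_unit) blast
  show "\<exists>\<phi>\<in>?A. An (\<lambda>\<gamma>. \<psi> \<gamma> - \<phi> \<gamma>) < e" if \<psi>: "\<psi> \<in> Aalg chi (closure V)" and e: "0 < e" for \<psi> and e :: real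
  proof -
    have i: "in_A \<psi>" using \<psi> by (simp add: Aalg_iff)
    have e2: "0 < e / 2" using e by simp
    obtain u K' where u: "continuous_on UNIV u" "\<And>\<gamma>. 0 \<le> u \<gamma> \<and> u \<gamma> \<le> (1::real)"
      "compact K'" "\<And>\<gamma>. \<gamma> \<notin> K' \<Longrightarrow> u \<gamma> = 0" "\<And>\<gamma>. loc_le (\<lambda>\<gamma>. complex_of_real (u \<gamma>)) \<gamma> C"
      and le: "An (\<lambda>\<gamma>. \<psi> \<gamma> - complex_of_real (u \<gamma>) * \<psi> \<gamma>) \<le> e / 2"
      using C[OF i e2 compact_empty] by blast
    note uA = Ap_unit_in[OF p u]
    \<comment> \<open>The truncation is p-integrable because u is and \<psi> is bounded by its
      norm.\<close>
    have "(\<lambda>\<gamma>. complex_of_real (u \<gamma>) * \<psi> \<gamma>) \<in> ?A"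
      using in_A_mult(1)[OF uA(1) i] Lp_mult_A(1)[OF p uA(2,1) i] by (simp add: Ap_iff)
    then show ?thesis using le e by (intro bexI[of _ "\<lambda>\<gamma>. complex_of_real (u \<gamma>) * \<psi> \<gamma>"]) auto
  qed
  show "\<exists>u\<in>?A. Apn p (\<lambda>\<gamma>. \<phi> \<gamma> - u \<gamma> * \<phi> \<gamma>) < e" if \<phi>: "\<phi> \<in> ?A" and e: "0 < e" for \<phi> and e :: real
  proof -
    have i: "in_A \<phi>" "\<phi> \<in> Lp_set \<mu> p" using \<phi> by (simp_all add: Ap_iff)
    have e3: "0 < e / 3" using e by simp
    \<comment> \<open>K controls the L^p tail; passing it on as Q makes one u serve both norms, with
      error at most e / 3 in each.\<close>
    obtain K where K: "compact K" "\<And>u. continuous_on UNIV u \<Longrightarrow> (\<And>\<gamma>. 0 \<le> u \<gamma> \<and> u \<gamma> \<le> 1) \<Longrightarrow> (\<And>\<gamma>. \<gamma> \<in> K \<Longrightarrow> u \<gamma> = (1::real))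
    \<Longrightarrow> Lp_norm \<mu> p (\<lambda>\<gamma>. \<phi> \<gamma> - complex_of_real (u \<gamma>) * \<phi> \<gamma>) \<le> e / 3"
      by (rule Lp_tail[OF p i e3]) blast
    obtain u K' where u: "continuous_on UNIV u" "\<And>\<gamma>. 0 \<le> u \<gamma> \<and> u \<gamma> \<le> (1::real)"
      "compact K'" "\<And>\<gamma>. \<gamma> \<notin> K' \<Longrightarrow> u \<gamma> = 0" "\<And>\<gamma>. loc_le (\<lambda>\<gamma>. complex_of_real (u \<gamma>)) \<gamma> C"
      and u1: "\<And>\<gamma>. \<gamma> \<in> K \<Longrightarrow> u \<gamma> = 1"
      and le: "An (\<lambda>\<gamma>. \<phi> \<gamma> - complex_of_real (u \<gamma>) * \<phi> \<gamma>) \<le> e / 3"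
      using C[OF i(1) e3 K(1)] by blast
    have "(\<lambda>\<gamma>. complex_of_real (u \<gamma>)) \<in> ?A" using Ap_unit_in[OF p u] by (simp add: Ap_iff)
    moreover have "Apn p (\<lambda>\<gamma>. \<phi> \<gamma> - complex_of_real (u \<gamma>) * \<phi> \<gamma>) < e"
      using le K(2)[OF u(1,2) u1] e by (simp add: Ap_norm_def)
    ultimately show ?thesis by (intro bexI[of _ "\<lambda>\<gamma>. complex_of_real (u \<gamma>)"])
  qed
qed

theorem Ap_translation_invariant:
  "isom_transl_inv (Ap_set chi (closure V) \<mu> p) (Apn p)"
  unfolding isom_transl_inv_def
proof (intro ballI allI)
  fix \<psi> \<delta> assume "\<psi> \<in> Ap_set chi (closure V) \<mu> p"
  then have i: "in_A \<psi>" "\<psi> \<in> Lp_set \<mu> p" by (simp_all add: Ap_iff)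
  note t = in_A_translate[OF i(1), of \<delta>]
  have I: "Lp_int \<mu> p (\<lambda>\<gamma>. \<psi> (\<gamma> - \<delta>)) = Lp_int \<mu> p \<psi>" by (rule Lp_translate[OF Ap_measurable[OF i(1)]])
  show "(\<lambda>\<gamma>'. \<psi> (\<gamma>' - \<delta>)) \<in> Ap_set chi (closure V) \<mu> p \<and> Apn p (\<lambda>\<gamma>'. \<psi> (\<gamma>' - \<delta>)) = Apn p \<psi>"
    using t i(2) Ap_measurable[OF t(1)] I by (simp add: Ap_iff Lp_set_def Ap_norm_def Lp_norm_def)
qed

end

section \<open>Strictness of the inclusion\<close>

lemma avoiding_sequence:
  assumes "\<And>F. finite F \<Longrightarrow> \<exists>x. \<forall>y\<in>F. R x y"
  shows "\<exists>g :: nat \<Rightarrow> 'a. \<forall>m n. m < n \<longrightarrow> R (g n) (g m)"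
proof -
  define h where "h F = (SOME x. \<forall>y\<in>F. R x y)" for F
  have h: "R (h F) y" if "finite F" "y \<in> F" for F y
    using someI_ex[OF assms[OF that(1)]] that(2) unfolding h_def by blast
  define X where "X = rec_nat {} (\<lambda>_ F. insert (h F) F)"
  have X: "X 0 = {}" "X (Suc n) = insert (h (X n)) (X n)" for n by (simp_all add: X_def)
  have fin: "finite (X n)" for n by (induction n) (simp_all add: X)
  have sub: "h (X m) \<in> X n" if "m < n" for m n
    using that by (induction n) (auto simp: X less_Suc_eq)
  show ?thesis by (intro exI[of _ "\<lambda>n. h (X n)"] allI impI h fin sub)
qed

context dual_haar
begin

text \<open>Elements of the algebra are bounded by their norm, so the surplus power q - p is
  absorbed into a constant.\<close>

lemma Lp_int_A_mono:
  assumes A: "in_A \<psi>" and L: "\<psi> \<in> Lp_set \<mu> p" and pq: "0 \<le> p" "p \<le> q"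
  shows "\<psi> \<in> Lp_set \<mu> q"
proof -
  have m: "\<psi> \<in> borel_measurable \<mu>" by (rule Ap_measurable[OF A])
  have "Lp_int \<mu> q \<psi> \<le> (\<integral>\<^sup>+\<gamma>. ennreal (An \<psi> powr (q - p)) * ennreal (cmod (\<psi> \<gamma>) powr p) \<partial>\<mu>)"
  proof (rule nn_integral_mono)
    fix \<gamma>
    have "cmod (\<psi> \<gamma>) powr q = cmod (\<psi> \<gamma>) powr (q - p) * cmod (\<psi> \<gamma>) powr p"
      by (simp add: powr_add[symmetric])
    also have "\<dots> \<le> An \<psi> powr (q - p) * cmod (\<psi> \<gamma>) powr p"
      using pq in_A_point[OF A] by (intro mult_right_mono powr_mono2) auto
    finally show "ennreal (cmod (\<psi> \<gamma>) powr q) \<le> ennreal (An \<psi> powr (q - p)) * ennreal (cmod (\<psi> \<gamma>) powr p)"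
      by (simp add: ennreal_mult[symmetric] ennreal_leI)
  qed
  also have "\<dots> = ennreal (An \<psi> powr (q - p)) * Lp_int \<mu> p \<psi>"
  proof (rule nn_integral_cmult)
    show "(\<lambda>\<gamma>. ennreal (cmod (\<psi> \<gamma>) powr p)) \<in> borel_measurable \<mu>" using m by measurable
  qed
  also have "\<dots> < \<infinity>" using L by (simp add: Lp_set_def ennreal_mult_less_top)
  finally show ?thesis using m by (simp add: Lp_set_def)
qed

text \<open>P consists of the \<gamma> whose window meets S, the set carrying b. Finitely many
  translates of the compact set D = P - P cannot cover the dual, so centres g n exist whose
  differences avoid D; each window then sees at most one bump, and local norms of the infinite sum
  are those of a single term.\<close>

theorem Ap_strict_subset:
  assumes nc: "\<not> compact (UNIV :: 'c set)" and p: "1 \<le> p" and pq: "p < q"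
  shows "Ap_set chi (closure V) \<mu> p \<subset> Ap_set chi (closure V) \<mu> q"
proof -
  have q: "1 \<le> q" using p pq by simp
  obtain b :: "'c \<Rightarrow> real" and K0 L S where K0: "compact K0" and L: "0 \<le> L" and bl: "dlip K0 L b" and S: "compact S"
    and b0: "\<And>\<gamma>. 0 \<le> b \<gamma>" and bS: "\<And>\<gamma>. \<gamma> \<notin> S \<Longrightarrow> b \<gamma> = 0" and bp: "0 < b 0"
    and pd: "pos_def_fun (\<lambda>\<gamma>. complex_of_real (b \<gamma>))"
    by (rule pos_def_bump) blast
  have bc: "continuous_on UNIV b" by (rule dlip_continuous[OF K0 L bl])
  have lb: "loc_le (\<lambda>\<gamma>. complex_of_real (b \<gamma>)) \<gamma> (b 0)" for \<gamma> using pos_def_loc_le[OF pd] by simp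
  have bB: "b \<gamma> \<le> b 0" for \<gamma> using loc_le_point[OF lb nb_self, of \<gamma>] b0[of \<gamma>] by simp
  define P where "P = {s - v |s v. s \<in> S \<and> v \<in> closure V}"
  define D where "D = {x - y |x y. x \<in> P \<and> y \<in> P}"
  have P: "compact P" unfolding P_def by (intro dual_compact_diff S V_compact)
  have D: "compact D" unfolding D_def by (intro dual_compact_diff P)
  have "\<exists>x. \<forall>y\<in>F. x - y \<notin> D" if F: "finite F" for F
  proof (rule ccontr)
    assume n: "\<not> ?thesis"
    have "x \<in> {x + y |x y. x \<in> F \<and> y \<in> D}" for x
    proof -
      obtain y where "y \<in> F" "x - y \<in> D" using n by blast
      moreover have "x = y + (x - y)" by simp
      ultimately show ?thesis by blast
    qed
    then have "{x + y |x y. x \<in> F \<and> y \<in> D} = UNIV" by blast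
    moreover have "compact {x + y |x y. x \<in> F \<and> y \<in> D}" by (intro dual_compact_add D finite_imp_compact F)
    ultimately show False using nc by simp
  qed
  then obtain g :: "nat \<Rightarrow> 'c" where g: "\<And>m n. m < n \<Longrightarrow> g n - g m \<notin> D"
    using avoiding_sequence[of "\<lambda>x y. x - y \<notin> D"] by blast
  have sep: "m = n" if "\<gamma> - g m \<in> P" "\<gamma> - g n \<in> P" for \<gamma> m n
  proof (rule ccontr)
    assume "m \<noteq> n"
    have "g n - g m = (\<gamma> - g m) - (\<gamma> - g n)" "g m - g n = (\<gamma> - g n) - (\<gamma> - g m)" by simp_all
    then have "g n - g m \<in> D" "g m - g n \<in> D" unfolding D_def using that by blast+
    then show False using g[of m n] g[of n m] \<open>m \<noteq> n\<close> by (cases "m < n") auto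
  qed
  \<comment> \<open>The p-th powers are 1 / (n + 1), a divergent series, while the q-th powers have
    exponent - q / p < -1. As a n tends to 0, the sum still lies in the algebra.\<close>
  define a where "a n = real (Suc n) powr (- 1 / p)" for n
  have a0: "0 \<le> a n" for n by (simp add: a_def)
  have a1: "a n \<le> 1" for n
    unfolding a_def using p powr_mono2'[of "- 1 / p" 1 "real (Suc n)"] by simp
  have near: "\<gamma> - g n \<in> P" if d: "\<delta> \<in> nb \<gamma>" and nz: "b (\<delta> - g n) \<noteq> 0" for \<gamma> \<delta> n
  proof -
    obtain v where v: "v \<in> closure V" "\<delta> = v + \<gamma>" using d by blast
    have "\<gamma> - g n = (\<delta> - g n) - v" using v(2) by (simp add: algebra_simps)
    moreover have "\<delta> - g n \<in> S" using bS nz by blast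
    ultimately show ?thesis unfolding P_def using v(1) by blast
  qed
  \<comment> \<open>At every point at most one term is nonzero, so convergence of the series is
    immediate.\<close>
  define \<psi> where "\<psi> \<gamma> = (suminf (\<lambda>n. complex_of_real (a n * b (\<gamma> - g n))))" for \<gamma>
  have one: "\<psi> \<delta> = complex_of_real (a n * b (\<delta> - g n))" if n: "\<gamma> - g n \<in> P" and d: "\<delta> \<in> nb \<gamma>" for \<gamma> \<delta> n
  proof -
    have "b (\<delta> - g m) = 0" if "m \<noteq> n" for m using near[OF d, of m] sep[OF n, of m] that by auto
    then have "(\<lambda>m. complex_of_real (a m * b (\<delta> - g m))) = (\<lambda>m. if m = n then complex_of_real (a m * b (\<delta> - g m)) else 0)"
      by auto
    then have "(\<lambda>m. complex_of_real (a m * b (\<delta> - g m))) sums complex_of_real (a n * b (\<delta> - g n))"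
      using sums_single[of n "\<lambda>m. complex_of_real (a m * b (\<delta> - g m))"] by simp
    then show ?thesis unfolding \<psi>_def by (rule sums_unique[symmetric])
  qed
  have none: "\<psi> \<delta> = 0" if n: "\<And>n. \<gamma> - g n \<notin> P" and d: "\<delta> \<in> nb \<gamma>" for \<gamma> \<delta>
  proof -
    have "b (\<delta> - g m) = 0" for m using near[OF d, of m] n by auto
    then show ?thesis by (simp add: \<psi>_def)
  qed
  have btc: "continuous_on UNIV (\<lambda>\<gamma>. complex_of_real (a n * b (\<gamma> - g n)))" for n
    by (intro continuous_intros continuous_on_compose2[OF bc] dual_continuous_diff) auto
  \<comment> \<open>The window at \<gamma> is a neighbourhood of \<gamma> on which \<psi> is one
    continuous term or zero; this gives continuity without uniform convergence.\<close>
  have near_form: "\<exists>h. continuous_on UNIV h \<and> (\<forall>\<delta>\<in>nb \<gamma>. \<psi> \<delta> = h \<delta>)" for \<gamma>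
  proof (cases "\<exists>n. \<gamma> - g n \<in> P")
    case True
    then show ?thesis using one btc by blast
  next
    case False
    then show ?thesis using none[of \<gamma>] by (intro exI[of _ "\<lambda>_. 0"]) auto
  qed
  have cont: "continuous_on UNIV \<psi>"
  proof (rule continuous_on_UNIV_nhdI)
    fix \<gamma> and e :: real assume e: "0 < e"
    obtain h where h: "continuous_on UNIV h" "\<And>\<delta>. \<delta> \<in> nb \<gamma> \<Longrightarrow> \<psi> \<delta> = h \<delta>" using near_form[of \<gamma>] by blast
    define U where "U = {\<delta>. \<delta> - \<gamma> \<in> V} \<inter> {\<delta>. dist (h \<delta>) (h \<gamma>) < e}"
    have "open U"
      unfolding U_def by (intro open_Int dual_open_translate V_open open_Collect_less continuous_intros h)
    moreover have "\<gamma> \<in> U" using e V_0 by (simp add: U_def)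
    moreover have "dist (\<psi> \<delta>) (\<psi> \<gamma>) < e" if "\<delta> \<in> U" for \<delta>
    proof -
      have "\<delta> - \<gamma> \<in> closure V" using that closure_subset by (auto simp: U_def)
      then have "\<delta> \<in> nb \<gamma>" by (intro image_eqI[of _ _ "\<delta> - \<gamma>"]) simp_all
      then show ?thesis using that h(2) nb_self[of \<gamma>] by (simp add: U_def)
    qed
    ultimately show "\<exists>U. open U \<and> \<gamma> \<in> U \<and> (\<forall>y\<in>U. dist (\<psi> y) (\<psi> \<gamma>) < e)" by blast
  qed
  have locn: "loc_le \<psi> \<gamma> (a n * b 0)" if n: "\<gamma> - g n \<in> P" for \<gamma> n
  proof (rule loc_le_cong)
    have "loc_le (\<lambda>\<gamma>. complex_of_real (a n) * complex_of_real (b (\<gamma> - g n))) \<gamma> (cmod (complex_of_real (a n)) * b 0)"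
      by (intro loc_le_scale loc_le_translate[OF lb])
    then show "loc_le (\<lambda>\<gamma>. complex_of_real (a n * b (\<gamma> - g n))) \<gamma> (a n * b 0)" using a0[of n] by simp
    show "complex_of_real (a n * b (\<delta> - g n)) = \<psi> \<delta>" if "\<delta> \<in> nb \<gamma>" for \<delta> using one[OF n that] by simp
  qed
  have A: "in_A \<psi>"
  proof (rule in_AI[OF cont])
    show "loc_le \<psi> \<gamma> (b 0)" for \<gamma>
    proof (cases "\<exists>n. \<gamma> - g n \<in> P")
      case True
      then obtain n where n: "\<gamma> - g n \<in> P" by blast
      have "a n * b 0 \<le> b 0" using a1[of n] bp by simp
      then show ?thesis using loc_le_mono[OF locn[OF n]] by blast
    next
      case False
      then show ?thesis using none[of \<gamma>] bp by (intro loc_le_vanish) auto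
    qed
    fix e :: real assume e: "0 < e"
    have "a \<longlonglongrightarrow> 0"
    proof -
      have "(\<lambda>n. real n powr (- 1 / p)) \<longlonglongrightarrow> 0"
        using p by (intro tendsto_neg_powr filterlim_real_sequentially) auto
      then show ?thesis unfolding a_def by (rule LIMSEQ_Suc)
    qed
    then have "(\<lambda>n. a n * b 0) \<longlonglongrightarrow> 0" by (rule tendsto_mult_left_zero)
    then have "\<forall>\<^sub>F n in sequentially. a n * b 0 < e" using e by (rule order_tendstoD(2))
    then obtain N where N: "\<And>n. n \<ge> N \<Longrightarrow> a n * b 0 < e" by (auto simp: eventually_sequentially)
    \<comment> \<open>Outside K only bumps of index at least N are visible, and their local norms
      are below e.\<close>
    define K where "K = {x + y |x y. x \<in> g ` {..<N} \<and> y \<in> P}"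
    have "compact K" unfolding K_def by (intro dual_compact_add P finite_imp_compact) simp
    moreover have "loc_le \<psi> \<gamma> e" if k: "\<gamma> \<notin> K" for \<gamma>
    proof (cases "\<exists>n. \<gamma> - g n \<in> P")
      case True
      then obtain n where n: "\<gamma> - g n \<in> P" by blast
      have "\<gamma> = g n + (\<gamma> - g n)" by simp
      then have "\<not> n < N" using k n unfolding K_def by blast
      then have "a n * b 0 \<le> e" using N[of n] by simp
      then show ?thesis using loc_le_mono[OF locn[OF n]] by blast
    next
      case False
      then show ?thesis using none[of \<gamma>] e by (intro loc_le_vanish) auto
    qed
    ultimately show "\<exists>K. compact K \<and> (\<forall>\<gamma>. \<gamma> \<notin> K \<longrightarrow> loc_le \<psi> \<gamma> e)" by blast
  qed
  define \<kappa> where "\<kappa> r = (\<integral>\<gamma>. b \<gamma> powr r \<partial>\<mu>)" for r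
  have brc: "continuous_on UNIV (\<lambda>\<gamma>. b \<gamma> powr r)" if "1 \<le> r" for r
    using that b0 by (intro continuous_on_powr' bc continuous_on_const) auto
  have bri: "integrable \<mu> (\<lambda>\<gamma>. b \<gamma> powr r)" if "1 \<le> r" for r
    by (rule integrable_cpt[OF measurable_continuous[OF brc[OF that]] S, of "b 0 powr r"])
      (use that bS bB b0 in \<open>auto intro: powr_mono2\<close>)
  have \<kappa>: "0 < \<kappa> r" if "1 \<le> r" for r
    unfolding \<kappa>_def by (rule integral_pos[OF brc[OF that] _ bri[OF that], of 0]) (use bp in auto)
  have \<psi>int: "Lp_int \<mu> r \<psi> = (suminf (\<lambda>n. ennreal (a n powr r * \<kappa> r)))" if r: "1 \<le> r" for r
  proof -
    \<comment> \<open>Since the bumps do not overlap, the r-th power of the sum is the sum of the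
      r-th powers, and the integral becomes a numerical series.\<close>
    have pt: "ennreal (cmod (\<psi> \<gamma>) powr r) = (suminf (\<lambda>n. ennreal (a n powr r) * ennreal (b (- g n + \<gamma>) powr r)))" for \<gamma>
    proof (cases "\<exists>n. \<gamma> - g n \<in> P")
      case True
      then obtain n where n: "\<gamma> - g n \<in> P" by blast
      have z: "b (- g m + \<gamma>) = 0" if "m \<noteq> n" for m
        using near[OF nb_self, of \<gamma> m] sep[OF n, of m] that by auto
      have "(suminf (\<lambda>m. ennreal (a m powr r) * ennreal (b (- g m + \<gamma>) powr r)))
          = (\<Sum>m\<in>{n}. ennreal (a m powr r) * ennreal (b (- g m + \<gamma>) powr r))"
        using z by (intro suminf_finite) auto
      moreover have "cmod (\<psi> \<gamma>) = a n * b (- g n + \<gamma>)"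
        using one[OF n nb_self] a0[of n] b0[of "\<gamma> - g n"] by (simp add: norm_mult)
      ultimately show ?thesis using a0 b0 by (simp add: powr_mult ennreal_mult)
    next
      case False
      then have "b (- g m + \<gamma>) = 0" for m using near[OF nb_self, of \<gamma> m] by auto
      moreover have "\<psi> \<gamma> = 0" using none[OF _ nb_self] False by blast
      ultimately show ?thesis by simp
    qed
    have bm: "(\<lambda>\<gamma>. ennreal (b \<gamma> powr r)) \<in> borel_measurable \<mu>"
      using measurable_continuous[OF bc] by measurable
    have bmt: "(\<lambda>\<gamma>. ennreal (b (- g n + \<gamma>) powr r)) \<in> borel_measurable \<mu>" for n
      using measurable_compose[OF measurable_translate bm] .
    have "Lp_int \<mu> r \<psi> = (suminf (\<lambda>n. \<integral>\<^sup>+\<gamma>. ennreal (a n powr r) * ennreal (b (- g n + \<gamma>) powr r) \<partial>\<mu>))"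
      unfolding pt by (intro nn_integral_suminf borel_measurable_times_ennreal bmt) auto
    also have "\<dots> = (suminf (\<lambda>n. ennreal (a n powr r * \<kappa> r)))"
    proof (intro suminf_cong)
      fix n
      have "(\<integral>\<^sup>+\<gamma>. ennreal (a n powr r) * ennreal (b (- g n + \<gamma>) powr r) \<partial>\<mu>)
          = ennreal (a n powr r) * (\<integral>\<^sup>+\<gamma>. ennreal (b \<gamma> powr r) \<partial>\<mu>)"
        using nn_integral_cmult[OF bmt, of "ennreal (a n powr r)" n] nn_integral_translate[OF bm, of "- g n"] by simp
      also have "(\<integral>\<^sup>+\<gamma>. ennreal (b \<gamma> powr r) \<partial>\<mu>) = ennreal (\<kappa> r)"
        unfolding \<kappa>_def by (rule nn_integral_eq_integral[OF bri[OF r]]) simp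
      finally show "(\<integral>\<^sup>+\<gamma>. ennreal (a n powr r) * ennreal (b (- g n + \<gamma>) powr r) \<partial>\<mu>) = ennreal (a n powr r * \<kappa> r)"
        using \<kappa>[OF r] by (simp add: ennreal_mult)
    qed
    finally show ?thesis .
  qed
  have apow: "a n powr r = real (Suc n) powr (- r / p)" for n r
    by (simp add: a_def powr_powr)
  have summ: "summable (\<lambda>n. a n powr r) \<longleftrightarrow> - r / p < - 1" for r
    unfolding apow using summable_Suc_iff[of "\<lambda>n. real n powr (- r / p)"] summable_real_powr_iff[of "- r / p"] by simp
  have m: "\<psi> \<in> borel_measurable \<mu>" by (rule Ap_measurable[OF A])
  have "\<psi> \<in> Lp_set \<mu> q"
  proof -
    have "summable (\<lambda>n. a n powr q)" using p pq by (simp add: summ field_simps)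
    then have s: "summable (\<lambda>n. a n powr q * \<kappa> q)" by (rule summable_mult2)
    have "Lp_int \<mu> q \<psi> = ennreal (suminf (\<lambda>n. a n powr q * \<kappa> q))"
      unfolding \<psi>int[OF q] using \<kappa>[OF q] by (intro suminf_ennreal2 s) auto
    then show ?thesis using m by (simp add: Lp_set_def)
  qed
  moreover have "\<psi> \<notin> Lp_set \<mu> p"
  proof
    assume "\<psi> \<in> Lp_set \<mu> p"
    then have "(suminf (\<lambda>n. ennreal (a n powr p * \<kappa> p))) \<noteq> top" using \<psi>int[OF p] by (simp add: Lp_set_def less_top)
    then have "summable (\<lambda>n. a n powr p * \<kappa> p)" using \<kappa>[OF p] by (intro summable_suminf_not_top) auto
    then have "summable (\<lambda>n. a n powr p * \<kappa> p * inverse (\<kappa> p))" by (rule summable_mult2)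
    then have "summable (\<lambda>n. a n powr p)" using \<kappa>[OF p] by (simp add: mult.assoc)
    then show False using p by (simp add: summ)
  qed
  ultimately have "\<psi> \<in> Ap_set chi (closure V) \<mu> q" "\<psi> \<notin> Ap_set chi (closure V) \<mu> p" using A by (simp_all add: Ap_iff)
  moreover have "Ap_set chi (closure V) \<mu> p \<subseteq> Ap_set chi (closure V) \<mu> q"
    using Lp_int_A_mono p pq by (auto simp: Ap_iff)
  ultimately show ?thesis by blast
qed

end

theorem theorem6p4:
  fixes chi :: "'g::{topological_ab_group_add,t2_space} \<Rightarrow> 'c::{topological_space,ab_group_add} \<Rightarrow> complex"
    and V :: "'c set" and \<mu> :: "'c measure" and p q :: real
  assumes "LCA_group TYPE('g)"
    and "\<not> open {0::'g}"
    and "dual_pairing chi"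
    and "haar_measure \<mu>"
    and "open V" and "0 \<in> V" and "compact (closure V)"
    and "1 \<le> p" and "p < q"
  shows "segal_algebra chi (closure V) (Ap_set chi (closure V) \<mu> p) (Ap_norm chi (closure V) \<mu> p)
       \<and> isom_transl_inv (Ap_set chi (closure V) \<mu> p) (Ap_norm chi (closure V) \<mu> p)
       \<and> Ap_set chi (closure V) \<mu> p \<subset> Ap_set chi (closure V) \<mu> q"
proof -
  interpret dual_haar chi V \<mu> by unfold_locales (rule assms)+
  have "\<not> compact (UNIV :: 'c set)" by (rule dual_not_compact[OF assms(1,2)])
  then show ?thesis
    using Ap_segal Ap_translation_invariant Ap_strict_subset assms(8,9) by blast
qed

end
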